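(* Let $\tau\in\mathbb{R}\setminus\mathbb{Q}$ and $m\in\mathbb{N}$, $m\ge1$. Then there exists a $\mathbb{Z}_m$-equivariant admissible map $h:\mathbb{R}^2\to\mathbb{R}^2$, with asymptotically stable fixed point at the origin and basin of attraction $U$, whose rotation number is $\rho(h,U)=\bar\tau$, and such that the homeomorphism $h^*$ induced by $h$ on the circle of prime ends of $U$ is topologically conjugate to a $\mathbb{Z}_m$-equivariant Denjoy map of $\mathbb{T}$.
   Context: $\mathbb{Z}_m$ acts on $\mathbb{R}^2$ by the rotations about the origin by angles $2\pi k/m$, $k=0,\dots,m-1$; $h$ is $\mathbb{Z}_m$-equivariant if $h(\sigma x)=\sigma h(x)$ for all $x\in\mathbb{R}^2$ and $\sigma\in\mathbb{Z}_m$. On $\mathbb{T}=\mathbb{R}/\mathbb{Z}$, a map $g$ is $\mathbb{Z}_m$-equivariant if $g(\bar\theta+\tfrac1m)=g(\bar\theta)+\tfrac1m$. An admissible ($U$-admissible) map is a dissipative (there is a compact set attracting every orbit), orientation preserving homeomorphism $h$ of $\mathbb{R}^2$ having an asymptotically stable fixed point whose basin of attraction $U$ is unbounded and proper ($U\neq\mathbb{R}^2$). By Carathéodory's prime end theory, $h$ induces an orientation preserving homeomorphism $h^*$ of the space of prime ends of $U$, which is homeomorphic to the circle $\mathbb{T}$; the rotation number $\rho(h,U)\in\mathbb{T}$ is defined as the rotation number of $h^*$. A Denjoy map is an orientation preserving homeomorphism of $\mathbb{T}$ with irrational rotation number which is not topologically conjugate to any rotation. *)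

theory Defs
  imports "HOL-Analysis.Analysis"
begin

text \<open>The plane R^2 is identified with the complex numbers; the circle T = R/Z is
identified with the unit circle via x mod 1 maps to exp(2 pi i x).\<close>

definition circ :: "real \<Rightarrow> complex" where
  "circ x = cis (2 * pi * x)"

abbreviation S1 :: "complex set" where
  "S1 \<equiv> sphere 0 1"

definition circle_lift :: "(real \<Rightarrow> real) \<Rightarrow> (complex \<Rightarrow> complex) \<Rightarrow> bool" where
  "circle_lift F f \<longleftrightarrow> continuous_on UNIV F \<and> strict_mono F \<and> (\<forall>x. F (x + 1) = F x + 1)
      \<and> (\<forall>x. f (circ x) = circ (F x))"

definition op_circle_homeo :: "(complex \<Rightarrow> complex) \<Rightarrow> bool" where
  "op_circle_homeo f \<longleftrightarrow> (\<exists>F. circle_lift F f)"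

definition has_rotation_number :: "(complex \<Rightarrow> complex) \<Rightarrow> real \<Rightarrow> bool" where
  "has_rotation_number f t \<longleftrightarrow>
     (\<exists>F s. circle_lift F f \<and> ((\<lambda>n. (F ^^ n) 0 / real n) \<longlonglongrightarrow> s) \<and> s - t \<in> \<int>)"

definition top_conj_circle :: "(complex \<Rightarrow> complex) \<Rightarrow> (complex \<Rightarrow> complex) \<Rightarrow> bool" where
  "top_conj_circle f g \<longleftrightarrow>
     (\<exists>k k'. homeomorphism S1 S1 k k' \<and> (\<forall>z\<in>S1. k (f z) = g (k z)))"

definition denjoy_map :: "(complex \<Rightarrow> complex) \<Rightarrow> bool" where
  "denjoy_map f \<longleftrightarrow> op_circle_homeo f \<and> (\<exists>t. t \<notin> \<rat> \<and> has_rotation_number f t)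
     \<and> \<not> (\<exists>\<alpha>. top_conj_circle f (\<lambda>z. circ \<alpha> * z))"

definition circle_equivariant :: "nat \<Rightarrow> (complex \<Rightarrow> complex) \<Rightarrow> bool" where
  "circle_equivariant m g \<longleftrightarrow> (\<forall>z\<in>S1. g (circ (1 / real m) * z) = circ (1 / real m) * g z)"

definition plane_equivariant :: "nat \<Rightarrow> (complex \<Rightarrow> complex) \<Rightarrow> bool" where
  "plane_equivariant m h \<longleftrightarrow>
     (\<forall>k::nat. \<forall>x. h (circ (real k / real m) * x) = circ (real k / real m) * h x)"

text \<open>Orientation preserving (for a homeomorphism of the plane): the image of every small
circle around p winds once positively around h p (degree +1), via a continuous angle lift.\<close>
definition orientation_preserving :: "(complex \<Rightarrow> complex) \<Rightarrow> bool" where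
  "orientation_preserving h \<longleftrightarrow>
     (\<forall>p r. r > 0 \<longrightarrow> (\<exists>\<theta>. continuous_on {0..1} \<theta> \<and>
        (\<forall>t\<in>{0..1}. h (p + of_real r * circ t) - h p
                     = of_real (cmod (h (p + of_real r * circ t) - h p)) * circ (\<theta> t)) \<and>
        \<theta> 1 - \<theta> 0 = 1))"

definition dissipative :: "(complex \<Rightarrow> complex) \<Rightarrow> bool" where
  "dissipative h \<longleftrightarrow> (\<exists>K. compact K \<and> K \<noteq> {} \<and>
      (\<forall>x. ((\<lambda>n. infdist ((h ^^ n) x) K) \<longlonglongrightarrow> 0)))"

definition basin :: "(complex \<Rightarrow> complex) \<Rightarrow> complex \<Rightarrow> complex set" where
  "basin h p = {x. ((\<lambda>n. (h ^^ n) x) \<longlonglongrightarrow> p)}"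

definition asymp_stable_fixed :: "(complex \<Rightarrow> complex) \<Rightarrow> complex \<Rightarrow> bool" where
  "asymp_stable_fixed h p \<longleftrightarrow> h p = p
     \<and> (\<forall>\<epsilon>>0. \<exists>\<delta>>0. \<forall>x. dist x p < \<delta> \<longrightarrow> (\<forall>n. dist ((h ^^ n) x) p < \<epsilon>))
     \<and> p \<in> interior (basin h p)"

definition admissible :: "(complex \<Rightarrow> complex) \<Rightarrow> complex \<Rightarrow> bool" where
  "admissible h p \<longleftrightarrow> (\<exists>h'. homeomorphism UNIV UNIV h h') \<and> orientation_preserving h
     \<and> dissipative h \<and> asymp_stable_fixed h p
     \<and> \<not> bounded (basin h p) \<and> basin h p \<noteq> UNIV"

text \<open>Prime ends via Caratheodory: for a Riemann map phi from the unit disc onto U, the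
prime ends of U correspond to the unit circle, and the homeomorphism h* induced by h is
the boundary extension of phi^-1 o h o phi to the closed disc.\<close>
definition induced_prime_end_map ::
    "(complex \<Rightarrow> complex) \<Rightarrow> complex set \<Rightarrow> (complex \<Rightarrow> complex) \<Rightarrow> bool" where
  "induced_prime_end_map h U H \<longleftrightarrow>
     (\<exists>\<phi>. \<phi> holomorphic_on ball 0 1 \<and> bij_betw \<phi> (ball 0 1) U \<and>
        continuous_on (cball 0 1)
          (\<lambda>z. if cmod z < 1 then inv_into (ball 0 1) \<phi> (h (\<phi> z)) else H z))"

end

theory Submission
  imports Defs "HOL-Complex_Analysis.Complex_Analysis"
begin

text \<open>Let \<open>F\<close> be a lift of a Denjoy homeomorphism with rotation number \<open>\<tau>\<close> that commutes with the
translation by \<open>1/m\<close>, and \<open>C\<close> a closed invariant set without interior. The map \<open>h\<close> acts by \<open>F\<close> on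
angles; it fixes the unit circle over \<open>C\<close> radially, attracts the rays over \<open>C\<close> to that circle, and
pushes every other ray into the unit disc. Hence the basin of \<open>0\<close> is the plane minus the rays
\<open>r \<ge> 1\<close> over \<open>C\<close>, a starlike domain.

By the Schwarz lemma the angle of the Riemann map is increasing along each circle \<open>|z| = r\<close>.
Koebe's argument shows that its level curves end at points \<open>X \<theta>\<close> of the unit circle, and that the
monotone map \<open>X\<close> jumps only at end points of gaps of \<open>C\<close>, towards the gap. Next to such an end
point both the Riemann map and its inverse extend continuously to the sides of the slit, and no
nonconstant map is constant there. This rules out two different boundary values of the conjugate
of \<open>h\<close>, which therefore extends to the circle of prime ends. The extension \<open>H\<close> satisfies
\<open>H (X \<theta>) = X (F \<theta>)\<close>, so it has rotation number \<open>\<tau>\<close>, and the arc between the values of \<open>X\<close> at the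
two ends of a gap wanders. Since the Riemann map is equivariant, \<open>H\<close> itself is the required
Denjoy map.\<close>

subsection \<open>Boundary behaviour of holomorphic functions\<close>

text \<open>The slits may accumulate on one another, so the boundary of the basin need not be
  locally connected and no continuous extension of the Riemann map itself to the closed disc is
  available. Only the conjugate of \<open>h\<close> is extended: its cluster values at a boundary
  point form an interval, and the analysis serves to show that this interval is a point. The tool
  behind Koebe's argument is a quantitative maximum principle: a bounded holomorphic function that
  is small on a set separating a fixed point from a boundary interval is small at that point. It is
  applied to nowhere vanishing functions that tend to 0 at the tip of a slit or at infinity.
  Everything happens in the coordinate \<open>s\<close> with
  \<open>z = exp (2 \<pi> \<i> s)\<close>, where angles are real numbers and can be compared by
  order. There the radial map halves heights outside the disc, while the inward displacement decays
  at most by the factor 2/3 along an orbit; since 2/3 exceeds 1/2, every ray off \<open>C\<close> is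
  pushed in. Commutation with the translation by \<open>1/m\<close> comes from rescaling a lift with
  rotation number \<open>m \<tau>\<close>.\<close>

lemma Re_le_of_frontier:
  fixes g :: "complex \<Rightarrow> complex" and q :: "complex \<Rightarrow> real"
  assumes S: "open S" "bounded S" and g: "g holomorphic_on S"
    and q: "continuous_on (closure S) q" "\<And>z. z \<in> S \<Longrightarrow> q z = Re (g z)"
    and fr: "\<And>z. z \<in> frontier S \<Longrightarrow> q z \<le> B" and z: "z \<in> S"
  shows "Re (g z) \<le> B"
proof (rule ccontr)
  assume nle: "\<not> Re (g z) \<le> B"
  have co: "compact (closure S)" using S by (simp add: compact_closure)
  have ne: "closure S \<noteq> {}" using z closure_subset by blast
  obtain p where p: "p \<in> closure S" "\<And>w. w \<in> closure S \<Longrightarrow> q w \<le> q p"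
    using continuous_attains_sup[OF co ne q(1)] by blast
  have pB: "q p > B" using p(2)[of z] z q(2)[OF z] nle closure_subset[of S] by fastforce
  \<comment> \<open>\<open>q\<close> extends only the real part of \<open>g\<close>, so the maximum
    is examined locally: at the rightmost point of the compact set of maxima, the maximum modulus
    principle makes \<open>exp g\<close> constant nearby, which yields a maximum point further to
    the right.\<close>
  define K where "K = {w \<in> closure S. q w = q p}"
  have "closed K"
    unfolding K_def by (rule continuous_closed_preimage_constant[OF q(1) closed_closure])
  then have "compact (closure S \<inter> K)" using co by blast
  moreover have "closure S \<inter> K = K" by (auto simp: K_def)
  ultimately have cK: "compact K" by simp
  have "p \<in> K" using p by (simp add: K_def)
  then obtain w where w: "w \<in> K" "\<And>v. v \<in> K \<Longrightarrow> Re v \<le> Re w"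
    using continuous_attains_sup[OF cK, of Re] continuous_on_Re[OF continuous_on_id] by blast
  have wq: "q w = q p" using w by (simp add: K_def)
  have "w \<notin> frontier S" using fr pB wq by force
  then have wS: "w \<in> S" using w S(1) by (auto simp: K_def frontier_def interior_open)
  obtain e where e: "e > 0" "ball w e \<subseteq> S" using S(1) wS open_contains_ball by blast
  have "(\<lambda>z. exp (g z)) constant_on ball w e"
  proof (rule maximum_modulus_principle[of _ _ "ball w e" w])
    show "(\<lambda>z. exp (g z)) holomorphic_on ball w e"
      by (intro holomorphic_intros holomorphic_on_subset[OF g e(2)])
    fix z assume "z \<in> ball w e"
    then have zS: "z \<in> S" using e by blast
    then have "q z \<le> q w" using p(2) wq closure_subset by fastforce
    then show "cmod (exp (g z)) \<le> cmod (exp (g w))"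
      by (simp add: norm_exp_eq_Re q(2)[OF zS] q(2)[OF wS])
  qed (use e in auto)
  moreover define v where "v = w + of_real (e/2)"
  moreover have "v \<in> ball w e" using e by (simp add: v_def dist_norm)
  moreover have "w \<in> ball w e" using e by simp
  ultimately have "exp (g v) = exp (g w)"
    unfolding constant_on_def by fastforce
  then have "Re (g v) = Re (g w)" using norm_exp_eq_Re[of "g v"] norm_exp_eq_Re[of "g w"] by simp
  moreover have vS: "v \<in> S" using \<open>v \<in> ball w e\<close> e by blast
  ultimately have "v \<in> K" using q(2)[OF vS] q(2)[OF wS] wq closure_subset by (fastforce simp: K_def)
  then show False using w(2)[of v] e(1) by (simp add: v_def)
qed

text \<open>The barrier \<open>sin (l (x - a)) sinh (l (2 - y))\<close> is the real part of \<open>E\<close>; it vanishes on the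
left, right and upper sides of the rectangle, so only the zero set of \<open>P\<close> matters below.\<close>

lemma sweep_bound:
  fixes f :: "complex \<Rightarrow> complex" and P :: "complex \<Rightarrow> real"
  assumes f: "f holomorphic_on {s. Im s > 0}" "\<And>s. Im s > 0 \<Longrightarrow> cmod (f s) \<le> 1"
    and ab: "a < b" and y: "0 < y1" "y1 < y0" "y0 < 1"
    and P: "continuous_on {s. Im s > 0} P"
    and top: "\<And>x. x \<in> {a..b} \<Longrightarrow> P (Complex x y0) < 0"
    and bot: "\<And>x. x \<in> {a..b} \<Longrightarrow> P (Complex x y1) > 0"
    and small: "\<And>s. Re s \<in> {a..b} \<Longrightarrow> Im s \<in> {y1..y0} \<Longrightarrow> P s = 0 \<Longrightarrow> cmod (f s) \<le> \<epsilon>"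
    and \<epsilon>: "0 < \<epsilon>" "\<epsilon> \<le> 1"
  shows "cmod (f (Complex ((a+b)/2) 1)) \<le> \<epsilon> powr (sinh (pi/(b-a)) / sinh (2*pi/(b-a)))"
proof -
  define l where "l = pi / (b - a)"
  have l: "l > 0" using ab by (simp add: l_def)
  define E where "E = (\<lambda>s::complex. - \<i> * cos (of_real l * (s - of_real a - 2 * \<i>)))"
  have E: "Re (E s) = sin (l * (Re s - a)) * sinh (l * (2 - Im s))" for s
    unfolding E_def
    by (simp add: Im_cos sinh_field_def algebra_simps)
  define B where "B = sinh (2 * l)"
  have B: "B > 0" using l by (simp add: B_def)
  \<comment> \<open>The largest weight allowed where \<open>cmod (f s) \<le> \<epsilon>\<close>: the
    barrier is at most \<open>B\<close>, and
    \<open>\<epsilon> * exp (\<kappa> * B) = 1\<close>.\<close>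
  define \<kappa> where "\<kappa> = - ln \<epsilon> / B"
  have \<kappa>: "\<kappa> \<ge> 0" using \<epsilon> B by (simp add: \<kappa>_def divide_nonpos_pos)
  define g where "g = (\<lambda>s. f s * exp (of_real \<kappa> * E s))"
  have ng: "cmod (g s) = cmod (f s) * exp (\<kappa> * Re (E s))" for s
    by (simp add: g_def norm_mult norm_exp_eq_Re)
  \<comment> \<open>The points above the zero set of \<open>P\<close>: the whole rectangle over
    height \<open>y0\<close>, and below it only points with \<open>P\<close> negative. As
    \<open>P\<close> is positive at height \<open>y1\<close>, the lower part of the frontier
    consists of zeros of \<open>P\<close>. The closed superset \<open>S'\<close> makes the frontier
    points accessible.\<close>
  define S where "S = {s. a < Re s \<and> Re s < b \<and> Im s < 2 \<and>
      (Im s > y0 \<or> (Im s > y1 \<and> P s < 0))}"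
  define S' where "S' = {s. a \<le> Re s \<and> Re s \<le> b \<and> Im s \<le> 2 \<and> Im s \<ge> y1 \<and> (Im s \<ge> y0 \<or> P s \<le> 0)}"
  have oP: "open {s. Im s > y1 \<and> P s < 0}"
  proof -
    have "open ({s. Im s > y1} \<inter> P -` {..<0})"
      by (rule continuous_open_preimage[OF continuous_on_subset[OF P]])
         (use y in \<open>auto simp: open_halfspace_Im_gt\<close>)
    moreover have "{s. Im s > y1} \<inter> P -` {..<0} = {s. Im s > y1 \<and> P s < 0}" by auto
    ultimately show ?thesis by simp
  qed
  have oS: "open S"
  proof -
    have "S = {s. Re s > a} \<inter> {s. Re s < b} \<inter> {s. Im s < 2} \<inter> ({s. Im s > y0} \<union> {s. Im s > y1 \<and> P s < 0})"
      unfolding S_def by auto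
    moreover have "open \<dots>"
      using oP by (intro open_Int open_Un open_halfspace_Re_gt open_halfspace_Re_lt
        open_halfspace_Im_lt open_halfspace_Im_gt)
    ultimately show ?thesis by simp
  qed
  have cS': "closed S'"
  proof -
    have "closed ({s. Im s \<ge> y1} \<inter> P -` {..0})"
      by (rule continuous_closed_preimage[OF continuous_on_subset[OF P]])
         (use y in \<open>auto simp: closed_halfspace_Im_ge\<close>)
    moreover have "S' = {s. Re s \<ge> a} \<inter> {s. Re s \<le> b} \<inter> {s. Im s \<le> 2} \<inter> {s. Im s \<ge> y1} \<inter>
         ({s. Im s \<ge> y0} \<union> ({s. Im s \<ge> y1} \<inter> P -` {..0}))"
      unfolding S'_def by auto
    ultimately show ?thesis
      by (auto intro!: closed_Int closed_Un closed_halfspace_Re_ge closed_halfspace_Re_le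
        closed_halfspace_Im_le closed_halfspace_Im_ge)
  qed
  have SS': "S \<subseteq> S'" using y by (auto simp: S_def S'_def)
  then have clS: "closure S \<subseteq> S'" using cS' by (simp add: closure_minimal)
  have S'box: "S' \<subseteq> cbox (Complex a y1) (Complex b 2)"
    by (auto simp: S'_def in_cbox_complex_iff)
  then have bS: "bounded S" using SS' bounded_cbox bounded_subset by blast
  have SU: "S' \<subseteq> {s. Im s > 0}" using y by (auto simp: S'_def)
  have hg: "g holomorphic_on {s. Im s > 0}"
    unfolding g_def E_def by (intro holomorphic_intros f)
  have Epos: "0 \<le> Re (E s)" "Re (E s) \<le> B" if s: "s \<in> S'" for s
  proof -
    have "l * (Re s - a) \<le> l * (b - a)" using s l by (auto simp: S'_def)
    also have "\<dots> = pi" using ab by (simp add: l_def)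
    finally have s1: "0 \<le> sin (l * (Re s - a))" using s l
      by (intro sin_ge_zero) (auto simp: S'_def)
    have s2: "0 \<le> sinh (l * (2 - Im s))" using s l by (auto simp: S'_def)
    have s3: "sinh (l * (2 - Im s)) \<le> B" using s l y
      unfolding B_def by (simp add: S'_def mult.commute)
    show "0 \<le> Re (E s)" using s1 s2 by (simp add: E)
    have "sin (l * (Re s - a)) * sinh (l * (2 - Im s)) \<le> 1 * B"
      by (rule mult_mono) (use s2 s3 B in auto)
    then show "Re (E s) \<le> B" by (simp add: E)
  qed
  let ?z = "Complex ((a+b)/2) 1"
  have "cmod (g ?z) \<le> 1"
  proof (rule maximum_modulus_frontier[of g S])
    show "g holomorphic_on interior S"
      using hg SU SS' interior_subset by (meson holomorphic_on_subset order_trans)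
    show "continuous_on (closure S) g"
      using hg SU clS by (meson holomorphic_on_imp_continuous_on continuous_on_subset order_trans)
    show "bounded S" by fact
    show "?z \<in> S" using ab y by (auto simp: S_def)
    fix s assume "s \<in> frontier S"
    then have s: "s \<in> S'" "s \<notin> S" using clS oS by (auto simp: frontier_def interior_open)
    have fs: "cmod (f s) \<le> 1" using f(2) SU s by auto
    show "cmod (g s) \<le> 1"
    proof (cases "Re s = a \<or> Re s = b \<or> Im s = 2")
      case True
      have "sin (l * (b - a)) = 0" using ab by (simp add: l_def)
      then have "Re (E s) = 0" using True by (auto simp: E)
      then show ?thesis using fs by (simp add: ng)
    next
      case False
      then have i: "Im s \<le> y0" and r: "Re s \<in> {a..b}" and np: "Im s > y1 \<Longrightarrow> P s \<ge> 0"
        using s by (auto simp: S_def S'_def)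
      have Ps: "P s \<le> 0"
      proof (cases "Im s = y0")
        case True
        then show ?thesis using top[OF r] by (metis complex.collapse less_eq_real_def)
      next
        case False
        then show ?thesis using s(1) i by (auto simp: S'_def)
      qed
      have "Im s \<noteq> y1" using bot[OF r] Ps by (metis complex.collapse not_le)
      then have "Im s > y1" using s by (auto simp: S'_def)
      then have "P s = 0" using np Ps by auto
      then have fe: "cmod (f s) \<le> \<epsilon>" using small r i \<open>Im s > y1\<close> by auto
      have "\<kappa> * Re (E s) \<le> \<kappa> * B" using Epos[OF s(1)] \<kappa> mult_left_mono by blast
      also have "\<dots> = - ln \<epsilon>" using B by (simp add: \<kappa>_def)
      finally have "cmod (g s) \<le> \<epsilon> * exp (- ln \<epsilon>)" unfolding ng
        using fe \<epsilon> by (intro mult_mono) auto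
      also have "\<dots> = 1" using \<epsilon> by (simp add: exp_minus)
      finally show ?thesis .
    qed
  qed
  \<comment> \<open>The base point has the midpoint of \<open>a\<close> and \<open>b\<close> as its
    real part, where the sine is 1, and height 1, where \<open>2 - Im s = 1\<close>.\<close>
  moreover have "Re (E ?z) = sinh l"
  proof -
    have "l * ((a+b)/2 - a) = pi / 2" using ab by (simp add: l_def field_simps)
    then show ?thesis by (simp add: E)
  qed
  ultimately have "cmod (f ?z) * exp (\<kappa> * sinh l) \<le> 1" by (simp add: ng)
  then have "cmod (f ?z) \<le> exp (- (\<kappa> * sinh l))" by (simp add: exp_minus field_simps)
  also have "\<dots> = \<epsilon> powr (sinh l / B)" using \<epsilon> by (simp add: powr_def \<kappa>_def)
  finally show ?thesis by (simp add: l_def B_def)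
qed

text \<open>The threshold \<open>\<epsilon>\<close> depends only on \<open>f\<close>,
  \<open>a\<close> and \<open>b\<close> and is fixed before \<open>P\<close> and the heights. The
  heights can then be pushed towards the boundary until \<open>f\<close> is small on the separating
  set.\<close>

lemma sweep_contradiction:
  fixes f :: "complex \<Rightarrow> complex" and a b :: real
  assumes f: "f holomorphic_on {s. Im s > 0}" "\<And>s. Im s > 0 \<Longrightarrow> cmod (f s) \<le> 1"
    and nz: "f (Complex ((a+b)/2) 1) \<noteq> 0" and ab: "a < b"
  obtains \<epsilon> where "\<epsilon> > 0"
    "\<And>P y1 y0. \<lbrakk>0 < y1; y1 < y0; y0 < 1; continuous_on {s. Im s > 0} P;
      \<And>x. x \<in> {a..b} \<Longrightarrow> P (Complex x y0) < (0::real);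
      \<And>x. x \<in> {a..b} \<Longrightarrow> P (Complex x y1) > 0;
      \<And>s. Re s \<in> {a..b} \<Longrightarrow> Im s \<in> {y1..y0} \<Longrightarrow> P s = 0 \<Longrightarrow> cmod (f s) \<le> \<epsilon>\<rbrakk> \<Longrightarrow> False"
proof -
  define c where "c = sinh (pi/(b-a)) / sinh (2*pi/(b-a))"
  have c: "c > 0" using ab by (simp add: c_def)
  define m where "m = cmod (f (Complex ((a+b)/2) 1))"
  have m: "0 < m" "m \<le> 1" using nz f(2)[of "Complex ((a+b)/2) 1"] by (auto simp: m_def)
  \<comment> \<open>Chosen so that the bound \<open>\<epsilon> powr c\<close> of the sweep is half
    of the actual value \<open>m\<close>.\<close>
  define \<epsilon> where "\<epsilon> = (m/2) powr (1/c)"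
  have \<epsilon>0: "\<epsilon> > 0" using m by (simp add: \<epsilon>_def)
  have \<epsilon>1: "\<epsilon> \<le> 1" using m c by (simp add: \<epsilon>_def powr_le1)
  have \<epsilon>c: "\<epsilon> powr c = m/2" using m c by (simp add: \<epsilon>_def powr_powr)
  show thesis
  proof (rule that[OF \<epsilon>0])
    fix P y1 y0
    assume "0 < y1" "y1 < y0" "y0 < 1" "continuous_on {s. Im s > 0} P"
      "\<And>x. x \<in> {a..b} \<Longrightarrow> P (Complex x y0) < (0::real)"
      "\<And>x. x \<in> {a..b} \<Longrightarrow> P (Complex x y1) > 0"
      "\<And>s. Re s \<in> {a..b} \<Longrightarrow> Im s \<in> {y1..y0} \<Longrightarrow> P s = 0 \<Longrightarrow> cmod (f s) \<le> \<epsilon>"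
    then have "m \<le> \<epsilon> powr c" unfolding m_def c_def
      by (intro sweep_bound[where P = P and ?y0.0 = y0 and ?y1.0 = y1] f ab \<epsilon>0 \<epsilon>1)
    then show False using \<epsilon>c m by simp
  qed
qed

text \<open>Continuing \<open>f\<close> by the constant \<open>c\<close> across the line gives a
  continuous function that is holomorphic off the line, hence everywhere; the identity theorem does
  the rest.\<close>

lemma half_disc_constant:
  fixes f :: "complex \<Rightarrow> complex"
  assumes S: "open S" "connected S" and d: "d \<noteq> 0"
    and f: "f holomorphic_on (S \<inter> {z. k < d \<bullet> z})"
    and lim: "\<And>z. z \<in> S \<Longrightarrow> d \<bullet> z = k \<Longrightarrow> (f \<longlongrightarrow> c) (at z within S \<inter> {z. k < d \<bullet> z})"
    and ne: "S \<inter> {z. d \<bullet> z < k} \<noteq> {}" and z: "z \<in> S" "k < d \<bullet> z"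
  shows "f z = c"
proof -
  define F where "F = (\<lambda>z. if k < d \<bullet> z then f z else c)"
  have o1: "open (S \<inter> {z. k < d \<bullet> z})" and o2: "open (S \<inter> {z. d \<bullet> z < k})"
    using S by (auto intro!: open_Int open_halfspace_gt open_halfspace_lt)
  have "continuous_on S F"
    unfolding continuous_on_eq_continuous_at[OF S(1)]
  proof
    fix w assume w: "w \<in> S"
    consider "k < d \<bullet> w" | "d \<bullet> w < k" | "d \<bullet> w = k" by linarith
    then show "isCont F w"
    proof cases
      case 1
      then have "isCont f w" using f o1 w
        using continuous_on_eq_continuous_at[OF o1] holomorphic_on_imp_continuous_on[OF f] by auto
      moreover have "eventually (\<lambda>z. z \<in> S \<inter> {z. k < d \<bullet> z}) (nhds w)"
        using o1 1 w by (intro eventually_nhds_in_open) auto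
      ultimately show ?thesis
        by (subst isCont_cong[of F f]) (auto elim!: eventually_mono simp: F_def)
    next
      case 2
      have "eventually (\<lambda>z. z \<in> S \<inter> {z. d \<bullet> z < k}) (nhds w)"
        using o2 2 w by (intro eventually_nhds_in_open) auto
      then show ?thesis
        by (subst isCont_cong[of F "\<lambda>_. c"]) (auto elim!: eventually_mono simp: F_def)
    next
      case 3
      have l1: "(F \<longlongrightarrow> c) (at w within S \<inter> {z. k < d \<bullet> z})"
        by (rule Lim_transform_eventually[OF lim[OF w 3]]) (auto simp: F_def eventually_at_filter)
      have l2: "(F \<longlongrightarrow> c) (at w within {z. \<not> k < d \<bullet> z})"
        by (rule Lim_transform_eventually[OF tendsto_const]) (auto simp: F_def eventually_at_filter)
      have "(F \<longlongrightarrow> c) (at w within (S \<inter> {z. k < d \<bullet> z}) \<union> {z. \<not> k < d \<bullet> z})"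
        using l1 l2 Lim_Un by blast
      then have "(F \<longlongrightarrow> c) (at w within S)"
        by (rule tendsto_within_subset) auto
      then have "(F \<longlongrightarrow> c) (at w)" using S w by (metis at_within_open)
      then show ?thesis using 3 by (simp add: isCont_def F_def)
    qed
  qed
  moreover have "F holomorphic_on (S \<inter> {z. d \<bullet> z < k})"
    by (rule holomorphic_transform[of "\<lambda>_. c"]) (auto simp: F_def)
  moreover have "F holomorphic_on (S \<inter> {z. k < d \<bullet> z})"
    by (rule holomorphic_transform[OF f]) (auto simp: F_def)
  ultimately have hF: "F holomorphic_on S"
    using holomorphic_on_paste_across_line[OF S(1) d] by blast
  have "F z = c"
    by (rule analytic_continuation_open[OF o2 S(1) ne S(2) _ hF holomorphic_on_const _ z(1)])
       (auto simp: F_def)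
  then show ?thesis using z by (simp add: F_def)
qed

text \<open>The Schwarz lemma for \<open>k\<close>, a Cayley transform of \<open>g\<close> on the
  rescaled disc. With \<open>\<rho>\<close> equal to the distance from the boundary, a linear bound
  on \<open>Im g\<close> becomes a uniform bound on the derivative.\<close>

lemma deriv_le_Im:
  assumes g: "g holomorphic_on ball u \<rho>" and \<rho>: "\<rho> > 0"
    and pos: "\<And>w. w \<in> ball u \<rho> \<Longrightarrow> Im (g w) > 0"
  shows "cmod (deriv g u) \<le> 2 * Im (g u) / \<rho>"
proof -
  define k where "k = (\<lambda>\<zeta>. (g (u + of_real \<rho> * \<zeta>) - g u) / (g (u + of_real \<rho> * \<zeta>) - cnj (g u)))"
  have inb: "u + of_real \<rho> * \<zeta> \<in> ball u \<rho>" if "cmod \<zeta> < 1" for \<zeta>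
    using that \<rho> by (simp add: dist_norm norm_mult)
  have p0: "Im (g u) > 0" using pos[of u] \<rho> by simp
  have nz: "g (u + of_real \<rho> * \<zeta>) - cnj (g u) \<noteq> 0" if "cmod \<zeta> < 1" for \<zeta>
    using pos[OF inb[OF that]] p0 by (auto simp: complex_eq_iff)
  have hg: "(\<lambda>\<zeta>. g (u + of_real \<rho> * \<zeta>)) holomorphic_on ball 0 1"
    by (rule holomorphic_on_compose_gen[OF _ g, unfolded o_def])
       (use inb in \<open>auto intro!: holomorphic_intros\<close>)
  have hk: "k holomorphic_on ball 0 1"
    unfolding k_def by (intro holomorphic_intros hg) (use nz in auto)
  have lt: "cmod (k \<zeta>) < 1" if \<zeta>: "cmod \<zeta> < 1" for \<zeta>
  proof -
    let ?w = "g (u + of_real \<rho> * \<zeta>)"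
    have pw: "Im ?w > 0" using pos[OF inb[OF \<zeta>]] .
    have "(Re ?w - Re (g u))\<^sup>2 + (Im ?w - Im (g u))\<^sup>2 < (Re ?w - Re (g u))\<^sup>2 + (Im ?w + Im (g u))\<^sup>2"
      using pw p0 by (simp add: power2_eq_square algebra_simps)
    then have "(cmod (?w - g u))\<^sup>2 < (cmod (?w - cnj (g u)))\<^sup>2"
      by (simp add: cmod_power2)
    then have "cmod (?w - g u) < cmod (?w - cnj (g u))"
      by (rule power_less_imp_less_base) simp
    then show ?thesis using nz[OF \<zeta>] by (simp add: k_def norm_divide)
  qed
  have "cmod (deriv k 0) \<le> 1"
    by (rule Schwarz_Lemma(2)[OF hk _ lt, of 0]) (auto simp: k_def)
  moreover have "deriv k 0 = of_real \<rho> * deriv g u / (2 * \<i> * of_real (Im (g u)))"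
  proof (rule DERIV_imp_deriv)
    have d: "(g has_field_derivative deriv g u) (at (u + of_real \<rho> * 0))"
      using holomorphic_derivI[OF g open_ball, of u] \<rho> by simp
    have dd: "((\<lambda>\<zeta>. g (u + of_real \<rho> * \<zeta>)) has_field_derivative deriv g u * of_real \<rho>) (at 0)"
      by (rule DERIV_chain2[where f = g and g = "\<lambda>\<zeta>. u + of_real \<rho> * \<zeta>" and x = 0, OF d]) (auto intro!: derivative_eq_intros)
    have "g u - cnj (g u) = 2 * \<i> * of_real (Im (g u))" by (simp add: complex_eq_iff)
    then show "(k has_field_derivative of_real \<rho> * deriv g u / (2 * \<i> * of_real (Im (g u)))) (at 0)"
      unfolding k_def using p0
      by (auto intro!: derivative_eq_intros dd simp: divide_simps)
  qed
  ultimately have "\<rho> * cmod (deriv g u) / (2 * Im (g u)) \<le> 1"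
    using \<rho> p0 by (simp add: norm_mult norm_divide)
  then show ?thesis using \<rho> p0 by (simp add: field_simps)
qed

text \<open>The barrier \<open>2y + x^2 - y^2\<close> gives \<open>Im g = O(y)\<close>, and the Schwarz-Pick inequality turns this
into a bound for the derivative of \<open>g\<close>.\<close>

lemma half_disc_boundary_limit:
  fixes g :: "complex \<Rightarrow> complex" and \<rho> :: real
  defines "S \<equiv> ball 0 \<rho> \<inter> {z. Im z > 0}"
  assumes \<rho>: "\<rho> > 0" and g: "g holomorphic_on S" and pos: "\<And>z. z \<in> S \<Longrightarrow> Im (g z) > 0"
    and lim: "\<And>x. \<bar>x\<bar> < \<rho> \<Longrightarrow> ((\<lambda>z. Im (g z)) \<longlongrightarrow> 0) (at (of_real x) within S)"
  obtains l where "(g \<longlongrightarrow> l) (at 0 within S)"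
proof -
  have oS: "open S" unfolding S_def by (intro open_Int open_ball open_halfspace_Im_gt)
  define R where "R = \<rho> / 4"
  have R: "R > 0" using \<rho> by (simp add: R_def)
  define K where "K = cball (0::complex) (2*R) \<inter> {z. Im z \<ge> 0}"
  \<comment> \<open>Only the imaginary part of \<open>g\<close> is known to have boundary values on
    the diameter, namely 0; the maximum principle is therefore applied through this
    extension.\<close>
  define q where "q = (\<lambda>z. if Im z > 0 then Im (g z) else 0)"
  have KS: "z \<in> S" if "z \<in> K" "Im z > 0" for z
    using that \<rho> by (auto simp: K_def S_def R_def)
  have K\<rho>: "cmod z < \<rho>" if "z \<in> K" for z using that \<rho> by (auto simp: K_def R_def)
  have cq: "continuous_on K q"
    unfolding continuous_on_def
  proof
    fix z assume z: "z \<in> K"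
    show "(q \<longlongrightarrow> q z) (at z within K)"
    proof (cases "Im z > 0")
      case True
      have zS: "z \<in> S" using KS[OF z True] .
      have "continuous_on S g" using g by (rule holomorphic_on_imp_continuous_on)
      then have "isCont g z" using oS zS by (simp add: continuous_on_eq_continuous_at)
      then have "((\<lambda>z. Im (g z)) \<longlongrightarrow> Im (g z)) (at z within K)"
        unfolding isCont_def by (intro tendsto_Im) (rule tendsto_within_subset, auto)
      moreover have "eventually (\<lambda>w. w \<in> {w. Im w > 0}) (nhds z)"
        using True by (intro eventually_nhds_in_open open_halfspace_Im_gt) auto
      then have "eventually (\<lambda>w. Im (g w) = q w) (at z within K)"
        unfolding eventually_at_filter by eventually_elim (auto simp: q_def)
      ultimately show ?thesis using True Lim_transform_eventually by (force simp: q_def)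
    next
      case False
      then have "Im z = 0" using z by (auto simp: K_def)
      then have zr: "z = of_real (Re z)" by (simp add: complex_eq_iff)
      have "\<bar>Re z\<bar> < \<rho>" using K\<rho>[OF z] abs_Re_le_cmod[of z] by linarith
      then have l: "((\<lambda>w. Im (g w)) \<longlongrightarrow> 0) (at z within S)" using lim zr by metis
      have l1: "(q \<longlongrightarrow> 0) (at z within S)"
        by (rule Lim_transform_eventually[OF l]) (auto simp: eventually_at_filter q_def S_def)
      have l2: "(q \<longlongrightarrow> 0) (at z within {w. \<not> Im w > 0})"
        by (rule Lim_transform_eventually[OF tendsto_const]) (auto simp: eventually_at_filter q_def)
      have "(q \<longlongrightarrow> 0) (at z within S \<union> {w. \<not> Im w > 0})"
        using l1 l2 Lim_Un by blast
      then show ?thesis using False KS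
        by (auto simp: q_def intro: tendsto_within_subset)
    qed
  qed
  have coK: "compact K" unfolding K_def
    by (intro compact_Int_closed compact_cball closed_halfspace_Im_ge)
  then have "bounded (q ` K)" using cq compact_continuous_image compact_imp_bounded by blast
  then obtain M where M: "M > 0" "\<And>z. z \<in> K \<Longrightarrow> \<bar>q z\<bar> \<le> M"
    unfolding bounded_pos by auto
  have key: "Im (g (Complex x y)) \<le> 2 * M * y / R" if x: "\<bar>x\<bar> \<le> R" and y: "0 < y" "y < R" for x y
  proof -
    define T where "T = ball (of_real x) R \<inter> {z. Im z > 0}"
    define v where "v = (\<lambda>z::complex. (z - of_real x) / of_real R)"
    define G where "G = (\<lambda>z. - \<i> * g z - of_real M * ((v z)\<^sup>2 - 2 * \<i> * v z))"
    define Q where "Q = (\<lambda>z. q z - M * Re ((v z)\<^sup>2 - 2 * \<i> * v z))"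
    have oT: "open T" unfolding T_def by (intro open_Int open_ball open_halfspace_Im_gt)
    have "closed (cball (of_real x) R \<inter> {z. Im z \<ge> 0})"
      by (intro closed_Int closed_cball closed_halfspace_Im_ge)
    then have clT: "closure T \<subseteq> cball (of_real x) R \<inter> {z. Im z \<ge> 0}"
      by (intro closure_minimal) (auto simp: T_def)
    have sub: "cball (of_real x) R \<inter> {z. Im z \<ge> 0} \<subseteq> K"
    proof
      fix z assume z: "z \<in> cball (of_real x) R \<inter> {z. Im z \<ge> 0}"
      have "cmod z \<le> cmod (z - of_real x) + cmod (of_real x)" using norm_triangle_sub[of z "of_real x"] by simp
      then show "z \<in> K" using z x by (auto simp: K_def dist_norm norm_minus_commute)
    qed
    have TS: "T \<subseteq> S"
    proof
      fix z assume z: "z \<in> T"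
      then have "z \<in> K" using clT sub closure_subset by blast
      then show "z \<in> S" using KS z by (simp add: T_def)
    qed
    have "Re (G (Complex x y)) \<le> 0"
    proof (rule Re_le_of_frontier[where S = T and q = Q and g = G and z = "Complex x y"])
      show "open T" by fact
      show "bounded T" unfolding T_def by (simp add: bounded_Int bounded_ball)
      show "G holomorphic_on T" unfolding G_def v_def
        by (intro holomorphic_intros holomorphic_on_subset[OF g TS]) (use R in auto)
      show "continuous_on (closure T) Q" unfolding Q_def v_def
        by (intro continuous_intros continuous_on_subset[OF cq]) (use R clT sub in auto)
      show "Q z = Re (G z)" if "z \<in> T" for z
        using that by (simp add: Q_def G_def q_def T_def)
      show "Complex x y \<in> T" using y R by (simp add: T_def dist_norm cmod_def complex_of_real_def)
      fix z assume "z \<in> frontier T"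
      then have z: "z \<in> cball (of_real x) R" "Im z \<ge> 0" "z \<notin> T"
        using clT oT by (auto simp: frontier_def interior_open)
      have rv: "Re ((v z)\<^sup>2 - 2 * \<i> * v z) = (Re (v z))\<^sup>2 - (Im (v z))\<^sup>2 + 2 * Im (v z)"
        by (simp add: power2_eq_square)
      show "Q z \<le> 0"
      proof (cases "Im z = 0")
        case True
        then have "Im (v z) = 0" using R by (simp add: v_def)
        then show ?thesis using True M R unfolding Q_def rv by (simp add: q_def)
      next
        case False
        then have "dist (of_real x) z = R" using z by (auto simp: T_def)
        then have "cmod (v z) = 1" using R by (simp add: v_def norm_divide dist_norm norm_minus_commute)
        \<comment> \<open>On the semicircle, with \<open>v = x + \<i> y\<close>, the barrier is
          \<open>x^2 - y^2 + 2 y = 1 + 2 y (1 - y)\<close>, which is at least 1 since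
          \<open>0 \<le> y \<le> 1\<close>.\<close>
        then have n1: "(Re (v z))\<^sup>2 + (Im (v z))\<^sup>2 = 1" by (metis cmod_power2 one_power2)
        have iv: "Im (v z) \<ge> 0" using z R by (simp add: v_def)
        have "Im (v z) \<le> 1" using abs_Im_le_cmod[of "v z"] \<open>cmod (v z) = 1\<close> by simp
        then have "Im (v z) * Im (v z) \<le> Im (v z) * 1" using iv by (intro mult_left_mono)
        then have "1 \<le> Re ((v z)\<^sup>2 - 2 * \<i> * v z)" unfolding rv using n1 by (simp add: power2_eq_square)
        then have "M * 1 \<le> M * Re ((v z)\<^sup>2 - 2 * \<i> * v z)" using M by (intro mult_left_mono) auto
        moreover have "q z \<le> M" using M(2)[of z] z sub by auto
        ultimately show ?thesis by (simp add: Q_def)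
      qed
    qed
    moreover have "v (Complex x y) = \<i> * of_real (y / R)" using R by (simp add: v_def complex_eq_iff)
    ultimately have "Im (g (Complex x y)) \<le> M * (2 * (y/R) - (y/R)\<^sup>2)"
      by (simp add: G_def power2_eq_square algebra_simps)
    also have "\<dots> \<le> M * (2 * (y/R))" using M by (intro mult_left_mono) auto
    finally show ?thesis by (simp add: mult.assoc mult.left_commute)
  qed
  \<comment> \<open>A convex rectangle such that the disc of radius \<open>Im z\<close> about each
    of its points \<open>z\<close> stays in \<open>S\<close>. With the linear bound
    \<open>key\<close>, \<open>deriv_le_Im\<close> on these discs gives one Lipschitz constant, and
    a Lipschitz function has a limit at 0.\<close>
  define T where "T = {z. \<bar>Re z\<bar> < R} \<inter> {z. 0 < Im z \<and> Im z < R}"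
  have TS: "ball z (Im z) \<subseteq> S" if z: "z \<in> T" for z
  proof
    fix w assume w: "w \<in> ball z (Im z)"
    have "\<bar>Im (z - w)\<bar> < Im z" using w abs_Im_le_cmod[of "z - w"] by (simp add: dist_norm)
    moreover have "cmod w \<le> cmod z + cmod (w - z)" by (metis norm_triangle_sub)
    moreover have "cmod z \<le> \<bar>Re z\<bar> + \<bar>Im z\<bar>" by (rule cmod_le)
    ultimately show "w \<in> S" using w z by (auto simp: S_def T_def R_def dist_norm norm_minus_commute)
  qed
  have dB: "cmod (deriv g z) \<le> 4 * M / R" if z: "z \<in> T" for z
  proof -
    have iz: "0 < Im z" using z by (simp add: T_def)
    have "cmod (deriv g z) \<le> 2 * Im (g z) / Im z"
      by (rule deriv_le_Im[OF holomorphic_on_subset[OF g TS[OF z]] iz]) (use TS[OF z] pos in blast)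
    also have "\<dots> \<le> 2 * (2 * M * Im z / R) / Im z"
      using key[of "Re z" "Im z"] z iz by (intro divide_right_mono mult_left_mono) (auto simp: T_def)
    also have "\<dots> = 4 * M / R" using iz by simp
    finally show ?thesis .
  qed
  have TsS: "T \<subseteq> S" using TS by (force simp: T_def)
  have conv: "convex T"
  proof -
    have "T = {z. Re z < R} \<inter> {z. Re z > -R} \<inter> {z. Im z > 0} \<inter> {z. Im z < R}"
      by (auto simp: T_def)
    then show ?thesis
      by (auto intro!: convex_Int convex_halfspace_Re_lt convex_halfspace_Re_gt
          convex_halfspace_Im_lt convex_halfspace_Im_gt)
  qed
  have lip: "cmod (g z - g w) \<le> (4 * M / R) * cmod (z - w)" if "z \<in> T" "w \<in> T" for z w
  proof (rule field_differentiable_bound[OF conv _ dB that])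
    fix u assume "u \<in> T"
    then show "(g has_field_derivative deriv g u) (at u within T)"
      using holomorphic_derivI[OF g oS] TsS has_field_derivative_at_within by blast
  qed
  have "uniformly_continuous_on T g"
    unfolding uniformly_continuous_on_def
  proof (intro allI impI)
    fix e :: real assume e: "e > 0"
    have c: "4 * M / R > 0" using M R by simp
    show "\<exists>d>0. \<forall>z\<in>T. \<forall>w\<in>T. dist w z < d \<longrightarrow> dist (g w) (g z) < e"
    proof (intro exI conjI ballI impI)
      show "e / (4 * M / R) > 0" using e c by (rule divide_pos_pos)
      fix z w assume "z \<in> T" "w \<in> T" "dist w z < e / (4 * M / R)"
      then have "(4 * M / R) * cmod (w - z) < e"
        by (subst mult.commute) (simp only: pos_less_divide_eq[OF c, symmetric] dist_norm)
      then show "dist (g w) (g z) < e" using lip[OF \<open>w \<in> T\<close> \<open>z \<in> T\<close>] by (simp add: dist_norm)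
    qed
  qed
  moreover have "0 \<in> closure T"
    unfolding closure_approachable
  proof (intro allI impI)
    fix e :: real assume e: "e > 0"
    show "\<exists>y\<in>T. dist y 0 < e"
      using e R by (intro bexI[of _ "Complex 0 (min e R / 2)"]) (auto simp: T_def cmod_def min_def)
  qed
  ultimately obtain l where l: "(g \<longlongrightarrow> l) (at 0 within T)"
    using uniformly_continuous_on_extension_at_closure by blast
  have "at 0 within T = at 0 within S"
  proof (rule at_within_nhd[of _ "ball 0 R"])
    show "T \<inter> ball 0 R - {0} = S \<inter> ball 0 R - {0}"
      using TsS abs_Re_le_cmod abs_Im_le_cmod
      by (auto simp: T_def S_def) (meson abs_le_D1 le_less_trans abs_Re_le_cmod abs_Im_le_cmod)+
  qed (use R in auto)
  with l that show thesis by metis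
qed

subsection \<open>The angle of the Riemann map of a starlike slit domain\<close>

abbreviation HP :: "complex set" where
  "HP \<equiv> {s. Im s > 0}"

abbreviation cleft :: "real set \<Rightarrow> complex set" where
  "cleft C \<equiv> {w. Im w > 0 \<or> Re w \<notin> C}"

section \<open>Elementary facts on the half-plane, the slit domain and periodic maps\<close>

lemma open_HP: "open HP" by (rule open_halfspace_Im_gt)

lemma HP_limit_nontrivial: "at (of_real x) within HP \<noteq> bot"
proof -
  have "complex_of_real x islimpt HP"
    unfolding islimpt_approachable
  proof (intro allI impI)
    fix e :: real assume "e > 0"
    then show "\<exists>s\<in>HP. s \<noteq> of_real x \<and> dist s (of_real x) < e"
      by (intro bexI[of _ "Complex x (e/2)"]) (auto simp: dist_norm cmod_def complex_eq_iff)
  qed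
  then show ?thesis by (simp add: trivial_limit_within)
qed

lemma open_cleft:
  assumes "closed C" shows "open (cleft C)"
proof -
  have "open (- (Re -` C))"
    using assms by (intro open_Compl closed_vimage) (auto intro: continuous_intros)
  moreover have "cleft C = HP \<union> - (Re -` C)" by auto
  ultimately show ?thesis using open_HP by (metis open_Un)
qed

lemma periodic_int:
  assumes "\<And>w. \<kappa> (w + 1) = \<kappa> w + (1::'b::ring_1)" shows "\<kappa> (w + of_int n :: 'a :: ring_1) = \<kappa> w + of_int n"
proof (induction n rule: int_induct[of _ 0])
  case (step1 i)
  then show ?case using assms[of "w + of_int i"] by (simp add: add.assoc)
next
  case (step2 i)
  then show ?case using assms[of "w + of_int (i - 1)"] by (simp add: algebra_simps)
qed simp

lemma periodic_set_int:
  fixes C :: "real set"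
  assumes "\<And>x. x + 1 \<in> C \<longleftrightarrow> x \<in> C" shows "x + of_int n \<in> C \<longleftrightarrow> x \<in> C"
proof (induction n rule: int_induct[of _ 0])
  case (step1 i)
  then show ?case using assms[of "x + of_int i"] by (simp add: add.assoc)
next
  case (step2 i)
  then show ?case using assms[of "x + of_int (i - 1)"] by (simp add: add.assoc)
qed simp

text \<open>If \<open>f y \<le> f x\<close> with \<open>x < y\<close>, periodicity lifts some
  \<open>f (y + n)\<close> above \<open>f x\<close>, and the intermediate value theorem finds the
  value \<open>f x\<close> again to the right of \<open>x\<close>.\<close>

lemma strict_mono_of_inj_periodic:
  fixes f :: "real \<Rightarrow> real"
  assumes cont: "continuous_on UNIV f" and inj: "\<And>x y. f x = f y \<Longrightarrow> x = y"
    and per: "\<And>x. f (x + 1) = f x + 1"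
  shows "strict_mono f"
proof (rule strict_monoI, rule ccontr)
  fix x y :: real assume xy: "x < y" and "\<not> f x < f y"
  then have le: "f y \<le> f x" by simp
  have pern: "f (y + real n) = f y + real n" for n
  proof (induction n)
    case (Suc n)
    then show ?case using per[of "y + real n"] by (simp add: ac_simps)
  qed simp
  obtain n where n: "f x - f y \<le> real n" using real_arch_simple by blast
  then have "f x \<le> f (y + real n)" by (simp add: pern)
  then obtain t where "y \<le> t" "f t = f x"
    using IVT'[of f y "f x" "y + real n"] le continuous_on_subset[OF cont] by auto
  then show False using inj[of t x] xy by simp
qed

lemma Re_csqrt_pos_slit: assumes z: "z \<notin> \<real>\<^sub>\<le>\<^sub>0" shows "0 < Re (csqrt z)"
proof -
  define r where "r = csqrt z"
  have "z = r\<^sup>2" by (simp add: r_def)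
  then have "Re r \<noteq> 0" using z by (auto simp: complex_nonpos_Reals_iff power2_eq_square)
  then show ?thesis using Re_csqrt[of z] by (simp add: r_def del: csqrt.simps)
qed

text \<open>Logarithmic coordinates: a Riemann map \<open>\<phi>\<close> is represented by \<open>\<Lambda>\<close> with
\<open>\<phi> (exp (2 \<pi> i s)) = exp (2 \<pi> i \<Lambda> s)\<close> and the radial slits become the half-lines \<open>Im w \<le> 0\<close> over \<open>C\<close>.
The assumption \<open>mono\<close> is the Schwarz lemma for a starlike domain.\<close>

locale spike_map =
  fixes \<Lambda> \<Psi> :: "complex \<Rightarrow> complex" and C :: "real set"
  assumes C_closed: "closed C" and C_ne: "C \<noteq> {}" and C_per: "x + 1 \<in> C \<longleftrightarrow> x \<in> C"
    and C_nd: "a < b \<Longrightarrow> \<exists>x. a < x \<and> x < b \<and> x \<notin> C"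
    and hol: "\<Lambda> holomorphic_on HP" and hol_inv: "\<Psi> holomorphic_on cleft C"
    and per: "s \<in> HP \<Longrightarrow> \<Lambda> (s + 1) = \<Lambda> s + 1"
    and range: "s \<in> HP \<Longrightarrow> \<Lambda> s \<in> cleft C" and inv: "s \<in> HP \<Longrightarrow> \<Psi> (\<Lambda> s) = s"
    and range_inv: "w \<in> cleft C \<Longrightarrow> \<Psi> w \<in> HP" and inv_inv: "w \<in> cleft C \<Longrightarrow> \<Lambda> (\<Psi> w) = w"
    and mono: "w \<in> cleft C \<Longrightarrow> \<eta> > 0 \<Longrightarrow> Im (\<Psi> w) < Im (\<Psi> (w + \<i> * of_real \<eta>))"
    and proper: "w \<notin> cleft C \<Longrightarrow> ((\<lambda>u. Im (\<Psi> u)) \<longlongrightarrow> 0) (at w within cleft C)"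
    and far: "\<epsilon> > 0 \<Longrightarrow> \<exists>B. \<forall>s. Im s \<ge> \<epsilon> \<longrightarrow> cmod (\<Lambda> s - s) \<le> B"
    and upper: "\<exists>M. \<forall>s\<in>HP. Im (\<Lambda> s) \<le> Im s + M"
begin

lemma C_per_int: "x + of_int k \<in> C \<longleftrightarrow> x \<in> C"
  by (rule periodic_set_int) (rule C_per)

lemma isCont_Lam: "s \<in> HP \<Longrightarrow> isCont \<Lambda> s"
  using holomorphic_on_imp_continuous_on[OF hol] continuous_on_eq_continuous_at[OF open_HP] by blast

lemma isCont_Psi: "w \<in> cleft C \<Longrightarrow> isCont \<Psi> w"
  using holomorphic_on_imp_continuous_on[OF hol_inv] continuous_on_eq_continuous_at[OF open_cleft[OF C_closed]] by blast

lemma per_int: "s \<in> HP \<Longrightarrow> \<Lambda> (s + of_int k) = \<Lambda> s + of_int k"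
proof (induction k rule: int_induct[of _ 0])
  case (step1 i)
  then show ?case using per[of "s + of_int i"] by (simp add: add.assoc)
next
  case (step2 i)
  then show ?case using per[of "s + of_int (i - 1)"] by (simp add: algebra_simps)
qed simp

lemma mono_Im:
  assumes "w \<in> cleft C" "Re w = Re w'" "Im w < Im w'"
  shows "Im (\<Psi> w) < Im (\<Psi> w')"
proof -
  have "w' = w + \<i> * of_real (Im w' - Im w)" using assms by (simp add: complex_eq_iff)
  then show ?thesis using mono[of w "Im w' - Im w"] assms by simp
qed

section \<open>The angle of the Riemann map along horizontal lines\<close>

definition V :: "real \<Rightarrow> real \<Rightarrow> real" where
  "V x y = Re (\<Lambda> (Complex x y))"

lemma V_per_int: assumes "y > 0" shows "V (x + of_int k) y = V x y + of_int k"
proof -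
  have "Complex (x + of_int k) y = Complex x y + of_int k" by (simp add: complex_eq_iff)
  then show ?thesis using per_int[of "Complex x y" k] assms by (simp add: V_def)
qed

lemma cont_Re_Lam: "continuous_on HP (\<lambda>s. Re (\<Lambda> s))"
  using holomorphic_on_imp_continuous_on[OF hol] by (rule continuous_on_Re)

lemma cont_V: "y > 0 \<Longrightarrow> continuous_on UNIV (\<lambda>x. V x y)"
  unfolding V_def Complex_eq
  by (rule continuous_on_compose2[OF cont_Re_Lam]) (auto intro!: continuous_intros)

text \<open>Two points at the same height with the same angle would have images on one vertical line
  of the slit domain, where \<open>mono\<close> makes the height of \<open>\<Psi>\<close> strictly
  increasing; so the angle is injective at each height.\<close>

lemma V_strict_mono: assumes y: "y > 0" shows "strict_mono (\<lambda>x. V x y)"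
proof (rule strict_mono_of_inj_periodic[OF cont_V[OF y]])
  show "V (x + 1) y = V x y + 1" for x using V_per_int[OF y, of x 1] by simp
  fix x x' assume eq: "V x y = V x' y"
  let ?s = "Complex x y" and ?s' = "Complex x' y"
  have s: "?s \<in> HP" "?s' \<in> HP" using y by auto
  have "\<not> Im (\<Lambda> ?s) < Im (\<Lambda> ?s')"
    using mono_Im[OF range[OF s(1)], of "\<Lambda> ?s'"] eq inv[OF s(1)] inv[OF s(2)] by (auto simp: V_def)
  moreover have "\<not> Im (\<Lambda> ?s') < Im (\<Lambda> ?s)"
    using mono_Im[OF range[OF s(2)], of "\<Lambda> ?s"] eq inv[OF s(1)] inv[OF s(2)] by (auto simp: V_def)
  ultimately have "\<Lambda> ?s = \<Lambda> ?s'" using eq by (simp add: V_def complex_eq_iff)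
  then show "x = x'" using inv[OF s(1)] inv[OF s(2)] by (metis complex.sel(1))
qed

lemma V_less: "y > 0 \<Longrightarrow> x < x' \<Longrightarrow> V x y < V x' y"
  using V_strict_mono strict_monoD by blast

lemma V_le: "y > 0 \<Longrightarrow> x \<le> x' \<Longrightarrow> V x y \<le> V x' y"
  using strict_mono_less_eq[OF V_strict_mono] by blast

section \<open>Bounded functions that are small at the end of a ray\<close>

lemma slit_sqrt:
  assumes \<theta>: "\<theta> \<in> C" and w: "w \<in> cleft C"
  shows "1 - exp (2 * pi * \<i> * (w - of_real \<theta>)) \<notin> \<real>\<^sub>\<le>\<^sub>0"
proof
  let ?q = "exp (2 * pi * \<i> * (w - of_real \<theta>))"
  assume "1 - ?q \<in> \<real>\<^sub>\<le>\<^sub>0"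
  \<comment> \<open>A value on the cut of the square root means that the exponential is real and at
    least 1: its modulus gives \<open>Im w \<le> 0\<close>, and its argument puts \<open>w\<close>
    over an integer translate of \<open>\<theta>\<close>, that is, on a slit.\<close>
  then have q: "Im ?q = 0" "Re ?q \<ge> 1" by (auto simp: complex_nonpos_Reals_iff)
  then have "?q = of_real (Re ?q)" by (simp add: complex_eq_iff)
  then have nq: "cmod ?q = Re ?q" using q by (metis norm_of_real abs_of_nonneg zero_le_one order_trans)
  then have "exp (- 2 * pi * Im w) \<ge> 1" using q by (simp add: norm_exp_eq_Re)
  then have "Im w \<le> 0" using pi_gt_zero by (auto simp: mult_le_0_iff simp del: pi_gt_zero)
  have "cos (2 * pi * (Re w - \<theta>)) = 1"
    using nq by (simp add: Re_exp norm_exp_eq_Re)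
  then obtain k where "2 * pi * (Re w - \<theta>) = of_int k * 2 * pi" using cos_one_2pi_int by auto
  then have "Re w = \<theta> + of_int k" by simp
  then have "Re w \<in> C" using C_per_int \<theta> by simp
  then show False using w \<open>Im w \<le> 0\<close> by simp
qed

text \<open>A nowhere vanishing function bounded by 1 that tends to 0 at the tip of the slit over \<open>\<theta>\<close>.\<close>

definition tip_fun :: "real \<Rightarrow> complex \<Rightarrow> complex" where
  "tip_fun \<theta> s = (let r = csqrt (1 - exp (2 * pi * \<i> * (\<Lambda> s - of_real \<theta>))) in r / (1 + r))"

text \<open>The root \<open>r\<close> has positive real part, whence
  \<open>cmod r \<le> cmod (1 + r)\<close>; division by \<open>1 + r\<close> makes the root bounded
  by 1 without introducing zeros.\<close>

lemma tip_fun: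
  assumes \<theta>: "\<theta> \<in> C"
  shows "tip_fun \<theta> holomorphic_on HP" "\<And>s. s \<in> HP \<Longrightarrow> cmod (tip_fun \<theta> s) \<le> 1"
    "\<And>s. s \<in> HP \<Longrightarrow> tip_fun \<theta> s \<noteq> 0"
proof -
  have ns: "1 - exp (2 * pi * \<i> * (\<Lambda> s - of_real \<theta>)) \<notin> \<real>\<^sub>\<le>\<^sub>0" if "s \<in> HP" for s
    using slit_sqrt[OF \<theta> range[OF that]] .
  have rp: "0 < Re (csqrt (1 - exp (2 * pi * \<i> * (\<Lambda> s - of_real \<theta>))))" if "s \<in> HP" for s
    using Re_csqrt_pos_slit[OF ns[OF that]] .
  have nz: "1 + csqrt (1 - exp (2 * pi * \<i> * (\<Lambda> s - of_real \<theta>))) \<noteq> 0" if "s \<in> HP" for s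
    using rp[OF that] by (auto simp: complex_eq_iff simp del: csqrt.simps)
  show "tip_fun \<theta> holomorphic_on HP"
    unfolding tip_fun_def Let_def
    by (intro holomorphic_intros hol) (use ns nz in auto)
  show "cmod (tip_fun \<theta> s) \<le> 1" if "s \<in> HP" for s
  proof -
    let ?r = "csqrt (1 - exp (2 * pi * \<i> * (\<Lambda> s - of_real \<theta>)))"
    have "(cmod ?r)\<^sup>2 \<le> (cmod (1 + ?r))\<^sup>2"
      unfolding cmod_power2 using rp[OF that] by (simp add: power2_eq_square algebra_simps del: csqrt.simps)
    then have "cmod ?r \<le> cmod (1 + ?r)" by (rule power2_le_imp_le) simp
    then show ?thesis using nz[OF that] by (simp add: tip_fun_def Let_def norm_divide del: csqrt.simps)
  qed
  show "tip_fun \<theta> s \<noteq> 0" if "s \<in> HP" for s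
    using rp[OF that] nz[OF that] by (auto simp: tip_fun_def Let_def simp del: csqrt.simps)
qed

text \<open>\<open>tip_fun\<close> sees \<open>\<Lambda> s\<close> only modulo integers, so the
  bound holds near all translates of the tip at once. This uniformity in \<open>k\<close> is
  inherited by the level curve estimate and used in \<open>V_bound\<close>.\<close>

lemma tip_fun_small:
  assumes \<theta>: "\<theta> \<in> C" and \<epsilon>: "\<epsilon> > 0"
  obtains \<eta> where "\<eta> > 0"
    "\<And>s k. s \<in> HP \<Longrightarrow> cmod (\<Lambda> s - of_real \<theta> - of_int k) \<le> \<eta> \<Longrightarrow> cmod (tip_fun \<theta> s) \<le> \<epsilon>"
proof -
  have "((\<lambda>u. 1 - exp (2 * pi * \<i> * u)) \<longlongrightarrow> 1 - exp (2 * pi * \<i> * 0)) (at 0)"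
    by (intro tendsto_intros)
  then have "((\<lambda>u::complex. 1 - exp (2 * pi * \<i> * u)) \<longlongrightarrow> 0) (at 0)" by simp
  then have "eventually (\<lambda>u::complex. cmod (1 - exp (2 * pi * \<i> * u)) < \<epsilon>\<^sup>2) (at 0)"
    using \<epsilon> by (auto simp: tendsto_iff)
  then obtain d where d: "d > 0" "\<And>u. u \<noteq> 0 \<Longrightarrow> cmod u < d \<Longrightarrow> cmod (1 - exp (2 * pi * \<i> * u)) < \<epsilon>\<^sup>2"
    unfolding eventually_at by auto
  have d': "cmod (1 - exp (2 * pi * \<i> * u)) < \<epsilon>\<^sup>2" if "cmod u < d" for u
    using d(2)[of u] that \<epsilon> by (cases "u = 0") auto
  show thesis
  proof (rule that[of "d/2"])
    show "d/2 > 0" using d by simp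
    fix s :: complex and k :: int
    assume s: "s \<in> HP" and le: "cmod (\<Lambda> s - of_real \<theta> - of_int k) \<le> d / 2"
    let ?u = "\<Lambda> s - of_real \<theta> - of_int k"
    have "exp (2 * pi * \<i> * (\<Lambda> s - of_real \<theta>)) = exp (2 * pi * \<i> * ?u + \<i> * (of_int k * (of_real pi * 2)))"
      by (simp add: algebra_simps)
    also have "\<dots> = exp (2 * pi * \<i> * ?u)" by (rule exp_plus_2pin)
    finally have e: "exp (2 * pi * \<i> * (\<Lambda> s - of_real \<theta>)) = exp (2 * pi * \<i> * ?u)" .
    let ?r = "csqrt (1 - exp (2 * pi * \<i> * (\<Lambda> s - of_real \<theta>)))"
    have "(cmod ?r)\<^sup>2 < \<epsilon>\<^sup>2" unfolding norm_power[symmetric] power2_csqrt e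
      using d'[of ?u] le d by simp
    then have r: "cmod ?r \<le> \<epsilon>" using \<epsilon> by (simp add: power2_less_imp_less less_imp_le)
    have rp: "0 < Re ?r" using Re_csqrt_pos_slit[OF slit_sqrt[OF \<theta> range[OF s]]] .
    have "1 \<le> Re (1 + ?r)" using rp by (simp del: csqrt.simps)
    also have "\<dots> \<le> cmod (1 + ?r)" by (rule complex_Re_le_cmod)
    finally have "cmod ?r / cmod (1 + ?r) \<le> \<epsilon> / 1"
      using r \<epsilon> by (intro frac_le) auto
    then show "cmod (tip_fun \<theta> s) \<le> \<epsilon>" by (simp add: tip_fun_def Let_def norm_divide del: csqrt.simps)
  qed
qed

text \<open>In the disc this is a constant multiple of \<open>z / \<phi> z\<close>: the counterpart
  of \<open>tip_fun\<close> for the point at infinity of the slit domain. The assumption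
  \<open>upper\<close> bounds it.\<close>

lemma end_fun:
  obtains f M where "f holomorphic_on HP" "\<And>s. s \<in> HP \<Longrightarrow> cmod (f s) \<le> 1"
    "\<And>s. s \<in> HP \<Longrightarrow> f s \<noteq> 0" "\<And>s N. s \<in> HP \<Longrightarrow> Im (\<Lambda> s) \<le> - N \<Longrightarrow> cmod (f s) \<le> exp (- 2 * pi * (N + M))"
proof -
  obtain M where M: "\<And>s. s \<in> HP \<Longrightarrow> Im (\<Lambda> s) \<le> Im s + M" using upper by blast
  define f where "f = (\<lambda>s. exp (2 * pi * \<i> * (s - \<Lambda> s) - 2 * pi * of_real M))"
  have nf: "cmod (f s) = exp (2 * pi * (Im (\<Lambda> s) - Im s - M))" for s
    by (simp add: f_def norm_exp_eq_Re algebra_simps)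
  show thesis
  proof (rule that[of f M])
    show "f holomorphic_on HP" unfolding f_def by (intro holomorphic_intros hol)
    show "cmod (f s) \<le> 1" if "s \<in> HP" for s
      unfolding nf using M[OF that] by (simp add: mult_le_0_iff)
    show "f s \<noteq> 0" for s by (simp add: f_def)
    show "cmod (f s) \<le> exp (- 2 * pi * (N + M))" if "s \<in> HP" "Im (\<Lambda> s) \<le> - N" for s N
    proof -
      have "2 * pi * (Im (\<Lambda> s) - Im s - M) \<le> 2 * pi * (- N - M)"
        using that by (intro mult_left_mono) auto
      then show ?thesis unfolding nf by (simp add: algebra_simps)
    qed
  qed
qed

text \<open>The ray over \<open>\<theta>\<close> ends at the tip of a slit if
  \<open>\<theta> \<in> C\<close> and runs to infinity otherwise; \<open>tip_fun\<close> serves in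
  the first case and \<open>end_fun\<close> in the second. By \<open>mono\<close>, low points
  \<open>s\<close> on the level curve have images far along the ray, which gives a height
  \<open>y0\<close> common to all integer translates of the ray.\<close>

lemma small_fun:
  obtains f where "f holomorphic_on HP" "\<And>s. s \<in> HP \<Longrightarrow> cmod (f s) \<le> 1"
    "\<And>s. s \<in> HP \<Longrightarrow> f s \<noteq> 0"
    "\<And>\<epsilon>. \<epsilon> > 0 \<Longrightarrow> \<exists>y0>0. \<forall>s k. 0 < Im s \<longrightarrow> Im s \<le> y0 \<longrightarrow> Re (\<Lambda> s) = \<theta> + of_int k \<longrightarrow> cmod (f s) \<le> \<epsilon>"
proof (cases "\<theta> \<in> C")
  case True
  show thesis
  proof (rule that[OF tip_fun[OF True]])
    fix \<epsilon> :: real assume "\<epsilon> > 0"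
    then obtain \<eta> where \<eta>: "\<eta> > 0"
      "\<And>s k. s \<in> HP \<Longrightarrow> cmod (\<Lambda> s - of_real \<theta> - of_int k) \<le> \<eta> \<Longrightarrow> cmod (tip_fun \<theta> s) \<le> \<epsilon>"
      using tip_fun_small[OF True] by blast
    let ?y = "Im (\<Psi> (Complex \<theta> \<eta>))"
    have "?y > 0" using range_inv[of "Complex \<theta> \<eta>"] \<eta> by simp
    moreover have "cmod (tip_fun \<theta> s) \<le> \<epsilon>"
      if s: "0 < Im s" "Im s \<le> ?y" "Re (\<Lambda> s) = \<theta> + of_int k" for s k
    proof -
      let ?w = "\<Lambda> s - of_int k"
      have sk: "s - of_int k \<in> HP" using s by simp
      have w: "?w = \<Lambda> (s - of_int k)" using per_int[of s "- k"] s by simp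
      have rw: "Re ?w = \<theta>" using s by simp
      have wC: "?w \<in> cleft C" unfolding w by (rule range[OF sk])
      have "Im ?w > 0" using wC rw True by simp
      moreover have "Im ?w \<le> \<eta>"
      proof (rule ccontr)
        assume "\<not> Im ?w \<le> \<eta>"
        then have "?y < Im (\<Psi> ?w)" using \<eta> rw by (intro mono_Im) auto
        also have "\<dots> = Im s" unfolding w inv[OF sk] by simp
        finally show False using s by simp
      qed
      moreover have "\<Lambda> s - of_real \<theta> - of_int k = \<i> * of_real (Im ?w)" using rw by (simp add: complex_eq_iff)
      ultimately have "cmod (\<Lambda> s - of_real \<theta> - of_int k) \<le> \<eta>" by (simp add: norm_mult)
      then show ?thesis using \<eta>(2)[of s k] s by simp
    qed
    ultimately show "\<exists>y0>0. \<forall>s k. 0 < Im s \<longrightarrow> Im s \<le> y0 \<longrightarrow> Re (\<Lambda> s) = \<theta> + of_int k \<longrightarrow> cmod (tip_fun \<theta> s) \<le> \<epsilon>"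
      by blast
  qed
next
  case False
  obtain f M where f: "f holomorphic_on HP" "\<And>s. s \<in> HP \<Longrightarrow> cmod (f s) \<le> 1" "\<And>s. s \<in> HP \<Longrightarrow> f s \<noteq> 0"
    "\<And>s N. s \<in> HP \<Longrightarrow> Im (\<Lambda> s) \<le> - N \<Longrightarrow> cmod (f s) \<le> exp (- 2 * pi * (N + M))"
    using end_fun by metis
  show thesis
  proof (rule that[OF f(1-3)])
    fix \<epsilon> :: real assume \<epsilon>: "\<epsilon> > 0"
    \<comment> \<open>The solution of \<open>exp (- 2 * pi * (N + M)) = \<epsilon>\<close>.\<close>
    define N where "N = - ln \<epsilon> / (2 * pi) - M"
    have eN: "exp (- 2 * pi * (N + M)) = \<epsilon>" using \<epsilon> by (simp add: N_def)
    let ?y = "Im (\<Psi> (Complex \<theta> (- N)))"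
    have "?y > 0" using range_inv[of "Complex \<theta> (- N)"] False by simp
    moreover have "cmod (f s) \<le> \<epsilon>"
      if s: "0 < Im s" "Im s \<le> ?y" "Re (\<Lambda> s) = \<theta> + of_int k" for s k
    proof -
      let ?w = "\<Lambda> s - of_int k"
      have sk: "s - of_int k \<in> HP" using s by simp
      have w: "?w = \<Lambda> (s - of_int k)" using per_int[of s "- k"] s by simp
      have rw: "Re ?w = \<theta>" using s by simp
      have "Im ?w \<le> - N"
      proof (rule ccontr)
        assume "\<not> Im ?w \<le> - N"
        then have "?y < Im (\<Psi> ?w)" using False rw by (intro mono_Im) auto
        also have "\<dots> = Im s" unfolding w inv[OF sk] by simp
        finally show False using s by simp
      qed
      then show ?thesis using f(4)[of s N] s eN by simp
    qed
    ultimately show "\<exists>y0>0. \<forall>s k. 0 < Im s \<longrightarrow> Im s \<le> y0 \<longrightarrow> Re (\<Lambda> s) = \<theta> + of_int k \<longrightarrow> cmod (f s) \<le> \<epsilon>"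
      by blast
  qed
qed

text \<open>Koebe's argument: a level curve of the angle cannot oscillate at the boundary.\<close>

lemma level_curve_no_oscillation:
  assumes ab: "a < b"
  obtains y0 where "y0 > 0"
    "\<And>y1 y2 k. \<lbrakk>0 < y1; y1 < y2; y2 \<le> y0; V b y2 < \<theta> + of_int k\<rbrakk> \<Longrightarrow> V a y1 \<le> \<theta> + of_int k"
    "\<And>y1 y2 k. \<lbrakk>0 < y1; y1 < y2; y2 \<le> y0; V a y2 > \<theta> + of_int k\<rbrakk> \<Longrightarrow> V b y1 \<ge> \<theta> + of_int k"
proof -
  obtain f where f: "f holomorphic_on HP" "\<And>s. s \<in> HP \<Longrightarrow> cmod (f s) \<le> 1" "\<And>s. s \<in> HP \<Longrightarrow> f s \<noteq> 0"
    "\<And>\<epsilon>. \<epsilon> > 0 \<Longrightarrow> \<exists>y0>0. \<forall>s k. 0 < Im s \<longrightarrow> Im s \<le> y0 \<longrightarrow> Re (\<Lambda> s) = \<theta> + of_int k \<longrightarrow> cmod (f s) \<le> \<epsilon>"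
    using small_fun[of \<theta>] by blast
  obtain \<epsilon> where \<epsilon>: "\<epsilon> > 0"
    and sw: "\<And>P y1 y0. \<lbrakk>0 < y1; y1 < y0; y0 < 1; continuous_on HP P;
      \<And>x. x \<in> {a..b} \<Longrightarrow> P (Complex x y0) < (0::real);
      \<And>x. x \<in> {a..b} \<Longrightarrow> P (Complex x y1) > 0;
      \<And>s. Re s \<in> {a..b} \<Longrightarrow> Im s \<in> {y1..y0} \<Longrightarrow> P s = 0 \<Longrightarrow> cmod (f s) \<le> \<epsilon>\<rbrakk> \<Longrightarrow> False"
  proof (rule sweep_contradiction[OF f(1) _ _ ab])
    show "cmod (f s) \<le> 1" if "0 < Im s" for s using f(2) that by simp
    show "f (Complex ((a + b) / 2) 1) \<noteq> 0" using f(3) by simp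
  qed blast
  obtain y0 where y0: "y0 > 0" and sm: "\<And>s k. \<lbrakk>0 < Im s; Im s \<le> y0; Re (\<Lambda> s) = \<theta> + of_int k\<rbrakk> \<Longrightarrow> cmod (f s) \<le> \<epsilon>"
    using f(4)[OF \<epsilon>] by blast
  show thesis
  proof (rule that[of "min y0 (1/2)"])
    show "min y0 (1/2) > 0" using y0 by simp
    fix y1 y2 :: real and k :: int
    assume y: "0 < y1" "y1 < y2" "y2 \<le> min y0 (1/2)"
    show "V a y1 \<le> \<theta> + of_int k" if vb: "V b y2 < \<theta> + of_int k"
    proof (rule ccontr)
      assume va: "\<not> V a y1 \<le> \<theta> + of_int k"
      \<comment> \<open>Since \<open>V\<close> increases in \<open>x\<close>, its value at
        \<open>b\<close> decides the sign on the whole segment at height \<open>y2\<close>, and its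
        value at \<open>a\<close> the sign at height \<open>y1\<close>; the level curve separates
        the two segments.\<close>
      show False
      proof (rule sw[of y1 y2 "\<lambda>s. Re (\<Lambda> s) - (\<theta> + of_int k)"])
        show "continuous_on HP (\<lambda>s. Re (\<Lambda> s) - (\<theta> + of_int k))"
          by (intro continuous_intros cont_Re_Lam)
        show "Re (\<Lambda> (Complex x y2)) - (\<theta> + of_int k) < 0" if "x \<in> {a..b}" for x
          using V_le[of y2 x b] vb that y by (simp add: V_def)
        show "0 < Re (\<Lambda> (Complex x y1)) - (\<theta> + of_int k)" if "x \<in> {a..b}" for x
          using V_le[of y1 a x] va that y by (simp add: V_def)
        show "cmod (f s) \<le> \<epsilon>" if "Im s \<in> {y1..y2}" "Re (\<Lambda> s) - (\<theta> + of_int k) = 0" for s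
          using sm[of s k] that y by simp
      qed (use y in auto)
    qed
    show "V b y1 \<ge> \<theta> + of_int k" if va: "V a y2 > \<theta> + of_int k"
    proof (rule ccontr)
      assume vb: "\<not> V b y1 \<ge> \<theta> + of_int k"
      show False
      proof (rule sw[of y1 y2 "\<lambda>s. (\<theta> + of_int k) - Re (\<Lambda> s)"])
        show "continuous_on HP (\<lambda>s. (\<theta> + of_int k) - Re (\<Lambda> s))"
          by (intro continuous_intros cont_Re_Lam)
        show "(\<theta> + of_int k) - Re (\<Lambda> (Complex x y2)) < 0" if "x \<in> {a..b}" for x
          using V_le[of y2 a x] va that y by (simp add: V_def)
        show "0 < (\<theta> + of_int k) - Re (\<Lambda> (Complex x y1))" if "x \<in> {a..b}" for x
          using V_le[of y1 x b] vb that y by (simp add: V_def)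
        show "cmod (f s) \<le> \<epsilon>" if "Im s \<in> {y1..y2}" "(\<theta> + of_int k) - Re (\<Lambda> s) = 0" for s
          using sm[of s k] that y by simp
      qed (use y in auto)
    qed
  qed
qed

lemma V_shift_le: "y > 0 \<Longrightarrow> \<bar>V x y - x\<bar> \<le> \<bar>V 0 y\<bar> + 1"
proof -
  assume y: "y > 0"
  have "V (0 + of_int \<lfloor>x\<rfloor>) y \<le> V x y" "V x y \<le> V (0 + of_int (\<lfloor>x\<rfloor> + 1)) y"
    using y by (intro V_le; simp; linarith)+
  then show ?thesis unfolding V_per_int[OF y] by (simp; linarith)
qed

text \<open>At heights above a fixed \<open>y0\<close> this follows from \<open>far\<close>. Below
  \<open>y0\<close>, an integer level beyond the value at abscissa 1 or -1 and height
  \<open>y0\<close> is a barrier for the values at abscissa 0; this works because the threshold in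
  \<open>level_curve_no_oscillation\<close> is independent of \<open>k\<close>.\<close>

lemma V_bound: obtains B where "\<And>x y. y > 0 \<Longrightarrow> \<bar>V x y - x\<bar> \<le> B"
proof -
  obtain y1 where y1: "y1 > 0" and u: "\<And>y y' k. \<lbrakk>0 < y; y < y'; y' \<le> y1; V 1 y' < 0 + of_int k\<rbrakk> \<Longrightarrow> V 0 y \<le> 0 + of_int k"
    using level_curve_no_oscillation[of 0 1 0] by (metis zero_less_one)
  obtain y2 where y2: "y2 > 0" and l: "\<And>y y' k. \<lbrakk>0 < y; y < y'; y' \<le> y2; V (-1) y' > 0 + of_int k\<rbrakk> \<Longrightarrow> V 0 y \<ge> 0 + of_int k"
    using level_curve_no_oscillation[of "-1" 0 0] by (metis neg_less_0_iff_less zero_less_one)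
  define y0 where "y0 = min y1 y2"
  have y0: "y0 > 0" using y1 y2 by (simp add: y0_def)
  obtain B0 where B0: "\<And>s. Im s \<ge> y0 \<Longrightarrow> cmod (\<Lambda> s - s) \<le> B0" using far[OF y0] by blast
  define k1 where "k1 = \<lfloor>V 1 y0\<rfloor> + 1"
  define k2 where "k2 = \<lceil>V (-1) y0\<rceil> - 1"
  have "\<bar>V 0 y\<bar> \<le> B0 + \<bar>k1\<bar> + \<bar>k2\<bar>" if y: "y > 0" for y
  proof (cases "y < y0")
    case True
    have "y0 \<le> y1" "y0 \<le> y2" by (simp_all add: y0_def)
    moreover have "V 1 y0 < 0 + of_int k1" "V (-1) y0 > 0 + of_int k2" unfolding k1_def k2_def by linarith+
    ultimately have "V 0 y \<le> 0 + of_int k1" "V 0 y \<ge> 0 + of_int k2"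
      using u[of y y0 k1] l[of y y0 k2] y True by auto
    moreover have "0 \<le> cmod (\<Lambda> (Complex 0 y0) - Complex 0 y0)" "cmod (\<Lambda> (Complex 0 y0) - Complex 0 y0) \<le> B0"
      using B0[of "Complex 0 y0"] by simp_all
    ultimately show ?thesis by (simp add: abs_le_iff; linarith)
  next
    case False
    have "\<bar>Re (\<Lambda> (Complex 0 y) - Complex 0 y)\<bar> \<le> B0"
      using B0[of "Complex 0 y"] False abs_Re_le_cmod[of "\<Lambda> (Complex 0 y) - Complex 0 y"] by simp
    then show ?thesis by (simp add: V_def; linarith)
  qed
  then have "\<bar>V x y - x\<bar> \<le> (B0 + \<bar>k1\<bar> + \<bar>k2\<bar>) + 1" if "y > 0" for x y
    using V_shift_le[OF that, of x] that by fastforce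
  then show thesis using that by blast
qed

text \<open>\<open>X \<theta>\<close> is the boundary point at which the level curve \<open>Re \<Lambda> = \<theta>\<close> ends.\<close>

definition X :: "real \<Rightarrow> real" where
  "X \<theta> = Sup {a. eventually (\<lambda>y. V a y \<le> \<theta>) (at_right 0)}"

lemma eventually_at_right_0I: "y0 > 0 \<Longrightarrow> (\<And>y. 0 < y \<Longrightarrow> y < y0 \<Longrightarrow> P y) \<Longrightarrow> eventually P (at_right (0::real))"
  unfolding eventually_at_right_field by blast

lemma eventually_at_right_0_pos: "eventually (\<lambda>y. y > 0) (at_right (0::real))"
  by (rule eventually_at_right_less)

lemma X_set_bounds:
  obtains B where "\<And>\<theta>. \<theta> - B \<in> {a. eventually (\<lambda>y. V a y \<le> \<theta>) (at_right 0)}"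
    "\<And>\<theta> a. a \<in> {a. eventually (\<lambda>y. V a y \<le> \<theta>) (at_right 0)} \<Longrightarrow> a \<le> \<theta> + B"
proof -
  obtain B where B: "\<And>x y. y > 0 \<Longrightarrow> \<bar>V x y - x\<bar> \<le> B" using V_bound by blast
  show thesis
  proof (rule that[of B])
    fix \<theta>
    show "\<theta> - B \<in> {a. eventually (\<lambda>y. V a y \<le> \<theta>) (at_right 0)}"
      using eventually_at_right_0_pos by (auto elim!: eventually_mono dest: B[of _ "\<theta> - B"])
    fix a assume "a \<in> {a. eventually (\<lambda>y. V a y \<le> \<theta>) (at_right 0)}"
    then have "eventually (\<lambda>y. V a y \<le> \<theta> \<and> y > 0) (at_right 0)"
      using eventually_at_right_0_pos by (simp add: eventually_conj)
    then obtain y where "V a y \<le> \<theta>" "y > 0"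
      using eventually_happens trivial_limit_at_right_real by blast
    then show "a \<le> \<theta> + B" using B[of y a] by linarith
  qed
qed

lemma X_bound: obtains B where "\<And>\<theta>. \<bar>X \<theta> - \<theta>\<bar> \<le> B"
proof -
  obtain B where B: "\<And>\<theta>. \<theta> - B \<in> {a. eventually (\<lambda>y. V a y \<le> \<theta>) (at_right 0)}"
    "\<And>\<theta> a. a \<in> {a. eventually (\<lambda>y. V a y \<le> \<theta>) (at_right 0)} \<Longrightarrow> a \<le> \<theta> + B"
    using X_set_bounds by metis
  have "\<bar>X \<theta> - \<theta>\<bar> \<le> B" for \<theta>
  proof -
    have "\<theta> - B \<le> X \<theta>" unfolding X_def
      by (rule cSup_upper[OF B(1)]) (use B(2) in \<open>auto simp: bdd_above_def\<close>)
    moreover have "X \<theta> \<le> \<theta> + B" unfolding X_def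
      by (rule cSup_least) (use B in blast)+
    ultimately show ?thesis by linarith
  qed
  then show thesis using that by blast
qed

lemma X_less:
  assumes "a < X \<theta>" shows "eventually (\<lambda>y. V a y < \<theta>) (at_right 0)"
proof -
  obtain B where B: "\<And>\<theta>. \<theta> - B \<in> {a. eventually (\<lambda>y. V a y \<le> \<theta>) (at_right 0)}"
    "\<And>\<theta> a. a \<in> {a. eventually (\<lambda>y. V a y \<le> \<theta>) (at_right 0)} \<Longrightarrow> a \<le> \<theta> + B"
    using X_set_bounds by metis
  obtain a' where a': "a < a'" "eventually (\<lambda>y. V a' y \<le> \<theta>) (at_right 0)"
    using less_cSupD[of "{a. eventually (\<lambda>y. V a y \<le> \<theta>) (at_right 0)}" a] assms B(1) unfolding X_def by blast
  show ?thesis using a'(2) eventually_at_right_0_pos by eventually_elim (use V_less a'(1) in fastforce)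
qed

text \<open>The supremum only shows that \<open>V a y \<le> \<theta>\<close> fails at arbitrarily
  small heights. Koebe's argument upgrades this: one small height with
  \<open>V c y2 < \<theta>\<close> would force \<open>V a y \<le> \<theta>\<close> at all lower
  heights. Passing from \<open>c\<close> to \<open>b\<close> makes the inequality strict.\<close>

lemma X_gt:
  assumes "X \<theta> < b" shows "eventually (\<lambda>y. V b y > \<theta>) (at_right 0)"
proof -
  obtain B where B: "\<And>\<theta>. \<theta> - B \<in> {a. eventually (\<lambda>y. V a y \<le> \<theta>) (at_right 0)}"
    "\<And>\<theta> a. a \<in> {a. eventually (\<lambda>y. V a y \<le> \<theta>) (at_right 0)} \<Longrightarrow> a \<le> \<theta> + B"
    using X_set_bounds by metis
  define a where "a = X \<theta> + (b - X \<theta>) / 3"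
  define c where "c = X \<theta> + 2 * (b - X \<theta>) / 3"
  have abc: "X \<theta> < a" "a < c" "c < b" using assms by (auto simp: a_def c_def field_simps)
  have na: "\<not> eventually (\<lambda>y. V a y \<le> \<theta>) (at_right 0)"
  proof
    assume "eventually (\<lambda>y. V a y \<le> \<theta>) (at_right 0)"
    then have "a \<le> X \<theta>" unfolding X_def
      by (intro cSup_upper) (use B(2)[of _ \<theta>] in \<open>auto simp: bdd_above_def\<close>)
    then show False using abc by simp
  qed
  obtain y0 where y0: "y0 > 0"
    "\<And>y1 y2 k. \<lbrakk>0 < y1; y1 < y2; y2 \<le> y0; V c y2 < \<theta> + of_int k\<rbrakk> \<Longrightarrow> V a y1 \<le> \<theta> + of_int k"
    using level_curve_no_oscillation[OF abc(2), of \<theta>] by metis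
  have "V c y2 \<ge> \<theta>" if y2: "0 < y2" "y2 < y0" for y2
  proof (rule ccontr)
    assume "\<not> V c y2 \<ge> \<theta>"
    then have "V a y1 \<le> \<theta>" if "0 < y1" "y1 < y2" for y1
      using y0(2)[of y1 y2 0] y2 that by simp
    then have "eventually (\<lambda>y. V a y \<le> \<theta>) (at_right 0)" by (rule eventually_at_right_0I[OF y2(1)])
    then show False using na by contradiction
  qed
  then have "eventually (\<lambda>y. V c y \<ge> \<theta>) (at_right 0)" by (rule eventually_at_right_0I[OF y0(1)])
  then show ?thesis using eventually_at_right_0_pos by eventually_elim (use V_less abc in fastforce)
qed

lemma eventually_at_right_0_ex: "eventually P (at_right (0::real)) \<Longrightarrow> \<exists>y. P y"
  using eventually_happens trivial_limit_at_right_real by blast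

text \<open>Unlike the supremum in the definition of \<open>X\<close>, this criterion treats left
  and right alike; it identifies \<open>X\<close> for the reflected map and at integer
  translates.\<close>

lemma X_eqI:
  assumes "\<And>a. a < x \<Longrightarrow> eventually (\<lambda>y. V a y \<le> \<theta>) (at_right 0)"
    and "\<And>b. x < b \<Longrightarrow> eventually (\<lambda>y. V b y \<ge> \<theta>) (at_right 0)"
  shows "X \<theta> = x"
proof (rule ccontr)
  assume "X \<theta> \<noteq> x"
  then consider "X \<theta> < x" | "x < X \<theta>" by linarith
  then show False
  proof cases
    case 1
    then obtain a where a: "X \<theta> < a" "a < x" using dense by blast
    then have "eventually (\<lambda>y. V a y > \<theta> \<and> V a y \<le> \<theta>) (at_right 0)"
      using assms(1) X_gt by (intro eventually_conj) auto
    then show False using eventually_at_right_0_ex by fastforce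
  next
    case 2
    then obtain a where a: "x < a" "a < X \<theta>" using dense by blast
    then have "eventually (\<lambda>y. V a y < \<theta> \<and> V a y \<ge> \<theta>) (at_right 0)"
      using assms(2) X_less by (intro eventually_conj) auto
    then show False using eventually_at_right_0_ex by fastforce
  qed
qed

lemma X_mono: assumes "\<theta> \<le> \<theta>'" shows "X \<theta> \<le> X \<theta>'"
proof (rule ccontr)
  assume "\<not> X \<theta> \<le> X \<theta>'"
  then obtain a where a: "X \<theta>' < a" "a < X \<theta>" using dense not_le by metis
  then have "eventually (\<lambda>y. V a y < \<theta> \<and> V a y > \<theta>') (at_right 0)"
    using X_gt X_less by (intro eventually_conj) auto
  then show False using eventually_at_right_0_ex assms by fastforce
qed

text \<open>With its companion \<open>cluster_X_ge\<close>, this bounds a boundary point by the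
  limit angle of a sequence tending to it: \<open>x\<close> lies between the one-sided limits of
  \<open>X\<close> at \<open>\<theta>\<close>. Where \<open>X\<close> does not jump, the limit angle
  determines \<open>x\<close>.\<close>

lemma cluster_X_le:
  assumes s: "\<And>n. s n \<in> HP" "s \<longlonglongrightarrow> of_real x" and \<theta>: "(\<lambda>n. Re (\<Lambda> (s n))) \<longlonglongrightarrow> \<theta>" and lt: "\<theta>' < \<theta>"
  shows "X \<theta>' \<le> x"
proof (rule ccontr)
  assume "\<not> X \<theta>' \<le> x"
  then obtain a where a: "x < a" "a < X \<theta>'" using dense not_le by metis
  obtain y0 where y0: "y0 > 0" "\<And>y. 0 < y \<Longrightarrow> y < y0 \<Longrightarrow> V a y < \<theta>'"
    using X_less[OF a(2)] unfolding eventually_at_right_field by blast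
  have "(\<lambda>n. Re (s n)) \<longlonglongrightarrow> x" "(\<lambda>n. Im (s n)) \<longlonglongrightarrow> 0"
    using tendsto_Re[OF s(2)] tendsto_Im[OF s(2)] by auto
  then have "eventually (\<lambda>n. Re (s n) < a) sequentially" "eventually (\<lambda>n. Im (s n) < y0) sequentially"
    using a(1) y0(1) by (auto intro: order_tendstoD(2))
  then have "eventually (\<lambda>n. Re (\<Lambda> (s n)) \<le> \<theta>') sequentially"
  proof eventually_elim
    case (elim n)
    have "Re (\<Lambda> (s n)) = V (Re (s n)) (Im (s n))" by (simp add: V_def)
    also have "\<dots> \<le> V a (Im (s n))" using elim s(1)[of n] by (intro V_le) auto
    also have "\<dots> < \<theta>'" using y0 elim s(1)[of n] by auto
    finally show ?case by simp
  qed
  then have "\<theta> \<le> \<theta>'" using tendsto_upperbound[OF \<theta>] by simp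
  then show False using lt by simp
qed

lemma cluster_X_ge:
  assumes s: "\<And>n. s n \<in> HP" "s \<longlonglongrightarrow> of_real x" and \<theta>: "(\<lambda>n. Re (\<Lambda> (s n))) \<longlonglongrightarrow> \<theta>" and lt: "\<theta> < \<theta>'"
  shows "x \<le> X \<theta>'"
proof (rule ccontr)
  assume "\<not> x \<le> X \<theta>'"
  then obtain a where a: "a < x" "X \<theta>' < a" using dense not_le by metis
  obtain y0 where y0: "y0 > 0" "\<And>y. 0 < y \<Longrightarrow> y < y0 \<Longrightarrow> V a y > \<theta>'"
    using X_gt[OF a(2)] unfolding eventually_at_right_field by blast
  have "(\<lambda>n. Re (s n)) \<longlonglongrightarrow> x" "(\<lambda>n. Im (s n)) \<longlonglongrightarrow> 0"
    using tendsto_Re[OF s(2)] tendsto_Im[OF s(2)] by auto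
  then have "eventually (\<lambda>n. Re (s n) > a) sequentially" "eventually (\<lambda>n. Im (s n) < y0) sequentially"
    using a(1) y0(1) by (auto intro: order_tendstoD)
  then have "eventually (\<lambda>n. Re (\<Lambda> (s n)) \<ge> \<theta>') sequentially"
  proof eventually_elim
    case (elim n)
    have "\<theta>' < V a (Im (s n))" using y0 elim s(1)[of n] by auto
    also have "\<dots> \<le> V (Re (s n)) (Im (s n))" using elim s(1)[of n] by (intro V_le) auto
    also have "\<dots> = Re (\<Lambda> (s n))" by (simp add: V_def)
    finally show ?case by simp
  qed
  then have "\<theta>' \<le> \<theta>" using tendsto_lowerbound[OF \<theta>] by simp
  then show False using lt by simp
qed

text \<open>Monotonicity of \<open>V\<close> traps the points between two level curves with a common
  end point. In contrast to the cluster lemmas, the convergence of \<open>s\<close> is a conclusion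
  here.\<close>

lemma X_squeeze:
  assumes s: "\<And>n. s n \<in> HP" "(\<lambda>n. Im (s n)) \<longlonglongrightarrow> 0"
    and bd: "\<And>n. \<theta>1 \<le> Re (\<Lambda> (s n))" "\<And>n. Re (\<Lambda> (s n)) \<le> \<theta>2" and X: "X \<theta>1 = x" "X \<theta>2 = x"
  shows "s \<longlonglongrightarrow> of_real x"
proof -
  have "(\<lambda>n. Re (s n)) \<longlonglongrightarrow> x"
  proof (rule order_tendstoI)
    fix a assume "a < x"
    then obtain y0 where y0: "y0 > 0" "\<And>y. 0 < y \<Longrightarrow> y < y0 \<Longrightarrow> V a y < \<theta>1"
      using X_less[of a \<theta>1] X unfolding eventually_at_right_field by auto
    have "eventually (\<lambda>n. Im (s n) < y0) sequentially" using s(2) y0(1) by (auto intro: order_tendstoD)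
    then show "eventually (\<lambda>n. a < Re (s n)) sequentially"
    proof eventually_elim
      case (elim n)
      have "V a (Im (s n)) < V (Re (s n)) (Im (s n))"
        using y0(2)[of "Im (s n)"] elim s(1)[of n] bd(1)[of n] by (simp add: V_def)
      then show ?case using V_le[of "Im (s n)" "Re (s n)" a] s(1)[of n] by fastforce
    qed
  next
    fix a assume "x < a"
    then obtain y0 where y0: "y0 > 0" "\<And>y. 0 < y \<Longrightarrow> y < y0 \<Longrightarrow> V a y > \<theta>2"
      using X_gt[of \<theta>2 a] X unfolding eventually_at_right_field by auto
    have "eventually (\<lambda>n. Im (s n) < y0) sequentially" using s(2) y0(1) by (auto intro: order_tendstoD)
    then show "eventually (\<lambda>n. Re (s n) < a) sequentially"
    proof eventually_elim
      case (elim n)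
      have "V (Re (s n)) (Im (s n)) < V a (Im (s n))"
        using y0(2)[of "Im (s n)"] elim s(1)[of n] bd(2)[of n] by (simp add: V_def)
      then show ?case using V_le[of "Im (s n)" a "Re (s n)"] s(1)[of n] by fastforce
    qed
  qed
  then have "(\<lambda>n. Complex (Re (s n)) (Im (s n))) \<longlonglongrightarrow> Complex x 0" using s(2) by (rule tendsto_Complex)
  then show ?thesis by (simp add: complex_of_real_def)
qed

text \<open>Over a gap no slit stops the rays, so close to a boundary interval between two different
  end points the images under \<open>\<Lambda>\<close> would be uniformly far down. The set
  \<open>Im (\<Lambda> s) = - N\<close> would then separate that interval from a fixed point, and
  the function of \<open>end_fun\<close> is small on it.\<close>

lemma X_gap:
  assumes le: "\<theta> \<le> \<theta>'" and gap: "{\<theta>..\<theta>'} \<inter> C = {}"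
  shows "X \<theta> = X \<theta>'"
proof (rule ccontr)
  assume "X \<theta> \<noteq> X \<theta>'"
  then have lt: "X \<theta> < X \<theta>'" using X_mono[OF le] by simp
  define a where "a = X \<theta> + (X \<theta>' - X \<theta>) / 3"
  define b where "b = X \<theta> + 2 * (X \<theta>' - X \<theta>) / 3"
  have ab: "X \<theta> < a" "a < b" "b < X \<theta>'" using lt by (auto simp: a_def b_def field_simps)
  obtain f M where f: "f holomorphic_on HP" "\<And>s. s \<in> HP \<Longrightarrow> cmod (f s) \<le> 1" "\<And>s. s \<in> HP \<Longrightarrow> f s \<noteq> 0"
    "\<And>s N. s \<in> HP \<Longrightarrow> Im (\<Lambda> s) \<le> - N \<Longrightarrow> cmod (f s) \<le> exp (- 2 * pi * (N + M))"
    using end_fun by metis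
  obtain \<epsilon> where \<epsilon>: "\<epsilon> > 0"
    and sw: "\<And>P y1 y0. \<lbrakk>0 < y1; y1 < y0; y0 < 1; continuous_on HP P;
      \<And>x. x \<in> {a..b} \<Longrightarrow> P (Complex x y0) < (0::real);
      \<And>x. x \<in> {a..b} \<Longrightarrow> P (Complex x y1) > 0;
      \<And>s. Re s \<in> {a..b} \<Longrightarrow> Im s \<in> {y1..y0} \<Longrightarrow> P s = 0 \<Longrightarrow> cmod (f s) \<le> \<epsilon>\<rbrakk> \<Longrightarrow> False"
  proof (rule sweep_contradiction[OF f(1) _ _ ab(2)])
    show "cmod (f s) \<le> 1" if "0 < Im s" for s using f(2) that by simp
    show "f (Complex ((a + b) / 2) 1) \<noteq> 0" using f(3) by simp
  qed blast
  obtain B0 where B0: "\<And>s. Im s \<ge> 1/2 \<Longrightarrow> cmod (\<Lambda> s - s) \<le> B0" using far[of "1/2"] by auto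
  \<comment> \<open>The first term makes \<open>f\<close> at most \<open>\<epsilon>\<close> on the
    separating set, the second keeps the image of the segment at height 1/2 above the level
    \<open>- N\<close>.\<close>
  define N where "N = max (- ln \<epsilon> / (2 * pi) - M) (B0 + 1)"
  have "- 2 * pi * (N + M) \<le> - 2 * pi * (- ln \<epsilon> / (2 * pi))"
    by (rule mult_left_mono_neg) (auto simp: N_def)
  then have "- 2 * pi * (N + M) \<le> ln \<epsilon>" by simp
  then have eN: "exp (- 2 * pi * (N + M)) \<le> \<epsilon>" using \<epsilon> by (metis exp_le_cancel_iff exp_ln)
  \<comment> \<open>The height over \<open>W\<close> of the preimage of the line
    \<open>Im w = - N - 1\<close>, bounded below by compactness of the interval of angles; by
    \<open>mono\<close>, lower points are mapped below that line. The extra 1 leaves room for the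
    strict inequality in \<open>mono_Im\<close>.\<close>
  define m where "m = (\<lambda>W. Im (\<Psi> (Complex W (- N - 1))))"
  have mc: "continuous_on {\<theta>..\<theta>'} m" unfolding m_def
    by (intro continuous_on_Im continuous_on_compose2[OF holomorphic_on_imp_continuous_on[OF hol_inv]])
       (use gap in \<open>auto simp: Complex_eq intro!: continuous_intros\<close>)
  obtain W0 where W0: "W0 \<in> {\<theta>..\<theta>'}" "\<And>W. W \<in> {\<theta>..\<theta>'} \<Longrightarrow> m W0 \<le> m W"
    using continuous_attains_inf[OF _ _ mc] le by auto
  have "W0 \<notin> C" using W0(1) gap by blast
  then have m0: "m W0 > 0" using range_inv[of "Complex W0 (- N - 1)"] by (simp add: m_def)
  have "eventually (\<lambda>y. V a y > \<theta>) (at_right 0)" "eventually (\<lambda>y. V b y < \<theta>') (at_right 0)"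
    using X_gt X_less ab by auto
  moreover have "eventually (\<lambda>y. y < min (m W0) (1/2)) (at_right 0)"
    using m0 by (intro eventually_at_right_0I[of "min (m W0) (1/2)"]) auto
  ultimately have "eventually (\<lambda>y. V a y > \<theta> \<and> V b y < \<theta>' \<and> y < min (m W0) (1/2) \<and> y > 0) (at_right 0)"
    using eventually_at_right_0_pos by eventually_elim auto
  then obtain y1 where y1: "V a y1 > \<theta>" "V b y1 < \<theta>'" "y1 < m W0" "y1 < 1/2" "y1 > 0"
    using eventually_at_right_0_ex by fastforce
  show False
  proof (rule sw[of y1 "1/2" "\<lambda>s. - N - Im (\<Lambda> s)"])
    show "continuous_on HP (\<lambda>s. - N - Im (\<Lambda> s))"
      by (intro continuous_intros continuous_on_Im holomorphic_on_imp_continuous_on[OF hol])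
    show "- N - Im (\<Lambda> (Complex x (1/2))) < 0" if "x \<in> {a..b}" for x
    proof -
      have "\<bar>Im (\<Lambda> (Complex x (1/2)) - Complex x (1/2))\<bar> \<le> B0"
        using B0[of "Complex x (1/2)"] abs_Im_le_cmod[of "\<Lambda> (Complex x (1/2)) - Complex x (1/2)"] by simp
      then show ?thesis by (simp add: N_def; linarith)
    qed
    show "0 < - N - Im (\<Lambda> (Complex x y1))" if x: "x \<in> {a..b}" for x
    proof (rule ccontr)
      let ?w = "\<Lambda> (Complex x y1)"
      assume "\<not> 0 < - N - Im ?w"
      then have i: "Im ?w > - N - 1" by simp
      have "V x y1 \<in> {\<theta>..\<theta>'}" using V_le[of y1 a x] V_le[of y1 x b] x y1 by auto
      then have r: "Re ?w \<in> {\<theta>..\<theta>'}" by (simp add: V_def)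
      have "m (Re ?w) < Im (\<Psi> ?w)" unfolding m_def
        using i r gap by (intro mono_Im) auto
      also have "\<dots> = y1" using inv[of "Complex x y1"] y1 by simp
      finally show False using W0(2)[OF r] y1 by simp
    qed
    show "cmod (f s) \<le> \<epsilon>" if "Im s \<in> {y1..1/2}" "- N - Im (\<Lambda> s) = 0" for s
      using f(4)[of s N] that y1 eN by auto
  qed (use y1 in auto)
qed

text \<open>Left continuity of \<open>X\<close> at a left limit point of \<open>C\<close>: over
  angles \<open>\<theta>'\<close> of \<open>C\<close> just below \<open>\<theta>\<close>, the low
  part of the level curve has its image between the heights 0 and \<open>\<eta>/2\<close>, hence
  close to the tip over \<open>\<theta>\<close>. A jump would make such a curve sweep across a fixed
  interval while \<open>tip_fun\<close> is small on it.\<close>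

lemma X_left_limit:
  assumes \<theta>: "\<theta> \<in> C" and lim: "\<And>\<delta>. \<delta> > 0 \<Longrightarrow> \<exists>\<theta>'\<in>C. \<theta> - \<delta> < \<theta>' \<and> \<theta>' < \<theta>" and p: "p < X \<theta>"
  shows "\<exists>\<theta>'<\<theta>. p < X \<theta>'"
proof (rule ccontr)
  assume "\<not> ?thesis"
  then have np: "\<And>\<theta>'. \<theta>' < \<theta> \<Longrightarrow> X \<theta>' \<le> p" by force
  define a where "a = p + (X \<theta> - p) / 3"
  define b where "b = p + 2 * (X \<theta> - p) / 3"
  have ab: "p < a" "a < b" "b < X \<theta>" using p by (auto simp: a_def b_def field_simps)
  obtain \<epsilon> where \<epsilon>: "\<epsilon> > 0"
    and sw: "\<And>P y1 y0. \<lbrakk>0 < y1; y1 < y0; y0 < 1; continuous_on HP P;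
      \<And>x. x \<in> {a..b} \<Longrightarrow> P (Complex x y0) < (0::real);
      \<And>x. x \<in> {a..b} \<Longrightarrow> P (Complex x y1) > 0;
      \<And>s. Re s \<in> {a..b} \<Longrightarrow> Im s \<in> {y1..y0} \<Longrightarrow> P s = 0 \<Longrightarrow> cmod (tip_fun \<theta> s) \<le> \<epsilon>\<rbrakk> \<Longrightarrow> False"
  proof (rule sweep_contradiction[OF tip_fun(1)[OF \<theta>] _ _ ab(2)])
    show "cmod (tip_fun \<theta> s) \<le> 1" if "0 < Im s" for s using tip_fun(2)[OF \<theta>] that by simp
    show "tip_fun \<theta> (Complex ((a + b) / 2) 1) \<noteq> 0" using tip_fun(3)[OF \<theta>] by simp
  qed blast
  obtain \<eta> where \<eta>: "\<eta> > 0"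
    "\<And>s k. s \<in> HP \<Longrightarrow> cmod (\<Lambda> s - of_real \<theta> - of_int k) \<le> \<eta> \<Longrightarrow> cmod (tip_fun \<theta> s) \<le> \<epsilon>"
    using tip_fun_small[OF \<theta> \<epsilon>] by blast
  define m where "m = (\<lambda>W. Im (\<Psi> (Complex W (\<eta>/2))))"
  have "continuous_on UNIV m" unfolding m_def
    by (intro continuous_on_Im continuous_on_compose2[OF holomorphic_on_imp_continuous_on[OF hol_inv]])
       (use \<eta> in \<open>auto simp: Complex_eq intro!: continuous_intros\<close>)
  then have mc: "m \<midarrow>\<theta>\<rightarrow> m \<theta>" using continuous_on_eq_continuous_at[of UNIV m] by (simp add: isCont_def)
  have m0: "m \<theta> > 0" using range_inv[of "Complex \<theta> (\<eta>/2)"] \<eta> by (auto simp: m_def)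
  have "eventually (\<lambda>y. V b y < \<theta>) (at_right 0)" using X_less ab by auto
  moreover have "eventually (\<lambda>y. y < min (m \<theta>) (1/2)) (at_right 0)"
    using m0 by (intro eventually_at_right_0I[of "min (m \<theta>) (1/2)"]) auto
  ultimately have "eventually (\<lambda>y. V b y < \<theta> \<and> y < min (m \<theta>) (1/2) \<and> y > 0) (at_right 0)"
    using eventually_at_right_0_pos by eventually_elim auto
  then obtain y0 where y0: "V b y0 < \<theta>" "y0 < m \<theta>" "y0 < 1/2" "y0 > 0"
    using eventually_at_right_0_ex by fastforce
  have "eventually (\<lambda>W. m W > y0) (at \<theta>)" using mc y0 by (auto intro: order_tendstoD)
  then obtain d where d: "d > 0" "\<And>W. W \<noteq> \<theta> \<Longrightarrow> dist W \<theta> < d \<Longrightarrow> m W > y0"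
    unfolding eventually_at by auto
  \<comment> \<open>Three demands on \<open>\<theta>'\<close>: \<open>m \<theta>' > y0\<close> by
    continuity of \<open>m\<close>, distance at most \<open>\<eta>/2\<close> from
    \<open>\<theta>\<close>, and a level above \<open>V b y0\<close>.\<close>
  obtain \<theta>' where \<theta>': "\<theta>' \<in> C" "\<theta> - min d (min (\<eta>/2) (\<theta> - V b y0)) < \<theta>'" "\<theta>' < \<theta>"
    using lim[of "min d (min (\<eta>/2) (\<theta> - V b y0))"] d \<eta> y0 by auto
  have m': "m \<theta>' > y0" using d(2)[of \<theta>'] \<theta>' by (simp add: dist_real_def)
  have "X \<theta>' < a" using np[OF \<theta>'(3)] ab by simp
  then have "eventually (\<lambda>y. V a y > \<theta>') (at_right 0)" by (rule X_gt)
  moreover have "eventually (\<lambda>y. y < y0) (at_right 0)" using y0 by (intro eventually_at_right_0I[of y0]) auto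
  ultimately have "eventually (\<lambda>y. V a y > \<theta>' \<and> y < y0 \<and> y > 0) (at_right 0)"
    using eventually_at_right_0_pos by eventually_elim auto
  then obtain y1 where y1: "V a y1 > \<theta>'" "y1 < y0" "y1 > 0" using eventually_at_right_0_ex by fastforce
  show False
  proof (rule sw[of y1 y0 "\<lambda>s. Re (\<Lambda> s) - \<theta>'"])
    show "continuous_on HP (\<lambda>s. Re (\<Lambda> s) - \<theta>')" by (intro continuous_intros cont_Re_Lam)
    show "Re (\<Lambda> (Complex x y0)) - \<theta>' < 0" if "x \<in> {a..b}" for x
      using V_le[of y0 x b] y0 \<theta>' that by (simp add: V_def)
    show "0 < Re (\<Lambda> (Complex x y1)) - \<theta>'" if "x \<in> {a..b}" for x
      using V_le[of y1 a x] y1 that by (simp add: V_def)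
    show "cmod (tip_fun \<theta> s) \<le> \<epsilon>" if s: "Im s \<in> {y1..y0}" "Re (\<Lambda> s) - \<theta>' = 0" for s
    proof -
      have sH: "s \<in> HP" using s y1 by auto
      have r: "Re (\<Lambda> s) = \<theta>'" using s by simp
      have "Im (\<Lambda> s) > 0" using range[OF sH] r \<theta>'(1) by simp
      moreover have "Im (\<Lambda> s) \<le> \<eta>/2"
      proof (rule ccontr)
        assume "\<not> Im (\<Lambda> s) \<le> \<eta>/2"
        then have "m \<theta>' < Im (\<Psi> (\<Lambda> s))" unfolding m_def using \<eta> r by (intro mono_Im) auto
        then show False using inv[OF sH] m' s by simp
      qed
      ultimately have "\<bar>Re (\<Lambda> s - of_real \<theta>)\<bar> + \<bar>Im (\<Lambda> s - of_real \<theta>)\<bar> \<le> \<eta>/2 + \<eta>/2"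
        using r \<theta>' by (intro add_mono) auto
      then have "cmod (\<Lambda> s - of_real \<theta> - of_int 0) \<le> \<eta>"
        using cmod_le[of "\<Lambda> s - of_real \<theta>"] by simp
      then show ?thesis using \<eta>(2)[OF sH] by blast
    qed
  qed (use y1 y0 in auto)
qed

text \<open>By \<open>half_disc_constant\<close>, a constant real boundary value on part of a side
  of a slit would be a value of \<open>\<Psi>\<close> in a half disc, against the range
  \<open>HP\<close>. The gap between \<open>\<alpha>\<close> and \<open>\<gamma>\<close> leaves room
  for that half disc.\<close>

lemma side_not_constant:
  assumes \<alpha>: "\<alpha> \<in> C" "\<alpha> < \<gamma>" "{\<alpha><..<\<gamma>} \<inter> C = {}" and t: "t1 < t2" "t2 \<le> 0"
    and lim: "\<And>t. t1 < t \<Longrightarrow> t < t2 \<Longrightarrow>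
      (\<Psi> \<longlongrightarrow> of_real x) (at (Complex \<alpha> t) within cleft C \<inter> {w. Re w > \<alpha>})"
  shows False
proof -
  define \<rho> where "\<rho> = min ((t2 - t1) / 2) (\<gamma> - \<alpha>)"
  have \<rho>: "\<rho> > 0" using \<alpha> t by (simp add: \<rho>_def)
  define c where "c = Complex \<alpha> ((t1 + t2) / 2)"
  define S where "S = ball c \<rho>"
  have re: "(1::complex) \<bullet> z = Re z" for z by (simp add: inner_complex_def)
  have SR: "\<bar>Re z - \<alpha>\<bar> < \<rho>" "\<bar>Im z - (t1 + t2) / 2\<bar> < \<rho>" if "z \<in> S" for z
    using that abs_Re_le_cmod[of "z - c"] abs_Im_le_cmod[of "z - c"]
    by (auto simp: S_def c_def dist_norm norm_minus_commute)
  have SI: "S \<inter> {z. \<alpha> < Re z} \<subseteq> cleft C \<inter> {w. Re w > \<alpha>}"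
  proof
    fix z assume z: "z \<in> S \<inter> {z. \<alpha> < Re z}"
    then have "Re z \<in> {\<alpha><..<\<gamma>}" using SR(1)[of z] by (auto simp: \<rho>_def)
    then show "z \<in> cleft C \<inter> {w. Re w > \<alpha>}" using \<alpha>(3) by auto
  qed
  define z where "z = c + of_real (\<rho>/2)"
  have z: "z \<in> S" "\<alpha> < Re z" using \<rho> by (auto simp: z_def S_def c_def dist_norm)
  have "\<Psi> z = of_real x"
  proof (rule half_disc_constant[of S 1 \<Psi> \<alpha>])
    show "open S" "connected S" by (auto simp: S_def)
    show "\<Psi> holomorphic_on (S \<inter> {z. \<alpha> < 1 \<bullet> z})"
      unfolding re by (rule holomorphic_on_subset[OF hol_inv]) (use SI in auto)
    show "z \<in> S" "\<alpha> < 1 \<bullet> z" using z by (auto simp: re)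
    have "c - of_real (\<rho>/2) \<in> S \<inter> {z. 1 \<bullet> z < \<alpha>}" using \<rho> by (auto simp: S_def c_def dist_norm re)
    then show "S \<inter> {z. 1 \<bullet> z < \<alpha>} \<noteq> {}" by blast
    fix w assume w: "w \<in> S" "1 \<bullet> w = \<alpha>"
    have "t1 < Im w" "Im w < t2" using SR(2)[OF w(1)] by (auto simp: \<rho>_def abs_less_iff field_simps; linarith)+
    then have "(\<Psi> \<longlongrightarrow> of_real x) (at (Complex \<alpha> (Im w)) within cleft C \<inter> {w. Re w > \<alpha>})" by (rule lim)
    moreover have "Complex \<alpha> (Im w) = w" using w by (simp add: re complex_eq_iff)
    ultimately show "(\<Psi> \<longlongrightarrow> of_real x) (at w within S \<inter> {z. \<alpha> < 1 \<bullet> z})"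
      unfolding re using tendsto_within_subset SI by metis
  qed simp
  moreover have "\<Psi> z \<in> HP" using range_inv z SI by blast
  ultimately show False by simp
qed

text \<open>If \<open>X \<alpha> = X \<theta>\<close>, all sequences tending to the right-hand side
  of the slit over \<open>\<alpha>\<close> are squeezed to one boundary point, so
  \<open>\<Psi>\<close> is constant on that side.\<close>

lemma X_strict_right:
  assumes \<alpha>: "\<alpha> \<in> C" "\<alpha> < \<gamma>" "{\<alpha><..<\<gamma>} \<inter> C = {}" and \<theta>: "\<alpha> < \<theta>"
  shows "X \<alpha> < X \<theta>"
proof (rule ccontr)
  assume "\<not> X \<alpha> < X \<theta>"
  then have eq: "X \<theta> = X \<alpha>" using X_mono[of \<alpha> \<theta>] \<theta> by simp
  show False
  proof (rule side_not_constant[OF \<alpha>, of "-2" "-1" "X \<alpha>"])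
    fix t :: real assume t: "-2 < t" "t < -1"
    let ?w = "Complex \<alpha> t"
    have nw: "?w \<notin> cleft C" using t \<alpha> by simp
    show "(\<Psi> \<longlongrightarrow> of_real (X \<alpha>)) (at ?w within cleft C \<inter> {w. Re w > \<alpha>})"
      unfolding tendsto_at_iff_sequentially
    proof (intro allI impI)
      fix u assume u: "\<forall>i. u i \<in> cleft C \<inter> {w. Re w > \<alpha>} - {?w}" "u \<longlonglongrightarrow> ?w"
      have "(\<lambda>n. Re (u n)) \<longlonglongrightarrow> \<alpha>" using tendsto_Re[OF u(2)] by simp
      then have "eventually (\<lambda>n. Re (u n) < \<theta>) sequentially" using \<theta> by (rule order_tendstoD)
      then obtain N where N: "\<And>n. n \<ge> N \<Longrightarrow> Re (u n) < \<theta>" unfolding eventually_sequentially by blast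
      define u' where "u' = (\<lambda>n. u (n + N))"
      have u': "u' n \<in> cleft C" "Re (u' n) > \<alpha>" "Re (u' n) < \<theta>" for n using u(1) N by (auto simp: u'_def)
      have u'l: "u' \<longlonglongrightarrow> ?w" unfolding u'_def using u(2) by (rule LIMSEQ_ignore_initial_segment)
      have "u' n \<noteq> ?w" for n using u'(1)[of n] nw by metis
      then have "\<forall>n. u' n \<in> cleft C - {?w}" using u'(1) by simp
      then have Im0: "(\<lambda>n. Im (\<Psi> (u' n))) \<longlonglongrightarrow> 0"
        using proper[OF nw, unfolded tendsto_at_iff_sequentially o_def, THEN spec, of u'] u'l by simp
      have "(\<lambda>n. \<Psi> (u' n)) \<longlonglongrightarrow> of_real (X \<alpha>)"
      proof (rule X_squeeze[where ?\<theta>1.0 = \<alpha> and ?\<theta>2.0 = \<theta>])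
        show "\<Psi> (u' n) \<in> HP" for n using range_inv u'(1) by blast
        show "\<alpha> \<le> Re (\<Lambda> (\<Psi> (u' n)))" "Re (\<Lambda> (\<Psi> (u' n))) \<le> \<theta>" for n
          unfolding inv_inv[OF u'(1)] using u'(2,3)[of n] by simp_all
      qed (use Im0 eq in auto)
      then show "(\<Psi> \<circ> u) \<longlonglongrightarrow> of_real (X \<alpha>)"
        unfolding u'_def o_def by (rule LIMSEQ_offset)
    qed
  qed auto
qed

end

subsection \<open>Jumps of the end point map\<close>

text \<open>Reflection in the imaginary axis. Conjugating by it preserves holomorphy and the upper
  half-plane and exchanges left and right, so a one-sided statement proved on one side can be
  carried to the other.\<close>

definition mirror_pt :: "complex \<Rightarrow> complex" where
  "mirror_pt z = - cnj z"

lemma mirror_pt_simps [simp]: "Re (mirror_pt z) = - Re z" "Im (mirror_pt z) = Im z" "mirror_pt (mirror_pt z) = z"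
  by (simp_all add: mirror_pt_def)

lemma mirror_pt_Complex [simp]: "mirror_pt (Complex x y) = Complex (- x) y"
  by (simp add: complex_eq_iff)

lemma mirror_pt_of_real [simp]: "mirror_pt (of_real x) = of_real (- x)"
  by (simp add: complex_eq_iff)

lemma norm_mirror_pt: "cmod (mirror_pt z) = cmod z"
  by (simp add: mirror_pt_def)

lemma tendsto_mirror_pt: "(f \<longlongrightarrow> l) F \<Longrightarrow> ((\<lambda>x. mirror_pt (f x)) \<longlongrightarrow> mirror_pt l) F"
  unfolding mirror_pt_def by (intro tendsto_intros)

lemma continuous_on_mirror_pt: "continuous_on S f \<Longrightarrow> continuous_on S (\<lambda>x. mirror_pt (f x))"
  unfolding mirror_pt_def by (intro continuous_intros)

lemma holomorphic_mirror_pt: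
  assumes S: "open S" and f: "f holomorphic_on S"
  shows "(\<lambda>z. mirror_pt (f (mirror_pt z))) holomorphic_on mirror_pt ` S"
proof -
  have "(\<lambda>z. - cnj (f (- cnj z))) field_differentiable (at z)" if "z \<in> mirror_pt ` S" for z
  proof -
    obtain w where w: "w \<in> S" "z = - cnj w" using \<open>z \<in> mirror_pt ` S\<close> by (auto simp: mirror_pt_def)
    then have zw: "- cnj z = w" by simp
    have "(f has_field_derivative deriv f w) (at w)" using holomorphic_derivI[OF f S w(1)] by simp
    then have d: "(f has_field_derivative deriv f w) (at (- cnj z))" using zw by simp
    have "((\<lambda>z. f (- z)) has_field_derivative deriv f w * - 1) (at (cnj z))"
      by (rule DERIV_chain2[where f = f and g = uminus, OF d DERIV_minus[OF DERIV_ident]])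
    then have "((\<lambda>z. f (- z)) has_field_derivative - deriv f w) (at (cnj z))" by simp
    then have "(cnj \<circ> (\<lambda>z. f (- z)) \<circ> cnj has_field_derivative cnj (- deriv f w)) (at z)"
      using has_field_derivative_cnj_cnj[of "\<lambda>z. f (- z)" "- deriv f w" z] by simp
    then have "((\<lambda>z. - (cnj \<circ> (\<lambda>z. f (- z)) \<circ> cnj) z) has_field_derivative - cnj (- deriv f w)) (at z)"
      by (rule DERIV_minus)
    then show ?thesis unfolding field_differentiable_def o_def by blast
  qed
  then show ?thesis unfolding holomorphic_on_def mirror_pt_def
    using field_differentiable_at_within by blast
qed

lemma closed_real_has_Inf_above:
  fixes C :: "real set"
  assumes "closed C" "c \<in> C" "u < c" "u \<notin> C"
  obtains \<beta> where "\<beta> \<in> C" "u < \<beta>" "\<beta> \<le> c" "{u..<\<beta>} \<inter> C = {}"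
proof -
  let ?S = "C \<inter> {u..}"
  define \<beta> where "\<beta> = Inf ?S"
  have ne: "?S \<noteq> {}" using assms by auto
  have bdd: "bdd_below ?S" by auto
  have "\<beta> \<in> ?S" unfolding \<beta>_def
    by (rule closed_contains_Inf[OF ne bdd]) (use assms in auto)
  moreover have "\<beta> \<noteq> u" using calculation assms by auto
  moreover have "\<beta> \<le> c" unfolding \<beta>_def using assms bdd by (intro cInf_lower) auto
  moreover have "x \<notin> C" if "x \<in> {u..<\<beta>}" for x
    using that cInf_lower[OF _ bdd, of x] by (auto simp: \<beta>_def)
  ultimately show thesis using that[of \<beta>] by force
qed

context spike_map
begin

lemma mirror: "spike_map (\<lambda>s. mirror_pt (\<Lambda> (mirror_pt s))) (\<lambda>w. mirror_pt (\<Psi> (mirror_pt w))) (uminus ` C)"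
proof -
  have C': "x \<in> uminus ` C \<longleftrightarrow> - x \<in> C" for x by (auto intro: image_eqI[of _ _ "- x"])
  have m: "mirror_pt w \<in> cleft C \<longleftrightarrow> w \<in> cleft (uminus ` C)" for w by (simp add: C')
  have mH: "mirror_pt s \<in> HP \<longleftrightarrow> s \<in> HP" for s by simp
  have imH: "mirror_pt ` HP = HP" by (auto intro: image_eqI[of _ _ "mirror_pt s" for s])
  have imC: "mirror_pt ` cleft C = cleft (uminus ` C)"
  proof (intro set_eqI iffI)
    fix w assume "w \<in> cleft (uminus ` C)"
    then have "mirror_pt w \<in> cleft C" using m by blast
    then show "w \<in> mirror_pt ` cleft C" by (metis imageI mirror_pt_simps(3))
  qed (use m in auto)
  show ?thesis
  proof
    show "closed (uminus ` C)" using C_closed by (simp add: closed_negations)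
    show "uminus ` C \<noteq> {}" using C_ne by simp
    show "(x + 1 \<in> uminus ` C) = (x \<in> uminus ` C)" for x
      unfolding C' using C_per[of "- x - 1"] by simp
    show "\<exists>x. a < x \<and> x < b \<and> x \<notin> uminus ` C" if ab: "a < b" for a b
    proof -
      obtain x where "- b < x" "x < - a" "x \<notin> C" using C_nd[of "- b" "- a"] ab by auto
      then show ?thesis unfolding C' by (intro exI[of _ "- x"]) auto
    qed
    show "(\<lambda>s. mirror_pt (\<Lambda> (mirror_pt s))) holomorphic_on HP"
      using holomorphic_mirror_pt[OF open_HP hol] unfolding imH .
    show "(\<lambda>w. mirror_pt (\<Psi> (mirror_pt w))) holomorphic_on cleft (uminus ` C)"
      using holomorphic_mirror_pt[OF open_cleft[OF C_closed] hol_inv] unfolding imC .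
    show "mirror_pt (\<Lambda> (mirror_pt (s + 1))) = mirror_pt (\<Lambda> (mirror_pt s)) + 1" if "s \<in> HP" for s
    proof -
      have "mirror_pt s - 1 \<in> HP" using that by simp
      from per[OF this] have "\<Lambda> (mirror_pt s) = \<Lambda> (mirror_pt s - 1) + 1" by simp
      moreover have "mirror_pt (s + 1) = mirror_pt s - 1" by (simp add: mirror_pt_def)
      ultimately show ?thesis by (simp add: mirror_pt_def)
    qed
    show "mirror_pt (\<Lambda> (mirror_pt s)) \<in> cleft (uminus ` C)" if "s \<in> HP" for s
      using range[of "mirror_pt s"] m[of "mirror_pt (\<Lambda> (mirror_pt s))"] that mH by simp
    show "mirror_pt (\<Psi> (mirror_pt (mirror_pt (\<Lambda> (mirror_pt s))))) = s" if "s \<in> HP" for s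
      using inv[of "mirror_pt s"] that by simp
    show "mirror_pt (\<Psi> (mirror_pt w)) \<in> HP" if "w \<in> cleft (uminus ` C)" for w
      using range_inv[of "mirror_pt w"] m[of w] that by simp
    show "mirror_pt (\<Lambda> (mirror_pt (mirror_pt (\<Psi> (mirror_pt w))))) = w" if "w \<in> cleft (uminus ` C)" for w
      using inv_inv[of "mirror_pt w"] m[of w] that by simp
    show "Im (mirror_pt (\<Psi> (mirror_pt w))) < Im (mirror_pt (\<Psi> (mirror_pt (w + \<i> * complex_of_real \<eta>))))"
      if w: "w \<in> cleft (uminus ` C)" and \<eta>: "0 < \<eta>" for w \<eta>
      using mono[of "mirror_pt w" \<eta>] m[of w] w \<eta> by (simp add: mirror_pt_def)
    show "((\<lambda>u. Im (mirror_pt (\<Psi> (mirror_pt u)))) \<longlongrightarrow> 0) (at w within cleft (uminus ` C))"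
      if w: "w \<notin> cleft (uminus ` C)" for w
      unfolding tendsto_at_iff_sequentially
    proof (intro allI impI)
      fix u assume u: "\<forall>i. u i \<in> cleft (uminus ` C) - {w}" "u \<longlonglongrightarrow> w"
      have w': "mirror_pt w \<notin> cleft C" using w m by blast
      have "mirror_pt (u i) \<in> cleft C - {mirror_pt w}" for i
      proof -
        have "u i \<in> cleft (uminus ` C)" "u i \<noteq> w" using u(1) by blast+
        then have "mirror_pt (u i) \<in> cleft C" "mirror_pt (u i) \<noteq> mirror_pt w" using m by (blast, metis mirror_pt_simps(3))
        then show ?thesis by blast
      qed
      then have "\<forall>i. mirror_pt (u i) \<in> cleft C - {mirror_pt w}" by blast
      moreover have "(\<lambda>i. mirror_pt (u i)) \<longlonglongrightarrow> mirror_pt w" using u(2) by (rule tendsto_mirror_pt)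
      ultimately show "((\<lambda>u. Im (mirror_pt (\<Psi> (mirror_pt u)))) \<circ> u) \<longlonglongrightarrow> 0"
        using proper[OF w', unfolded tendsto_at_iff_sequentially o_def, THEN spec, of "\<lambda>i. mirror_pt (u i)"]
        by (simp add: o_def)
    qed
    show "\<exists>B. \<forall>s. \<epsilon> \<le> Im s \<longrightarrow> cmod (mirror_pt (\<Lambda> (mirror_pt s)) - s) \<le> B" if \<epsilon>: "0 < \<epsilon>" for \<epsilon>
    proof -
      obtain B where B: "\<And>s. Im s \<ge> \<epsilon> \<Longrightarrow> cmod (\<Lambda> s - s) \<le> B" using far[OF \<epsilon>] by blast
      have "cmod (mirror_pt (\<Lambda> (mirror_pt s)) - s) \<le> B" if "\<epsilon> \<le> Im s" for s
      proof -
        have "mirror_pt (\<Lambda> (mirror_pt s)) - s = mirror_pt (\<Lambda> (mirror_pt s) - mirror_pt s)" by (simp add: mirror_pt_def)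
        also have "cmod \<dots> = cmod (\<Lambda> (mirror_pt s) - mirror_pt s)" by (rule norm_mirror_pt)
        finally show ?thesis using B[of "mirror_pt s"] that by simp
      qed
      then show ?thesis by blast
    qed
    obtain M where "\<forall>s\<in>HP. Im (\<Lambda> s) \<le> Im s + M" using upper by blast
    then show "\<exists>M. \<forall>s\<in>HP. Im (mirror_pt (\<Lambda> (mirror_pt s))) \<le> Im s + M"
      by (intro exI[of _ M] ballI) (metis mH mirror_pt_simps(2))
  qed
qed

lemma mirror_V: "spike_map.V (\<lambda>s. mirror_pt (\<Lambda> (mirror_pt s))) x y = - V (- x) y"
  unfolding spike_map.V_def[OF mirror] V_def by simp

lemma mirror_X: "spike_map.X (\<lambda>s. mirror_pt (\<Lambda> (mirror_pt s))) \<theta> = - X (- \<theta>)"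
proof (rule spike_map.X_eqI[OF mirror])
  show "eventually (\<lambda>y. spike_map.V (\<lambda>s. mirror_pt (\<Lambda> (mirror_pt s))) a y \<le> \<theta>) (at_right 0)" if "a < - X (- \<theta>)" for a
  proof -
    have "X (- \<theta>) < - a" using that by simp
    from X_gt[OF this] show ?thesis by eventually_elim (simp add: mirror_V)
  qed
  show "eventually (\<lambda>y. spike_map.V (\<lambda>s. mirror_pt (\<Lambda> (mirror_pt s))) a y \<ge> \<theta>) (at_right 0)" if "- X (- \<theta>) < a" for a
  proof -
    have "- a < X (- \<theta>)" using that by simp
    from X_less[OF this] show ?thesis by eventually_elim (simp add: mirror_V)
  qed
qed

lemma neg_C: "x \<in> uminus ` C \<longleftrightarrow> - x \<in> C" by (auto intro: image_eqI[of _ _ "- x"])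

lemma X_right_limit:
  assumes \<theta>: "\<theta> \<in> C" and lim: "\<And>\<delta>. \<delta> > 0 \<Longrightarrow> \<exists>\<theta>'\<in>C. \<theta> < \<theta>' \<and> \<theta>' < \<theta> + \<delta>" and p: "X \<theta> < p"
  shows "\<exists>\<theta>'>\<theta>. X \<theta>' < p"
proof -
  have "\<exists>\<theta>'. \<theta>' < - \<theta> \<and> - p < spike_map.X (\<lambda>s. mirror_pt (\<Lambda> (mirror_pt s))) \<theta>'"
  proof (rule spike_map.X_left_limit[OF mirror])
    show "- \<theta> \<in> uminus ` C" using \<theta> by simp
    show "- p < spike_map.X (\<lambda>s. mirror_pt (\<Lambda> (mirror_pt s))) (- \<theta>)" using p by (simp add: mirror_X)
    show "\<exists>\<theta>'\<in>uminus ` C. - \<theta> - \<delta> < \<theta>' \<and> \<theta>' < - \<theta>" if "0 < \<delta>" for \<delta>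
    proof -
      obtain \<theta>' where "\<theta>' \<in> C" "\<theta> < \<theta>'" "\<theta>' < \<theta> + \<delta>" using lim[OF \<open>0 < \<delta>\<close>] by blast
      then show ?thesis by (intro bexI[of _ "- \<theta>'"]) auto
    qed
  qed
  then obtain \<theta>' where "\<theta>' < - \<theta>" "X (- \<theta>') < p" unfolding mirror_X by auto
  then show ?thesis by (intro exI[of _ "- \<theta>'"]) auto
qed

lemma X_strict_left:
  assumes \<beta>: "\<beta> \<in> C" "\<gamma> < \<beta>" "{\<gamma><..<\<beta>} \<inter> C = {}" and \<theta>: "\<theta> < \<beta>"
  shows "X \<theta> < X \<beta>"
proof -
  have "spike_map.X (\<lambda>s. mirror_pt (\<Lambda> (mirror_pt s))) (- \<beta>) < spike_map.X (\<lambda>s. mirror_pt (\<Lambda> (mirror_pt s))) (- \<theta>)"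
  proof (rule spike_map.X_strict_right[OF mirror, of _ "- \<gamma>"])
    show "{- \<beta><..<- \<gamma>} \<inter> uminus ` C = {}"
    proof (rule equals0I)
      fix x assume "x \<in> {- \<beta><..<- \<gamma>} \<inter> uminus ` C"
      then have "- x \<in> {\<gamma><..<\<beta>} \<inter> C" by auto
      then show False using \<beta>(3) by blast
    qed
  qed (use \<beta> \<theta> in auto)
  then show ?thesis by (simp add: mirror_X)
qed

text \<open>Converse of \<open>X_gap\<close>: since \<open>C\<close> has no interior, a point of
  \<open>C\<close> inside the interval yields the right end \<open>\<beta>\<close> of a gap inside
  it, and \<open>X\<close> increases strictly there.\<close>

lemma X_const_gap:
  assumes X: "\<And>\<theta>. \<theta>1 < \<theta> \<Longrightarrow> \<theta> < \<theta>2 \<Longrightarrow> X \<theta> = x"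
  shows "{\<theta>1<..<\<theta>2} \<inter> C = {}"
proof (rule equals0I)
  fix c assume "c \<in> {\<theta>1<..<\<theta>2} \<inter> C"
  then have c: "\<theta>1 < c" "c < \<theta>2" "c \<in> C" by auto
  obtain u where u: "\<theta>1 < u" "u < c" "u \<notin> C" using C_nd[OF c(1)] by blast
  obtain \<beta> where \<beta>: "\<beta> \<in> C" "u < \<beta>" "\<beta> \<le> c" "{u..<\<beta>} \<inter> C = {}"
    using closed_real_has_Inf_above[OF C_closed c(3) u(2,3)] by blast
  have "{u<..<\<beta>} \<subseteq> {u..<\<beta>}" by auto
  then have "{u<..<\<beta>} \<inter> C = {}" using \<beta>(4) by blast
  then have "X u < X \<beta>" using X_strict_left[of \<beta> u] \<beta> by blast
  then show False using X[of u] X[of \<beta>] u \<beta> c by simp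
qed

section \<open>Boundary values of the Riemann map and its inverse next to a slit\<close>

lemma Lam_boundary_notin:
  assumes "(\<Lambda> \<longlongrightarrow> l) (at (of_real x) within HP)" shows "l \<notin> cleft C"
proof
  assume l: "l \<in> cleft C"
  have "((\<lambda>s. \<Psi> (\<Lambda> s)) \<longlongrightarrow> \<Psi> l) (at (of_real x) within HP)"
    by (rule isCont_tendsto_compose[OF isCont_Psi[OF l] assms])
  moreover have "((\<lambda>s. \<Psi> (\<Lambda> s)) \<longlongrightarrow> of_real x) (at (of_real x) within HP)"
    by (rule Lim_transform_eventually[OF tendsto_ident_at])
       (auto simp: eventually_at_filter inv)
  ultimately have "\<Psi> l = of_real x" using tendsto_unique[OF HP_limit_nontrivial] by blast
  then show False using range_inv[OF l] by simp
qed

text \<open>Between the two sides of a jump the angle exceeds \<open>\<alpha>\<close> and tends to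
  \<open>\<alpha>\<close> at the boundary. Hence \<open>\<i> * (\<Lambda> - \<alpha>)\<close> has
  positive imaginary part with boundary value 0, and \<open>half_disc_boundary_limit\<close>
  applies.\<close>

lemma jump_limit:
  assumes p: "X \<alpha> \<le> p" and q: "\<And>\<theta>. \<alpha> < \<theta> \<Longrightarrow> q \<le> X \<theta>" and x: "p < x" "x < q"
  obtains t where "(\<Lambda> \<longlongrightarrow> Complex \<alpha> t) (at (of_real x) within HP)"
    "eventually (\<lambda>s. Re (\<Lambda> s) > \<alpha>) (at (of_real x) within HP)"
proof -
  define a where "a = (p + x) / 2"
  have a: "p < a" "a < x" using x by (auto simp: a_def)
  obtain y0 where y0: "y0 > 0" "\<And>y. 0 < y \<Longrightarrow> y < y0 \<Longrightarrow> V a y > \<alpha>"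
    using X_gt[of \<alpha> a] p a unfolding eventually_at_right_field by auto
  \<comment> \<open>Keeps the half disc below \<open>y0\<close> and to the right of
    \<open>a\<close>, where the angle exceeds \<open>\<alpha>\<close>, and to the left of
    \<open>q\<close>, where \<open>X_less\<close> eventually bounds the angle by
    \<open>\<alpha> + e\<close>.\<close>
  define \<rho> where "\<rho> = min y0 (min (x - a) (q - x))"
  have \<rho>: "\<rho> > 0" using y0 a x by (simp add: \<rho>_def)
  define g where "g = (\<lambda>u. \<i> * (\<Lambda> (of_real x + u) - of_real \<alpha>))"
  have gi: "Im (g u) = Re (\<Lambda> (of_real x + u)) - \<alpha>" for u by (simp add: g_def)
  have pos: "Re (\<Lambda> s) > \<alpha>" if s: "s \<in> HP" "cmod (s - of_real x) < \<rho>" for s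
  proof -
    have "\<bar>Re (s - of_real x)\<bar> < \<rho>" "\<bar>Im (s - of_real x)\<bar> < \<rho>"
      using abs_Re_le_cmod abs_Im_le_cmod s(2) order_le_less_trans by blast+
    then have "a \<le> Re s" "Im s < y0" "0 < Im s" using s by (auto simp: \<rho>_def abs_less_iff)
    then show ?thesis using y0(2)[of "Im s"] V_le[of "Im s" a "Re s"] by (simp add: V_def)
  qed
  have lim: "((\<lambda>z. Im (g z)) \<longlongrightarrow> 0) (at (of_real v) within ball 0 \<rho> \<inter> HP)"
    if v: "\<bar>v\<bar> < \<rho>" for v :: real
  proof (rule tendstoI)
    fix e :: real assume e: "e > 0"
    define b where "b = (x + v + q) / 2"
    have b: "x + v < b" "b < q" using v by (auto simp: b_def \<rho>_def)
    have "b < X (\<alpha> + e)" using q[of "\<alpha> + e"] e b by simp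
    then obtain y1 where y1: "y1 > 0" "\<And>y. 0 < y \<Longrightarrow> y < y1 \<Longrightarrow> V b y < \<alpha> + e"
      using X_less unfolding eventually_at_right_field by blast
    define d where "d = min y1 (b - (x + v))"
    have d: "d > 0" using y1 b by (simp add: d_def)
    have "dist (Im (g z)) 0 < e" if z: "z \<in> ball 0 \<rho> \<inter> HP" "dist z (of_real v) < d" for z
    proof -
      have "\<bar>Re (z - of_real v)\<bar> < d" "\<bar>Im (z - of_real v)\<bar> < d"
        using abs_Re_le_cmod abs_Im_le_cmod z(2) order_le_less_trans unfolding dist_norm by blast+
      then have *: "x + Re z \<le> b" "Im z < y1" "0 < Im z" using z by (auto simp: d_def abs_less_iff)
      have "Re (\<Lambda> (of_real x + z)) = V (x + Re z) (Im z)"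
        unfolding V_def by (rule arg_cong[where f = "\<lambda>s. Re (\<Lambda> s)"]) (simp add: complex_eq_iff)
      also have "\<dots> \<le> V b (Im z)" using * by (intro V_le) auto
      also have "\<dots> < \<alpha> + e" using y1 * by auto
      finally have "Im (g z) < e" by (simp add: gi)
      moreover have "Im (g z) > 0" unfolding gi using pos[of "of_real x + z"] z by simp
      ultimately show ?thesis by simp
    qed
    then show "eventually (\<lambda>z. dist (Im (g z)) 0 < e) (at (of_real v) within ball 0 \<rho> \<inter> HP)"
      unfolding eventually_at using d by blast
  qed
  obtain l where l: "(g \<longlongrightarrow> l) (at 0 within ball 0 \<rho> \<inter> HP)"
  proof (rule half_disc_boundary_limit[OF \<rho>])
    show "g holomorphic_on ball 0 \<rho> \<inter> HP" unfolding g_def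
      by (intro holomorphic_intros holomorphic_on_compose_gen[OF _ hol, unfolded o_def]) auto
    show "Im (g z) > 0" if "z \<in> ball 0 \<rho> \<inter> HP" for z
      unfolding gi using pos[of "of_real x + z"] that by simp
  qed (rule lim)
  define L where "L = of_real \<alpha> - \<i> * l"
  have "(\<Lambda> \<longlongrightarrow> L) (at (of_real x) within HP)"
    unfolding tendsto_at_iff_sequentially
  proof (intro allI impI)
    fix s assume s: "\<forall>i. s i \<in> HP - {of_real x}" "s \<longlonglongrightarrow> of_real x"
    have z0: "(\<lambda>i. s i - of_real x) \<longlonglongrightarrow> 0" using s(2) by (simp add: LIM_zero)
    have "eventually (\<lambda>i. cmod (s i - of_real x) < \<rho>) sequentially"
      using tendstoD[OF z0 \<rho>] by simp
    then obtain N where N: "\<And>i. i \<ge> N \<Longrightarrow> cmod (s i - of_real x) < \<rho>"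
      unfolding eventually_sequentially by blast
    have "\<forall>i. s (i + N) - of_real x \<in> ball 0 \<rho> \<inter> HP - {0}" using s(1) N by auto
    moreover have "(\<lambda>i. s (i + N) - of_real x) \<longlonglongrightarrow> 0"
      using z0 by (rule LIMSEQ_ignore_initial_segment)
    ultimately have "(\<lambda>i. g (s (i + N) - of_real x)) \<longlonglongrightarrow> l"
      using l[unfolded tendsto_at_iff_sequentially o_def, THEN spec, of "\<lambda>i. s (i + N) - of_real x"] by simp
    then have "(\<lambda>i. of_real \<alpha> - \<i> * g (s (i + N) - of_real x)) \<longlonglongrightarrow> L"
      unfolding L_def by (intro tendsto_intros)
    moreover have "of_real \<alpha> - \<i> * g (s (i + N) - of_real x) = \<Lambda> (s (i + N))" for i
      by (simp add: g_def algebra_simps flip: mult.assoc)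
    ultimately have "(\<lambda>i. \<Lambda> (s (i + N))) \<longlonglongrightarrow> L" by simp
    then show "(\<Lambda> \<circ> s) \<longlonglongrightarrow> L" unfolding o_def by (rule LIMSEQ_offset)
  qed
  moreover have "Re L = \<alpha>"
  proof -
    have "at 0 within ball 0 \<rho> \<inter> HP = at 0 within HP"
      by (rule at_within_nhd[of _ "ball 0 \<rho>"]) (use \<rho> in auto)
    then have nt: "at 0 within ball 0 \<rho> \<inter> HP \<noteq> bot" using HP_limit_nontrivial[of 0] by simp
    have "((\<lambda>z. Im (g z)) \<longlongrightarrow> 0) (at 0 within ball 0 \<rho> \<inter> HP)" using lim[of 0] \<rho> by simp
    moreover have "((\<lambda>z. Im (g z)) \<longlongrightarrow> Im l) (at 0 within ball 0 \<rho> \<inter> HP)" using l by (rule tendsto_Im)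
    ultimately have "Im l = 0" using tendsto_unique[OF nt] by blast
    then show ?thesis by (simp add: L_def)
  qed
  moreover have "eventually (\<lambda>s. Re (\<Lambda> s) > \<alpha>) (at (of_real x) within HP)"
    using \<rho> pos unfolding eventually_at dist_norm by blast
  ultimately show thesis using that[of "Im L"] by (metis complex.collapse)
qed

text \<open>The substitution \<open>w = c - \<i> * u\<close> turns the upper half disc at 0 into a
  half disc to the right of the slit; by \<open>proper\<close>, the imaginary part of
  \<open>\<Psi>\<close> tends to 0 at the slit.\<close>

lemma side_limit:
  assumes \<alpha>: "\<alpha> \<in> C" "\<alpha> < \<gamma>" "{\<alpha><..<\<gamma>} \<inter> C = {}" and v: "v < 0"
  obtains l where "(\<Psi> \<longlongrightarrow> l) (at (Complex \<alpha> v) within cleft C \<inter> {w. Re w > \<alpha>})"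
proof -
  define c where "c = Complex \<alpha> v"
  define \<rho> where "\<rho> = min (\<gamma> - \<alpha>) (- v)"
  have \<rho>: "\<rho> > 0" using \<alpha> v by (simp add: \<rho>_def)
  define g where "g = (\<lambda>u. \<Psi> (c - \<i> * u))"
  have dom: "c - \<i> * u \<in> cleft C \<inter> {w. Re w > \<alpha>}" if "u \<in> ball 0 \<rho> \<inter> HP" for u
  proof -
    have "Im u < \<rho>" "Im u > 0" using that abs_Im_le_cmod[of u] by auto
    then have "Re (c - \<i> * u) \<in> {\<alpha><..<\<gamma>}" by (simp add: c_def \<rho>_def)
    then show ?thesis using \<alpha>(3) by auto
  qed
  obtain l where l: "(g \<longlongrightarrow> l) (at 0 within ball 0 \<rho> \<inter> HP)"
  proof (rule half_disc_boundary_limit[OF \<rho>])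
    show "g holomorphic_on ball 0 \<rho> \<inter> HP" unfolding g_def
      by (intro holomorphic_on_compose_gen[OF _ hol_inv, unfolded o_def] holomorphic_intros) (use dom in blast)
    show "Im (g z) > 0" if "z \<in> ball 0 \<rho> \<inter> HP" for z
      unfolding g_def using range_inv dom[OF that] by blast
    fix x :: real assume x: "\<bar>x\<bar> < \<rho>"
    let ?w = "c - \<i> * of_real x"
    have nw: "?w \<notin> cleft C" using x \<alpha>(1) by (auto simp: c_def \<rho>_def)
    show "((\<lambda>z. Im (g z)) \<longlongrightarrow> 0) (at (of_real x) within ball 0 \<rho> \<inter> HP)"
      unfolding tendsto_at_iff_sequentially
    proof (intro allI impI)
      fix u assume u: "\<forall>i. u i \<in> ball 0 \<rho> \<inter> HP - {of_real x}" "u \<longlonglongrightarrow> of_real x"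
      have d: "c - \<i> * u i \<in> cleft C" for i using dom[of "u i"] u(1) by blast
      have "c - \<i> * u i \<noteq> ?w" for i using d[of i] nw by metis
      then have "\<forall>i. c - \<i> * u i \<in> cleft C - {?w}" using d by simp
      moreover have "(\<lambda>i. c - \<i> * u i) \<longlonglongrightarrow> ?w" using u(2) by (intro tendsto_intros)
      ultimately show "((\<lambda>z. Im (g z)) \<circ> u) \<longlonglongrightarrow> 0"
        using proper[OF nw, unfolded tendsto_at_iff_sequentially o_def, THEN spec, of "\<lambda>i. c - \<i> * u i"]
        by (simp add: o_def g_def)
    qed
  qed blast
  have "(\<Psi> \<longlongrightarrow> l) (at c within cleft C \<inter> {w. Re w > \<alpha>})"
    unfolding tendsto_at_iff_sequentially
  proof (intro allI impI)
    fix s assume s: "\<forall>i. s i \<in> cleft C \<inter> {w. Re w > \<alpha>} - {c}" "s \<longlonglongrightarrow> c"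
    have z0: "(\<lambda>i. \<i> * (s i - c)) \<longlonglongrightarrow> \<i> * (c - c)" using s(2) by (intro tendsto_intros)
    then have z0: "(\<lambda>i. \<i> * (s i - c)) \<longlonglongrightarrow> 0" by simp
    have "eventually (\<lambda>i. cmod (\<i> * (s i - c)) < \<rho>) sequentially"
      using tendstoD[OF z0 \<rho>] by simp
    then obtain N where N: "\<And>i. i \<ge> N \<Longrightarrow> cmod (\<i> * (s i - c)) < \<rho>"
      unfolding eventually_sequentially by blast
    have "\<forall>i. \<i> * (s (i + N) - c) \<in> ball 0 \<rho> \<inter> HP - {0}" using s(1) N by (auto simp: c_def)
    moreover have "(\<lambda>i. \<i> * (s (i + N) - c)) \<longlonglongrightarrow> 0"
      using z0 by (rule LIMSEQ_ignore_initial_segment)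
    ultimately have "(\<lambda>i. g (\<i> * (s (i + N) - c))) \<longlonglongrightarrow> l"
      using l[unfolded tendsto_at_iff_sequentially o_def, THEN spec, of "\<lambda>i. \<i> * (s (i + N) - c)"] by simp
    moreover have "g (\<i> * (s (i + N) - c)) = \<Psi> (s (i + N))" for i
      by (simp add: g_def algebra_simps flip: mult.assoc)
    ultimately have "(\<lambda>i. \<Psi> (s (i + N))) \<longlonglongrightarrow> l" by simp
    then show "(\<Psi> \<circ> s) \<longlonglongrightarrow> l" unfolding o_def by (rule LIMSEQ_offset)
  qed
  then show thesis using that by (simp add: c_def)
qed

text \<open>A constant boundary value on an interval would make \<open>\<Lambda>\<close> constant on
  a half disc, against its injectivity.\<close>

lemma Lam_boundary_not_constant:
  assumes t: "x1 < x2"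
    and lim: "\<And>x. x1 < x \<Longrightarrow> x < x2 \<Longrightarrow> (\<Lambda> \<longlongrightarrow> l) (at (of_real x) within HP)"
  shows False
proof -
  define \<rho> where "\<rho> = (x2 - x1) / 2"
  define c :: complex where "c = of_real ((x1 + x2) / 2)"
  define S where "S = ball c \<rho>"
  have \<rho>: "\<rho> > 0" using t by (simp add: \<rho>_def)
  have im: "\<i> \<bullet> z = Im z" for z by (simp add: inner_complex_def)
  have const: "\<Lambda> z = l" if z: "z \<in> S" "0 < Im z" for z
  proof (rule half_disc_constant[of S \<i> \<Lambda> 0])
    show "open S" "connected S" by (auto simp: S_def)
    show "\<Lambda> holomorphic_on (S \<inter> {z. 0 < \<i> \<bullet> z})"
      unfolding im by (rule holomorphic_on_subset[OF hol]) auto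
    show "z \<in> S" "0 < \<i> \<bullet> z" using z by (auto simp: im)
    have "c - \<i> * of_real (\<rho>/2) \<in> S \<inter> {z. \<i> \<bullet> z < 0}"
      using \<rho> by (auto simp: S_def c_def dist_norm im norm_mult)
    then show "S \<inter> {z. \<i> \<bullet> z < 0} \<noteq> {}" by blast
    fix w assume w: "w \<in> S" "\<i> \<bullet> w = 0"
    then have wr: "w = of_real (Re w)" by (simp add: im complex_eq_iff)
    have "\<bar>Re w - (x1 + x2) / 2\<bar> < \<rho>"
      using w abs_Re_le_cmod[of "w - c"] by (auto simp: S_def c_def dist_norm norm_minus_commute)
    then have "x1 < Re w" "Re w < x2" by (auto simp: \<rho>_def abs_less_iff field_simps)
    then have "(\<Lambda> \<longlongrightarrow> l) (at w within HP)" using lim wr by metis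
    then show "(\<Lambda> \<longlongrightarrow> l) (at w within S \<inter> {z. 0 < \<i> \<bullet> z})"
      unfolding im by (rule tendsto_within_subset) auto
  qed simp
  define z1 z2 where "z1 = c + \<i> * of_real (\<rho>/2)" and "z2 = c + \<i> * of_real (\<rho>/3)"
  have "z1 \<in> S" "z2 \<in> S" "z1 \<in> HP" "z2 \<in> HP"
    using \<rho> by (auto simp: z1_def z2_def S_def c_def dist_norm norm_mult)
  then have "z1 = z2" using const inv by (metis mem_Collect_eq)
  then show False using \<rho> by (simp add: z1_def z2_def)
qed

end

section \<open>Continuity of functions extended by their boundary limits\<close>

lemma boundary_limit_near:
  fixes f :: "complex \<Rightarrow> complex"
  assumes l: "\<And>x. x \<in> I \<Longrightarrow> (f \<longlongrightarrow> l x) (at (of_real x) within HP)" and x: "x \<in> I" and e: "e > 0"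
  obtains d where "d > 0" "\<And>s. s \<in> HP \<Longrightarrow> dist s (of_real x) < d \<Longrightarrow> dist (f s) (l x) < e"
    "\<And>x'. x' \<in> I \<Longrightarrow> dist x' x < d \<Longrightarrow> dist (l x') (l x) < e"
proof -
  have "eventually (\<lambda>s. dist (f s) (l x) < e/2) (at (of_real x) within HP)"
    using tendstoD[OF l[OF x], of "e/2"] e by simp
  then obtain d where d: "d > 0" "\<And>s. s \<in> HP \<Longrightarrow> s \<noteq> of_real x \<Longrightarrow> dist s (of_real x) < d \<Longrightarrow> dist (f s) (l x) < e/2"
    unfolding eventually_at by blast
  have d2: "dist (f s) (l x) < e/2" if "s \<in> HP" "dist s (of_real x) < d" for s
    by (rule d(2)) (use that in auto)
  show thesis
  proof (rule that[OF d(1)])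
    show "dist (f s) (l x) < e" if "s \<in> HP" "dist s (of_real x) < d" for s
      using d2[OF that] e by simp
    fix x' assume x': "x' \<in> I" "dist x' x < d"
    have "eventually (\<lambda>s. s \<in> ball (complex_of_real x) d) (nhds (of_real x'))"
      using x' by (intro eventually_nhds_in_open) (auto simp: dist_commute)
    then have "eventually (\<lambda>s. dist (f s) (l x) \<le> e/2) (at (of_real x') within HP)"
      unfolding eventually_at_filter
      by eventually_elim (use d2 in \<open>auto simp: dist_commute less_imp_le\<close>)
    moreover have "((\<lambda>s. dist (f s) (l x)) \<longlongrightarrow> dist (l x') (l x)) (at (of_real x') within HP)"
      by (intro tendsto_intros l x')
    ultimately have "dist (l x') (l x) \<le> e/2"
      using tendsto_upperbound HP_limit_nontrivial by blast
    then show "dist (l x') (l x) < e" using e by simp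
  qed
qed

lemma continuous_on_boundary_limit:
  fixes f :: "complex \<Rightarrow> complex"
  assumes "\<And>x. x \<in> I \<Longrightarrow> (f \<longlongrightarrow> l x) (at (of_real x) within HP)"
  shows "continuous_on I l"
  unfolding continuous_on_iff
proof (intro ballI allI impI)
  fix x and e :: real assume xe: "x \<in> I" "e > 0"
  obtain d where "d > 0" "\<And>s. s \<in> HP \<Longrightarrow> dist s (of_real x) < d \<Longrightarrow> dist (f s) (l x) < e"
    "\<And>x'. x' \<in> I \<Longrightarrow> dist x' x < d \<Longrightarrow> dist (l x') (l x) < e"
  proof (rule boundary_limit_near[of I f l x e, OF assms xe])
  qed (assumption, rule that)
  then show "\<exists>d>0. \<forall>x'\<in>I. dist x' x < d \<longrightarrow> dist (l x') (l x) < e" by blast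
qed

lemma continuous_on_extend_boundary:
  fixes f :: "complex \<Rightarrow> complex"
  assumes f: "continuous_on HP f" and l: "\<And>x. (f \<longlongrightarrow> l x) (at (of_real x) within HP)"
  shows "continuous_on {s. Im s \<ge> 0} (\<lambda>s. if Im s > 0 then f s else l (Re s))"
  unfolding continuous_on_def
proof
  fix s :: complex assume s: "s \<in> {s. Im s \<ge> 0}"
  let ?E = "\<lambda>s. if Im s > 0 then f s else l (Re s)"
  show "(?E \<longlongrightarrow> ?E s) (at s within {s. Im s \<ge> 0})"
  proof (cases "Im s > 0")
    case True
    have "isCont f s" using f True open_HP by (simp add: continuous_on_eq_continuous_at)
    then have "(f \<longlongrightarrow> f s) (at s within {s. Im s \<ge> 0})"
      unfolding isCont_def by (rule tendsto_within_subset) simp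
    moreover have "eventually (\<lambda>w. w \<in> HP) (nhds s)"
      using True by (intro eventually_nhds_in_open open_HP) auto
    then have "eventually (\<lambda>w. f w = ?E w) (at s within {s. Im s \<ge> 0})"
      unfolding eventually_at_filter by eventually_elim auto
    ultimately show ?thesis using True Lim_transform_eventually by force
  next
    case False
    then have s0: "s = of_real (Re s)" using s by (simp add: complex_eq_iff)
    have "(?E \<longlongrightarrow> l (Re s)) (at s within {s. Im s \<ge> 0})"
    proof (rule tendstoI)
      fix e :: real assume e: "e > 0"
      obtain d where d: "d > 0" "\<And>u. u \<in> HP \<Longrightarrow> dist u (of_real (Re s)) < d \<Longrightarrow> dist (f u) (l (Re s)) < e"
        "\<And>x'. x' \<in> UNIV \<Longrightarrow> dist x' (Re s) < d \<Longrightarrow> dist (l x') (l (Re s)) < e"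
      proof (rule boundary_limit_near[of UNIV f l "Re s" e, OF l UNIV_I e])
      qed (rule that)
      have "dist (?E u) (l (Re s)) < e" if u: "dist u s < d" for u
      proof (cases "Im u > 0")
        case True
        then show ?thesis using d(2)[of u] u s0 by simp
      next
        case False
        have "dist (Re u) (Re s) < d" using u abs_Re_le_cmod[of "u - s"] by (simp add: dist_norm)
        then show ?thesis using d(3)[of "Re u"] False by simp
      qed
      then show "eventually (\<lambda>u. dist (?E u) (l (Re s)) < e) (at s within {s. Im s \<ge> 0})"
        unfolding eventually_at using d(1) by blast
    qed
    then show ?thesis using False by simp
  qed
qed

lemma real_IVT_between:
  fixes f :: "real \<Rightarrow> real"
  assumes c: "continuous_on S f" "connected S" and ab: "a \<in> S" "b \<in> S" and t: "f a \<le> t" "t \<le> f b"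
  obtains x where "x \<in> S" "f x = t"
proof -
  have "connected (f ` S)" using c by (rule connected_continuous_image)
  then have "t \<in> f ` S" using ab t connected_contains_Icc[of "f ` S" "f a" "f b"] by auto
  then show thesis using that by blast
qed

subsection \<open>Boundary extension of the conjugate map\<close>

text \<open>The hypotheses are stable under passing to the inverse (\<open>swap\<close>) and under
  reflection (\<open>mirror_ext\<close>), which yields boundary values of the inverse and left-hand
  versions without further work. The bounds \<open>Im_k\<close> and \<open>Im_k'\<close> say that
  points away from the centre of the disc stay away from it.\<close>

locale spike_ext = spike_map +
  fixes F F' :: "real \<Rightarrow> real" and k k' :: "complex \<Rightarrow> complex"
  assumes cont_k: "continuous_on UNIV k" and cont_k': "continuous_on UNIV k'"
    and k'k [simp]: "k' (k w) = w" and kk' [simp]: "k (k' w) = w"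
    and Re_k [simp]: "Re (k w) = F (Re w)" and Re_k' [simp]: "Re (k' w) = F' (Re w)"
    and k_cleft: "k w \<in> cleft C \<longleftrightarrow> w \<in> cleft C"
    and k_per: "k (w + 1) = k w + 1"
    and F_mono: "strict_mono F" and F'_mono: "strict_mono F'"
    and F_C: "F \<theta> \<in> C \<longleftrightarrow> \<theta> \<in> C"
    and Im_k: "\<exists>B'. \<forall>w. Im w \<le> B \<longrightarrow> Im (k w) \<le> B'"
    and Im_k': "\<exists>B'. \<forall>w. Im w \<le> B \<longrightarrow> Im (k' w) \<le> B'"
begin

lemma F'F [simp]: "F' (F \<theta>) = \<theta>" and FF' [simp]: "F (F' \<theta>) = \<theta>"
  using Re_k'[of "k (of_real \<theta>)"] Re_k[of "k' (of_real \<theta>)"] by (simp_all del: Re_k Re_k' add: Re_k[of "of_real \<theta>"] Re_k'[of "of_real \<theta>"])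

lemma isCont_k: "isCont k w" and isCont_k': "isCont k' w"
  using cont_k cont_k' by (simp_all add: continuous_on_eq_continuous_at)

lemma isCont_F: "isCont F \<theta>"
proof -
  have "continuous_on UNIV (\<lambda>\<theta>. Re (k (of_real \<theta>)))"
    by (intro continuous_on_Re continuous_on_compose2[OF cont_k] continuous_intros) auto
  then show ?thesis by (simp add: continuous_on_eq_continuous_at)
qed

lemma swap: "spike_ext \<Lambda> \<Psi> C F' F k' k"
proof unfold_locales
  show "k' w \<in> cleft C \<longleftrightarrow> w \<in> cleft C" for w using k_cleft[of "k' w"] by simp
  show "k' (w + 1) = k' w + 1" for w
    using k_per[of "k' w"] by (metis k'k kk')
  show "F' \<theta> \<in> C \<longleftrightarrow> \<theta> \<in> C" for \<theta> using F_C[of "F' \<theta>"] by simp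
qed (use cont_k cont_k' F_mono F'_mono Im_k Im_k' in auto)

lemma mirror_ext: "spike_ext (\<lambda>s. mirror_pt (\<Lambda> (mirror_pt s))) (\<lambda>w. mirror_pt (\<Psi> (mirror_pt w))) (uminus ` C)
   (\<lambda>\<theta>. - F (- \<theta>)) (\<lambda>\<theta>. - F' (- \<theta>)) (\<lambda>w. mirror_pt (k (mirror_pt w))) (\<lambda>w. mirror_pt (k' (mirror_pt w)))"
proof (intro spike_ext.intro mirror spike_ext_axioms.intro)
  have mc: "continuous_on UNIV mirror_pt" unfolding mirror_pt_def by (intro continuous_intros)
  show "continuous_on UNIV (\<lambda>w. mirror_pt (k (mirror_pt w)))" "continuous_on UNIV (\<lambda>w. mirror_pt (k' (mirror_pt w)))"
    by (intro continuous_on_mirror_pt continuous_on_compose2[OF cont_k mc] continuous_on_compose2[OF cont_k' mc]; simp)+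
  show "mirror_pt (k (mirror_pt w)) \<in> cleft (uminus ` C) \<longleftrightarrow> w \<in> cleft (uminus ` C)" for w
    using k_cleft[of "mirror_pt w"] by (simp add: neg_C)
  show "mirror_pt (k (mirror_pt (w + 1))) = mirror_pt (k (mirror_pt w)) + 1" for w
  proof -
    have "mirror_pt (w + 1) + 1 = mirror_pt w" by (simp add: mirror_pt_def)
    then have "k (mirror_pt w) = k (mirror_pt (w + 1)) + 1" by (metis k_per)
    then show ?thesis by (simp add: mirror_pt_def)
  qed
  show "strict_mono (\<lambda>\<theta>. - F (- \<theta>))" "strict_mono (\<lambda>\<theta>. - F' (- \<theta>))"
    using F_mono F'_mono by (auto simp: strict_mono_def)
  show "\<exists>B'. \<forall>w. Im w \<le> B \<longrightarrow> Im (mirror_pt (k (mirror_pt w))) \<le> B'" for B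
    using Im_k[of B] by simp (metis mirror_pt_simps(2))
  show "\<exists>B'. \<forall>w. Im w \<le> B \<longrightarrow> Im (mirror_pt (k' (mirror_pt w))) \<le> B'" for B
    using Im_k'[of B] by simp (metis mirror_pt_simps(2))
qed (auto simp: neg_C F_C)

section \<open>The conjugate map on the half-plane\<close>

definition G :: "complex \<Rightarrow> complex" where
  "G s = \<Psi> (k (\<Lambda> s))"

lemma G_HP: "s \<in> HP \<Longrightarrow> G s \<in> HP"
  unfolding G_def using range_inv k_cleft range by blast

lemma Lam_G: "s \<in> HP \<Longrightarrow> \<Lambda> (G s) = k (\<Lambda> s)"
  unfolding G_def using inv_inv k_cleft range by blast

lemma G_swap: "s \<in> HP \<Longrightarrow> spike_ext.G \<Lambda> \<Psi> k' (G s) = s"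
  unfolding spike_ext.G_def[OF swap] by (simp add: Lam_G inv)

lemma isCont_G: assumes "s \<in> HP" shows "isCont G s"
proof -
  have "k (\<Lambda> s) \<in> cleft C" using range[OF assms] k_cleft by blast
  then have "isCont \<Psi> (k (\<Lambda> s))" by (rule isCont_Psi)
  then have "isCont (\<lambda>s. \<Psi> (k (\<Lambda> s))) s"
    by (intro isCont_o2[where f = "\<lambda>s. k (\<Lambda> s)" and g = \<Psi>] isCont_o2[OF isCont_Lam[OF assms] isCont_k])
  then show ?thesis by (simp add: G_def[abs_def])
qed

lemma cont_G: "continuous_on HP G"
  using isCont_G by (simp add: continuous_on_eq_continuous_at open_HP)

lemma G_per: "s \<in> HP \<Longrightarrow> G (s + 1) = G s + 1"
proof -
  assume s: "s \<in> HP"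
  have "\<Lambda> (G s + 1) = k (\<Lambda> s) + 1" using per[OF G_HP[OF s]] Lam_G[OF s] by simp
  also have "\<dots> = k (\<Lambda> (s + 1))" using per[OF s] k_per by simp
  finally have "\<Psi> (\<Lambda> (G s + 1)) = G (s + 1)" by (simp add: G_def)
  moreover have "G s + 1 \<in> HP" using G_HP[OF s] by simp
  ultimately show ?thesis using inv by simp
qed

text \<open>The real part is controlled by applying \<open>V_bound\<close> to \<open>s\<close> and
  to \<open>G s\<close>. For the height, \<open>upper\<close> and \<open>Im_k\<close> bound
  \<open>Im (\<Lambda> (G s))\<close> from above, and \<open>far\<close> compares it with
  \<open>Im (G s)\<close> as soon as the latter is at least 1.\<close>

lemma G_bounded: "\<exists>B. \<forall>s\<in>HP. \<bar>Re s\<bar> \<le> R \<longrightarrow> Im s \<le> 1 \<longrightarrow> cmod (G s) \<le> B"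
proof -
  obtain B where B: "\<And>x y. y > 0 \<Longrightarrow> \<bar>V x y - x\<bar> \<le> B" using V_bound by blast
  have B': "\<bar>Re (\<Lambda> s) - Re s\<bar> \<le> B" if "s \<in> HP" for s using B[of "Im s" "Re s"] that by (simp add: V_def)
  obtain M where M: "\<And>s. s \<in> HP \<Longrightarrow> Im (\<Lambda> s) \<le> Im s + M" using upper by blast
  obtain B1 where B1: "\<And>w. Im w \<le> 1 + M \<Longrightarrow> Im (k w) \<le> B1" using Im_k by blast
  obtain B2 where B2: "\<And>s. Im s \<ge> 1 \<Longrightarrow> cmod (\<Lambda> s - s) \<le> B2" using far[of 1] by auto
  define b where "b = \<bar>F (R + B)\<bar> + \<bar>F (- R - B)\<bar> + B"
  have "cmod (G s) \<le> b + (\<bar>B1\<bar> + \<bar>B2\<bar> + 1)" if s: "s \<in> HP" "\<bar>Re s\<bar> \<le> R" "Im s \<le> 1" for s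
  proof -
    have "\<bar>Re (\<Lambda> s)\<bar> \<le> R + B" using B'[OF s(1)] s(2) by linarith
    then have "F (- R - B) \<le> F (Re (\<Lambda> s))" "F (Re (\<Lambda> s)) \<le> F (R + B)"
      by (auto simp: strict_mono_less_eq[OF F_mono] abs_le_iff)
    moreover have "\<bar>F (Re (\<Lambda> s)) - Re (G s)\<bar> \<le> B" using B'[OF G_HP[OF s(1)]] by (simp add: Lam_G[OF s(1)])
    ultimately have r: "\<bar>Re (G s)\<bar> \<le> b" unfolding b_def by linarith
    have "Im (k (\<Lambda> s)) \<le> B1" using M[OF s(1)] s(3) by (intro B1) simp
    then have i1: "Im (\<Lambda> (G s)) \<le> B1" by (simp add: Lam_G[OF s(1)])
    have i: "\<bar>Im (G s)\<bar> \<le> \<bar>B1\<bar> + \<bar>B2\<bar> + 1"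
    proof (cases "Im (G s) \<ge> 1")
      case True
      have "\<bar>Im (\<Lambda> (G s) - G s)\<bar> \<le> B2" using B2[OF True] abs_Im_le_cmod[of "\<Lambda> (G s) - G s"] by linarith
      then show ?thesis using i1 True by (simp; linarith)
    next
      case False
      then show ?thesis using G_HP[OF s(1)] by simp
    qed
    show ?thesis using cmod_le[of "G s"] r i by linarith
  qed
  then show ?thesis by blast
qed

text \<open>Properness: the imaginary part of the inverse of \<open>G\<close> is bounded below on
  the compact set of bounded points with height at least \<open>e\<close>, so points lower than this
  bound are not mapped there.\<close>

lemma G_Im_small:
  assumes e: "e > 0"
  shows "\<exists>\<delta>>0. \<forall>s\<in>HP. \<bar>Re s\<bar> \<le> R \<longrightarrow> Im s < \<delta> \<longrightarrow> Im (G s) < e"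
proof -
  obtain B where B: "\<And>s. s \<in> HP \<Longrightarrow> \<bar>Re s\<bar> \<le> R \<Longrightarrow> Im s \<le> 1 \<Longrightarrow> cmod (G s) \<le> B" using G_bounded by blast
  define K where "K = cball (0::complex) B \<inter> {t. Im t \<ge> e}"
  have cK: "compact K" unfolding K_def by (intro compact_Int_closed compact_cball closed_halfspace_Im_ge)
  have KH: "K \<subseteq> HP" using e by (auto simp: K_def)
  define G' where "G' = spike_ext.G \<Lambda> \<Psi> k'"
  have cG: "continuous_on K (\<lambda>t. Im (G' t))" unfolding G'_def
    by (intro continuous_on_Im continuous_on_subset[OF spike_ext.cont_G[OF swap] KH])
  have G'H: "Im (G' t) > 0" if "t \<in> K" for t
    using spike_ext.G_HP[OF swap, of t] that KH by (auto simp: G'_def)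
  obtain d where d: "d > 0" "\<And>t. t \<in> K \<Longrightarrow> d \<le> Im (G' t)"
  proof (cases "K = {}")
    case True
    then show ?thesis using that[of 1] by simp
  next
    case False
    then obtain t0 where "t0 \<in> K" "\<And>t. t \<in> K \<Longrightarrow> Im (G' t0) \<le> Im (G' t)"
      using continuous_attains_inf[OF cK _ cG] by blast
    then show ?thesis using that[of "Im (G' t0)"] G'H by blast
  qed
  have "Im (G s) < e" if s: "s \<in> HP" "\<bar>Re s\<bar> \<le> R" "Im s < min d 1" for s
  proof (rule ccontr)
    assume "\<not> Im (G s) < e"
    then have "G s \<in> K" using B[OF s(1,2)] s(3) by (simp add: K_def)
    then have "d \<le> Im s" using d(2)[of "G s"] G_swap[OF s(1)] by (simp add: G'_def)
    then show False using s by simp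
  qed
  then show ?thesis using d(1) by (intro exI[of _ "min d 1"]) auto
qed

section \<open>Cluster values at a boundary point\<close>

definition cluster :: "real \<Rightarrow> real \<Rightarrow> bool" where
  "cluster x y \<longleftrightarrow> (\<forall>e>0. \<exists>s\<in>HP. cmod (s - of_real x) < e \<and> cmod (G s - of_real y) < e)"

text \<open>Records in addition a limit angle of the sequence realising the cluster value; through
  \<open>X\<close> this angle locates both \<open>x\<close> and \<open>y\<close>.\<close>

definition cluster_at :: "real \<Rightarrow> real \<Rightarrow> real \<Rightarrow> bool" where
  "cluster_at x y \<theta> \<longleftrightarrow> (\<exists>s. (\<forall>n. s n \<in> HP) \<and> s \<longlonglongrightarrow> of_real x \<and> (\<lambda>n. G (s n)) \<longlonglongrightarrow> of_real y
     \<and> (\<lambda>n. Re (\<Lambda> (s n))) \<longlonglongrightarrow> \<theta>)"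

text \<open>The image of a half disc under \<open>Re G\<close> is connected and contains values on
  both sides of \<open>y\<close>; where \<open>Re (G s) = y\<close>, the height of
  \<open>G s\<close> is small by \<open>G_Im_small\<close>.\<close>

lemma cluster_between:
  assumes "cluster x y1" "cluster x y2" "y1 < y" "y < y2"
  shows "cluster x y"
  unfolding cluster_def
proof (intro allI impI)
  fix e :: real assume e: "e > 0"
  obtain d where d: "d > 0" "\<And>s. s \<in> HP \<Longrightarrow> \<bar>Re s\<bar> \<le> \<bar>x\<bar> + 1 \<Longrightarrow> Im s < d \<Longrightarrow> Im (G s) < e"
    using G_Im_small[OF e, of "\<bar>x\<bar> + 1"] by blast
  define e' where "e' = min (min e d) (min (min (y - y1) (y2 - y)) 1)"
  have e': "e' > 0" using e d assms by (simp add: e'_def)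
  obtain s1 where s1: "s1 \<in> HP" "cmod (s1 - of_real x) < e'" "cmod (G s1 - of_real y1) < e'"
    using assms(1) e' unfolding cluster_def by blast
  obtain s2 where s2: "s2 \<in> HP" "cmod (s2 - of_real x) < e'" "cmod (G s2 - of_real y2) < e'"
    using assms(2) e' unfolding cluster_def by blast
  have "e' \<le> y - y1" "e' \<le> y2 - y" by (simp_all add: e'_def)
  moreover have "\<bar>Re (G s1) - y1\<bar> < e'" using s1(3) abs_Re_le_cmod[of "G s1 - of_real y1"] by simp
  moreover have "\<bar>Re (G s2) - y2\<bar> < e'" using s2(3) abs_Re_le_cmod[of "G s2 - of_real y2"] by simp
  ultimately have b: "Re (G s1) \<le> y" "y \<le> Re (G s2)" by simp_all
  define S where "S = HP \<inter> ball (of_real x) e'"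
  have "convex S" unfolding S_def by (intro convex_Int convex_ball convex_halfspace_Im_gt)
  then have "connected ((\<lambda>s. Re (G s)) ` S)"
    by (intro connected_continuous_image continuous_on_Re continuous_on_subset[OF cont_G] convex_connected)
       (auto simp: S_def)
  moreover have "Re (G s1) \<in> (\<lambda>s. Re (G s)) ` S" "Re (G s2) \<in> (\<lambda>s. Re (G s)) ` S"
    using s1 s2 by (auto simp: S_def dist_norm norm_minus_commute)
  ultimately have "y \<in> (\<lambda>s. Re (G s)) ` S" using b connected_contains_Icc by (meson atLeastAtMost_iff subsetD)
  then obtain s where s: "s \<in> HP" "cmod (s - of_real x) < e'" "Re (G s) = y"
    by (auto simp: S_def dist_norm norm_minus_commute)
  have r: "\<bar>Re (s - of_real x)\<bar> < 1" "\<bar>Im (s - of_real x)\<bar> < d"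
    using s(2) abs_Re_le_cmod[of "s - of_real x"] abs_Im_le_cmod[of "s - of_real x"] by (auto simp: e'_def)
  then have "\<bar>Re s\<bar> \<le> \<bar>x\<bar> + 1" "Im s < d" by auto
  then have "Im (G s) < e" using d(2) s(1) by blast
  moreover have "G s - of_real y = \<i> * of_real (Im (G s))" using s(3) by (simp add: complex_eq_iff)
  ultimately have "cmod (G s - of_real y) < e" using G_HP[OF s(1)] by (simp add: norm_mult)
  moreover have "cmod (s - of_real x) < e" using s(2) by (simp add: e'_def)
  ultimately show "\<exists>s\<in>HP. cmod (s - of_real x) < e \<and> cmod (G s - of_real y) < e" using s(1) by blast
qed

lemma cluster_angle:
  assumes "cluster x y" obtains \<theta> where "cluster_at x y \<theta>"
proof -
  have "\<forall>n. \<exists>s. s \<in> HP \<and> cmod (s - of_real x) < inverse (real (Suc n)) \<and> cmod (G s - of_real y) < inverse (real (Suc n))"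
    using assms unfolding cluster_def by (metis inverse_positive_iff_positive of_nat_0_less_iff zero_less_Suc)
  then obtain s where s: "\<And>n. s n \<in> HP" "\<And>n. cmod (s n - of_real x) < inverse (real (Suc n))"
    "\<And>n. cmod (G (s n) - of_real y) < inverse (real (Suc n))" by metis
  have l1: "s \<longlonglongrightarrow> of_real x"
    by (rule LIMSEQ_norm_0[of "\<lambda>n. s n - of_real x", THEN LIM_zero_cancel]) (use s(2) in \<open>simp add: inverse_eq_divide\<close>)
  have l2: "(\<lambda>n. G (s n)) \<longlonglongrightarrow> of_real y"
    by (rule LIMSEQ_norm_0[of "\<lambda>n. G (s n) - of_real y", THEN LIM_zero_cancel]) (use s(3) in \<open>simp add: inverse_eq_divide\<close>)
  obtain B where B: "\<And>x y. y > 0 \<Longrightarrow> \<bar>V x y - x\<bar> \<le> B" using V_bound by blast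
  have "\<bar>Re (\<Lambda> (s n))\<bar> \<le> \<bar>x\<bar> + 1 + B" for n
  proof -
    have "inverse (real (Suc n)) \<le> 1" by (simp add: inverse_le_1_iff)
    then have "\<bar>Re (s n - of_real x)\<bar> \<le> 1" using s(2)[of n] abs_Re_le_cmod[of "s n - of_real x"] by linarith
    then show ?thesis using B[of "Im (s n)" "Re (s n)"] s(1)[of n] by (simp add: V_def; linarith)
  qed
  then have "bounded (range (\<lambda>n. Re (\<Lambda> (s n))))" unfolding bounded_iff by auto
  then obtain \<theta> r where r: "strict_mono r" "((\<lambda>n. Re (\<Lambda> (s n))) \<circ> r) \<longlonglongrightarrow> \<theta>"
    using bounded_imp_convergent_subsequence by blast
  have "cluster_at x y \<theta>" unfolding cluster_at_def
    using s(1) LIMSEQ_subseq_LIMSEQ[OF l1 r(1)] LIMSEQ_subseq_LIMSEQ[OF l2 r(1)] r(2)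
    by (intro exI[of _ "s \<circ> r"]) (simp add: o_def)
  then show thesis using that by blast
qed

text \<open>The angle of \<open>\<Lambda> (G s)\<close> is the image under \<open>F\<close> of the
  angle of \<open>\<Lambda> s\<close>, so the cluster lemmas apply to \<open>x\<close> with the
  angle \<open>\<theta>\<close> and to \<open>y\<close> with the angle
  \<open>F \<theta>\<close>.\<close>

lemma cluster_at_X:
  assumes "cluster_at x y \<theta>"
  shows "\<And>\<theta>'. \<theta>' < \<theta> \<Longrightarrow> X \<theta>' \<le> x" "\<And>\<theta>'. \<theta> < \<theta>' \<Longrightarrow> x \<le> X \<theta>'"
    "\<And>\<theta>'. \<theta>' < F \<theta> \<Longrightarrow> X \<theta>' \<le> y" "\<And>\<theta>'. F \<theta> < \<theta>' \<Longrightarrow> y \<le> X \<theta>'"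
proof -
  obtain s where s: "\<And>n. s n \<in> HP" "s \<longlonglongrightarrow> of_real x" "(\<lambda>n. G (s n)) \<longlonglongrightarrow> of_real y"
    "(\<lambda>n. Re (\<Lambda> (s n))) \<longlonglongrightarrow> \<theta>" using assms unfolding cluster_at_def by blast
  have "(\<lambda>n. Re (\<Lambda> (G (s n)))) \<longlonglongrightarrow> F \<theta>"
    using isCont_tendsto_compose[OF isCont_F s(4)] by (simp add: Lam_G[OF s(1)])
  then show "\<And>\<theta>'. \<theta>' < F \<theta> \<Longrightarrow> X \<theta>' \<le> y" "\<And>\<theta>'. F \<theta> < \<theta>' \<Longrightarrow> y \<le> X \<theta>'"
    using cluster_X_le[of "\<lambda>n. G (s n)"] cluster_X_ge[of "\<lambda>n. G (s n)"] G_HP s by blast+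
  show "\<And>\<theta>'. \<theta>' < \<theta> \<Longrightarrow> X \<theta>' \<le> x" "\<And>\<theta>'. \<theta> < \<theta>' \<Longrightarrow> x \<le> X \<theta>'"
    using cluster_X_le[OF s(1,2,4)] cluster_X_ge[OF s(1,2,4)] by blast+
qed

lemma cluster_at_mono:
  assumes "cluster_at x y \<theta>" "cluster_at x y' \<theta>'" "y < y'" shows "\<theta> \<le> \<theta>'"
proof (rule ccontr)
  assume "\<not> \<theta> \<le> \<theta>'"
  then have "F \<theta>' < F \<theta>" using strict_monoD[OF F_mono] by simp
  then obtain \<phi> where "F \<theta>' < \<phi>" "\<phi> < F \<theta>" using dense by blast
  then have "y' \<le> X \<phi>" "X \<phi> \<le> y" using cluster_at_X assms by blast+
  then show False using assms by simp
qed

text \<open>A nondegenerate set of cluster values over a right-hand jump of X would make the inverse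
  conformal map constant on a side of a slit.\<close>

lemma no_right_cluster:
  assumes z: "z1 < z2" and cluster_at: "\<And>y. z1 < y \<Longrightarrow> y < z2 \<Longrightarrow> cluster_at x y \<theta>" and X: "X (F \<theta>) \<le> z1"
  shows False
proof -
  define \<alpha> where "\<alpha> = F \<theta>"
  have Xq: "z2 \<le> X \<phi>" if "\<alpha> < \<phi>" for \<phi>
    by (rule dense_le_bounded[OF z]) (use cluster_at_X(4)[OF cluster_at] that \<alpha>_def in blast)
  have Xp: "X \<alpha> \<le> z1" using X by (simp add: \<alpha>_def)
  \<comment> \<open>By \<open>X_gap\<close>, \<open>X\<close> is constant near a point off
    \<open>C\<close>, but it jumps at \<open>\<alpha>\<close>.\<close>
  have \<alpha>C: "\<alpha> \<in> C"
  proof (rule ccontr)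
    assume "\<alpha> \<notin> C"
    then obtain e where e: "e > 0" "ball \<alpha> e \<subseteq> - C"
      using C_closed open_contains_ball[of "- C"] by (auto simp: open_Compl)
    have "{\<alpha>..\<alpha> + e/2} \<subseteq> ball \<alpha> e" using e by (auto simp: dist_real_def)
    then have "{\<alpha>..\<alpha> + e/2} \<inter> C = {}" using e(2) by blast
    then have "X \<alpha> = X (\<alpha> + e/2)" using e by (intro X_gap) auto
    then show False using Xq[of "\<alpha> + e/2"] Xp z e by simp
  qed
  \<comment> \<open>A right limit point of \<open>C\<close> is excluded by
    \<open>X_right_limit\<close>, so a gap starts at \<open>\<alpha>\<close>; \<open>F'\<close>
    carries it to a gap starting at \<open>\<theta>\<close>.\<close>
  have "\<exists>\<delta>>0. \<not> (\<exists>\<theta>'\<in>C. \<alpha> < \<theta>' \<and> \<theta>' < \<alpha> + \<delta>)"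
  proof (rule ccontr)
    assume "\<not> ?thesis"
    then have "\<exists>\<theta>'>\<alpha>. X \<theta>' < z2" using Xp z by (intro X_right_limit[OF \<alpha>C]) auto
    then show False using Xq by fastforce
  qed
  then obtain \<delta> where \<delta>0: "\<delta> > 0" "\<not> (\<exists>\<theta>'\<in>C. \<alpha> < \<theta>' \<and> \<theta>' < \<alpha> + \<delta>)" by blast
  then have \<delta>: "\<delta> > 0" "{\<alpha><..<\<alpha> + \<delta>} \<inter> C = {}" by auto
  define \<gamma> where "\<gamma> = F' (\<alpha> + \<delta>)"
  have \<theta>\<alpha>: "F' \<alpha> = \<theta>" by (simp add: \<alpha>_def)
  have \<theta>C: "\<theta> \<in> C" using \<alpha>C F_C by (simp add: \<alpha>_def)
  have \<gamma>: "\<theta> < \<gamma>" unfolding \<gamma>_def \<theta>\<alpha>[symmetric] using \<delta> strict_monoD[OF F'_mono] by simp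
  have gap: "{\<theta><..<\<gamma>} \<inter> C = {}"
  proof (rule equals0I)
    fix c assume c: "c \<in> {\<theta><..<\<gamma>} \<inter> C"
    then have "F \<theta> < F c" "F c < F \<gamma>" using strict_monoD[OF F_mono] by auto
    then have "F c \<in> {\<alpha><..<\<alpha> + \<delta>}" by (simp add: \<gamma>_def \<alpha>_def)
    moreover have "F c \<in> C" using c F_C by simp
    ultimately show False using \<delta> by blast
  qed
  \<comment> \<open>On the jump interval \<open>\<Lambda>\<close> has boundary values
    \<open>Complex \<alpha> (t y)\<close> on the slit over \<open>\<alpha>\<close>, approached from
    the right; \<open>t\<close> turns out to be continuous and not constant.\<close>
  have "\<forall>y. z1 < y \<and> y < z2 \<longrightarrow> (\<exists>t. (\<Lambda> \<longlongrightarrow> Complex \<alpha> t) (at (of_real y) within HP) \<and>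
    eventually (\<lambda>s. Re (\<Lambda> s) > \<alpha>) (at (of_real y) within HP))"
    using jump_limit[OF Xp Xq] by metis
  then obtain t where t: "\<And>y. z1 < y \<Longrightarrow> y < z2 \<Longrightarrow> (\<Lambda> \<longlongrightarrow> Complex \<alpha> (t y)) (at (of_real y) within HP)"
    and ev: "\<And>y. z1 < y \<Longrightarrow> y < z2 \<Longrightarrow> eventually (\<lambda>s. Re (\<Lambda> s) > \<alpha>) (at (of_real y) within HP)"
    by metis
  have ct: "continuous_on {z1<..<z2} t"
  proof -
    have "continuous_on {z1<..<z2} (\<lambda>y. Complex \<alpha> (t y))"
      by (rule continuous_on_boundary_limit[where f = \<Lambda>]) (use t in auto)
    then have "continuous_on {z1<..<z2} (\<lambda>y. Im (Complex \<alpha> (t y)))" by (rule continuous_on_Im)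
    then show ?thesis by simp
  qed
  have t0: "t y \<le> 0" if "z1 < y" "y < z2" for y
    using Lam_boundary_notin[OF t[OF that]] \<alpha>C by simp
  obtain ya yb where y: "z1 < ya" "ya < z2" "z1 < yb" "yb < z2" "t ya < t yb"
  proof -
    define m where "m = (z1 + z2) / 2"
    have m: "z1 < m" "m < z2" using z by (auto simp: m_def)
    have "\<exists>y. z1 < y \<and> y < z2 \<and> t y \<noteq> t m"
    proof (rule ccontr)
      assume "\<not> ?thesis"
      then have "(\<Lambda> \<longlongrightarrow> Complex \<alpha> (t m)) (at (of_real y) within HP)" if "z1 < y" "y < z2" for y
        using t[OF that] that by metis
      then show False using Lam_boundary_not_constant[OF z] by blast
    qed
    then obtain y where "z1 < y" "y < z2" "t y \<noteq> t m" by blast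
    then show thesis using that m by (meson linorder_neqE_linordered_idom)
  qed
  \<comment> \<open>A height strictly between two values of \<open>t\<close> is taken at some
    \<open>y'\<close>. A sequence for the cluster value \<open>y'\<close> tends to \<open>x\<close>,
    while its images under \<open>\<Lambda>\<close> tend to the point of the slit over
    \<open>\<theta>\<close> that \<open>k\<close> maps to
    \<open>Complex \<alpha> \<tau>\<close>.\<close>
  have conv: "\<exists>s. (\<forall>n. s n \<in> HP) \<and> s \<longlonglongrightarrow> of_real x \<and> (\<lambda>n. \<Lambda> (s n)) \<longlonglongrightarrow> k' (Complex \<alpha> \<tau>) \<and>
      eventually (\<lambda>n. Re (\<Lambda> (s n)) > \<theta>) sequentially" if \<tau>: "t ya < \<tau>" "\<tau> < t yb" for \<tau>
  proof -
    obtain y' where y': "z1 < y'" "y' < z2" "t y' = \<tau>"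
      using real_IVT_between[OF ct _ , of ya yb \<tau>] y \<tau> by auto
    obtain s where s: "\<And>n. s n \<in> HP" "s \<longlonglongrightarrow> of_real x" "(\<lambda>n. G (s n)) \<longlonglongrightarrow> of_real y'"
      using cluster_at[OF y'(1,2)] unfolding cluster_at_def by blast
    have "G (s n) \<noteq> of_real y'" for n using G_HP[OF s(1)[of n]] by auto
    then have fl: "filterlim (\<lambda>n. G (s n)) (at (of_real y') within HP) sequentially"
      using s(3) G_HP s(1) unfolding filterlim_at by (intro conjI always_eventually) auto
    have "(\<lambda>n. \<Lambda> (G (s n))) \<longlonglongrightarrow> Complex \<alpha> \<tau>"
      using filterlim_compose[OF t[OF y'(1,2)] fl] y'(3) by simp
    then have "(\<lambda>n. k' (\<Lambda> (G (s n)))) \<longlonglongrightarrow> k' (Complex \<alpha> \<tau>)"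
      by (rule isCont_tendsto_compose[OF isCont_k'])
    then have "(\<lambda>n. \<Lambda> (s n)) \<longlonglongrightarrow> k' (Complex \<alpha> \<tau>)" by (simp add: Lam_G[OF s(1)])
    moreover have "eventually (\<lambda>n. Re (\<Lambda> (G (s n))) > \<alpha>) sequentially"
      using eventually_compose_filterlim[OF ev[OF y'(1,2)] fl] .
    then have "eventually (\<lambda>n. Re (\<Lambda> (s n)) > \<theta>) sequentially"
      by (simp add: Lam_G[OF s(1)] \<alpha>_def strict_mono_less[OF F_mono])
    ultimately show ?thesis using s by blast
  qed
  define e where "e = (\<lambda>\<tau>. Im (k' (Complex \<alpha> \<tau>)))"
  have ke: "k' (Complex \<alpha> \<tau>) = Complex \<theta> (e \<tau>)" for \<tau> by (simp add: e_def complex_eq_iff \<theta>\<alpha>)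
  have ce: "continuous_on UNIV e" unfolding e_def Complex_eq
    by (intro continuous_on_Im continuous_on_compose2[OF cont_k'] continuous_intros) auto
  \<comment> \<open>Interior heights, so that \<open>conv\<close> covers the closed interval between
    them; \<open>e\<close> separates them because \<open>k'\<close> is injective.\<close>
  define \<tau>1 \<tau>2 where "\<tau>1 = t ya + (t yb - t ya) / 3" and "\<tau>2 = t ya + 2 * (t yb - t ya) / 3"
  have \<tau>: "t ya < \<tau>1" "\<tau>1 < \<tau>2" "\<tau>2 < t yb" using y by (auto simp: \<tau>1_def \<tau>2_def field_simps)
  have "e \<tau>1 \<noteq> e \<tau>2"
  proof
    assume "e \<tau>1 = e \<tau>2"
    then have "k (k' (Complex \<alpha> \<tau>1)) = k (k' (Complex \<alpha> \<tau>2))" by (simp only: ke)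
    then show False using \<tau> by simp
  qed
  define u1 u2 where "u1 = min (e \<tau>1) (e \<tau>2)" and "u2 = max (e \<tau>1) (e \<tau>2)"
  have u12: "u1 < u2" using \<open>e \<tau>1 \<noteq> e \<tau>2\<close> by (auto simp: u1_def u2_def)
  have e0: "e \<tau> \<le> 0" if "\<tau> < t yb" for \<tau>
  proof -
    have "Complex \<alpha> \<tau> \<notin> cleft C" using \<alpha>C t0[of yb] y that by simp
    then have "k' (Complex \<alpha> \<tau>) \<notin> cleft C" using k_cleft[of "k' (Complex \<alpha> \<tau>)"] by simp
    then show ?thesis by (simp add: ke \<theta>C)
  qed
  have u2: "u2 \<le> 0" using e0[of \<tau>1] e0[of \<tau>2] \<tau> by (simp add: u2_def)
  \<comment> \<open>On the right side of the slit over \<open>\<theta>\<close>,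
    \<open>\<Psi>\<close> has a limit by \<open>side_limit\<close>; evaluated along the sequence of
    \<open>conv\<close>, this limit is \<open>x\<close> at every height between \<open>u1\<close>
    and \<open>u2\<close>.\<close>
  show False
  proof (rule side_not_constant[OF \<theta>C \<gamma> gap u12 u2, of x])
    fix u assume u: "u1 < u" "u < u2"
    obtain \<tau> where \<tau>': "\<tau> \<in> {\<tau>1..\<tau>2}" "e \<tau> = u"
    proof (cases "e \<tau>1 \<le> e \<tau>2")
      case True
      then show ?thesis using real_IVT_between[of "{\<tau>1..\<tau>2}" e \<tau>1 \<tau>2 u] u \<tau> that
        continuous_on_subset[OF ce] by (auto simp: u1_def u2_def)
    next
      case False
      then show ?thesis using real_IVT_between[of "{\<tau>1..\<tau>2}" e \<tau>2 \<tau>1 u] u \<tau> that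
        continuous_on_subset[OF ce] by (auto simp: u1_def u2_def)
    qed
    have un: "u < 0" using u u2 by simp
    obtain s where s: "\<And>n. s n \<in> HP" "s \<longlonglongrightarrow> of_real x" "(\<lambda>n. \<Lambda> (s n)) \<longlonglongrightarrow> Complex \<theta> u"
      "eventually (\<lambda>n. Re (\<Lambda> (s n)) > \<theta>) sequentially"
      using conv[of \<tau>] \<tau>' \<tau> unfolding ke by auto
    obtain l where l: "(\<Psi> \<longlongrightarrow> l) (at (Complex \<theta> u) within cleft C \<inter> {w. Re w > \<theta>})"
      using side_limit[OF \<theta>C \<gamma> gap un] by blast
    have nw: "Complex \<theta> u \<notin> cleft C" using \<theta>C un by simp
    have ne: "\<Lambda> (s n) \<noteq> Complex \<theta> u" for n using range[OF s(1)[of n]] nw by metis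
    have "eventually (\<lambda>n. \<Lambda> (s n) \<in> cleft C \<inter> {w. Re w > \<theta>} \<and> \<Lambda> (s n) \<noteq> Complex \<theta> u) sequentially"
      using s(4) by eventually_elim (use range[OF s(1)] ne in blast)
    then have "filterlim (\<lambda>n. \<Lambda> (s n)) (at (Complex \<theta> u) within cleft C \<inter> {w. Re w > \<theta>}) sequentially"
      using s(3) unfolding filterlim_at by blast
    then have "(\<lambda>n. \<Psi> (\<Lambda> (s n))) \<longlonglongrightarrow> l" by (rule filterlim_compose[OF l])
    then have "s \<longlonglongrightarrow> l" by (simp add: inv[OF s(1)])
    then have "l = of_real x" using LIMSEQ_unique[OF _ s(2)] by simp
    then show "(\<Psi> \<longlongrightarrow> of_real x) (at (Complex \<theta> u) within cleft C \<inter> {w. Re w > \<theta>})" using l by simp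
  qed
qed

lemma mirror_G: "spike_ext.G (\<lambda>s. mirror_pt (\<Lambda> (mirror_pt s))) (\<lambda>w. mirror_pt (\<Psi> (mirror_pt w))) (\<lambda>w. mirror_pt (k (mirror_pt w))) s = mirror_pt (G (mirror_pt s))"
  unfolding spike_ext.G_def[OF mirror_ext] G_def by simp

lemma no_left_cluster:
  assumes z: "z1 < z2" and cluster_at: "\<And>y. z1 < y \<Longrightarrow> y < z2 \<Longrightarrow> cluster_at x y \<theta>" and X: "z2 \<le> X (F \<theta>)"
  shows False
proof (rule spike_ext.no_right_cluster[OF mirror_ext, of "- z2" "- z1" "- x" "- \<theta>"])
  show "- z2 < - z1" using z by simp
  show "spike_map.X (\<lambda>s. mirror_pt (\<Lambda> (mirror_pt s))) (- F (- (- \<theta>))) \<le> - z2" using X by (simp add: mirror_X)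
  fix y assume "- z2 < y" "y < - z1"
  then have "cluster_at x (- y) \<theta>" using cluster_at by simp
  then obtain s where s: "\<And>n. s n \<in> HP" "s \<longlonglongrightarrow> of_real x" "(\<lambda>n. G (s n)) \<longlonglongrightarrow> of_real (- y)"
    "(\<lambda>n. Re (\<Lambda> (s n))) \<longlonglongrightarrow> \<theta>" unfolding cluster_at_def by blast
  have "(\<lambda>n. mirror_pt (s n)) \<longlonglongrightarrow> of_real (- x)" using tendsto_mirror_pt[OF s(2)] by simp
  moreover have "(\<lambda>n. mirror_pt (G (mirror_pt (mirror_pt (s n))))) \<longlonglongrightarrow> of_real y"
    using tendsto_mirror_pt[OF s(3)] unfolding mirror_pt_of_real by simp
  moreover have "(\<lambda>n. Re (mirror_pt (\<Lambda> (mirror_pt (mirror_pt (s n)))))) \<longlonglongrightarrow> - \<theta>" using tendsto_minus[OF s(4)] by simp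
  moreover have "mirror_pt (s n) \<in> HP" for n using s(1) by simp
  ultimately show "spike_ext.cluster_at (\<lambda>s. mirror_pt (\<Lambda> (mirror_pt s))) (\<lambda>w. mirror_pt (\<Psi> (mirror_pt w))) (\<lambda>w. mirror_pt (k (mirror_pt w))) (- x) y (- \<theta>)"
    unfolding spike_ext.cluster_at_def[OF mirror_ext] mirror_G by (intro exI[of _ "\<lambda>n. mirror_pt (s n)"]) auto
qed

text \<open>Limit angles \<open>\<theta> y\<close> of the cluster values between \<open>y1\<close>
  and \<open>y2\<close> increase weakly with \<open>y\<close>. If one angle serves a whole
  subinterval, the lemmas on right and left clusters apply. Otherwise the angles grow on both sides
  of \<open>m\<close>; then \<open>X\<close> equals \<open>x\<close> on an interval of angles, which
  is free of \<open>C\<close>, so \<open>X\<close> is constant on the image of this interval under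
  \<open>F\<close>, although it takes values on both sides of \<open>m\<close> there.\<close>

lemma cluster_unique:
  assumes "cluster x y1" "cluster x y2" shows "\<not> y1 < y2"
proof
  assume lt: "y1 < y2"
  have "\<forall>y. y1 < y \<and> y < y2 \<longrightarrow> (\<exists>\<theta>. cluster_at x y \<theta>)"
    using cluster_between[OF assms] cluster_angle by metis
  then obtain \<theta> where \<theta>: "\<And>y. y1 < y \<Longrightarrow> y < y2 \<Longrightarrow> cluster_at x y (\<theta> y)" by metis
  define m where "m = (y1 + y2) / 2"
  have m: "y1 < m" "m < y2" using lt by (auto simp: m_def)
  have const: "\<exists>z1 z2 \<phi>. z1 < z2 \<and> (\<forall>y. z1 < y \<longrightarrow> y < z2 \<longrightarrow> cluster_at x y \<phi>)"
  proof (rule ccontr)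
    assume neg: "\<not> ?thesis"
    have pair: "\<exists>p q. z1 < p \<and> p < q \<and> q < z2 \<and> \<theta> p < \<theta> q" if z: "y1 \<le> z1" "z1 < z2" "z2 \<le> y2" for z1 z2
    proof -
      define c where "c = (z1 + z2) / 2"
      have c: "z1 < c" "c < z2" using z by (auto simp: c_def)
      have "\<exists>y. z1 < y \<and> y < z2 \<and> \<theta> y \<noteq> \<theta> c"
      proof (rule ccontr)
        assume "\<not> ?thesis"
        then have "\<And>y. z1 < y \<Longrightarrow> y < z2 \<Longrightarrow> cluster_at x y (\<theta> c)"
          using \<theta> z by (metis le_less_trans less_le_trans)
        then show False using neg z by blast
      qed
      then obtain y where y: "z1 < y" "y < z2" "\<theta> y \<noteq> \<theta> c" by blast
      show ?thesis
      proof (cases "y < c")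
        case True
        then have "\<theta> y \<le> \<theta> c" using cluster_at_mono[OF \<theta> \<theta>, of y c] y c z by auto
        then show ?thesis using y c True by force
      next
        case False
        then have cy: "c < y" using y by (metis linorder_neqE_linordered_idom)
        then have "\<theta> c \<le> \<theta> y" using cluster_at_mono[OF \<theta> \<theta>, of c y] y c z by auto
        then show ?thesis using y c cy by force
      qed
    qed
    \<comment> \<open>One pair on each side of \<open>m\<close>: the strict increase within each
      pair leaves room for \<open>\<phi>1\<close> and \<open>\<phi>2\<close>, and
      \<open>q < m < p'\<close> contradicts \<open>X \<phi>1 = X \<phi>2\<close>.\<close>
    obtain p q where pq: "y1 < p" "p < q" "q < m" "\<theta> p < \<theta> q" using pair[of y1 m] m by auto
    obtain p' q' where pq': "m < p'" "p' < q'" "q' < y2" "\<theta> p' < \<theta> q'" using pair[of m y2] m by auto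
    have r: "cluster_at x p (\<theta> p)" "cluster_at x q (\<theta> q)" "cluster_at x p' (\<theta> p')" "cluster_at x q' (\<theta> q')"
      using \<theta> pq pq' m by auto
    have qp: "\<theta> q \<le> \<theta> p'" using cluster_at_mono[OF r(2,3)] pq pq' by simp
    have Xc: "X \<phi> = x" if "\<theta> p < \<phi>" "\<phi> < \<theta> q'" for \<phi>
      using cluster_at_X(2)[OF r(1) that(1)] cluster_at_X(1)[OF r(4) that(2)] by simp
    have gap: "{\<theta> p<..<\<theta> q'} \<inter> C = {}" by (rule X_const_gap) (rule Xc)
    have gapF: "{\<phi>1..\<phi>2} \<inter> C = {}" if "F (\<theta> p) < \<phi>1" "\<phi>2 < F (\<theta> q')" for \<phi>1 \<phi>2
    proof (rule equals0I)
      fix c assume c: "c \<in> {\<phi>1..\<phi>2} \<inter> C"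
      then have "F (\<theta> p) < c" "c < F (\<theta> q')" using that by auto
      then have "F' (F (\<theta> p)) < F' c" "F' c < F' (F (\<theta> q'))"
        using strict_monoD[OF F'_mono] by blast+
      moreover have "F' c \<in> C" using c F_C[of "F' c"] by simp
      ultimately show False using gap by auto
    qed
    obtain \<phi>1 where \<phi>1: "F (\<theta> p) < \<phi>1" "\<phi>1 < F (\<theta> q)"
      using dense[of "F (\<theta> p)" "F (\<theta> q)"] strict_monoD[OF F_mono pq(4)] by blast
    obtain \<phi>2 where \<phi>2: "F (\<theta> p') < \<phi>2" "\<phi>2 < F (\<theta> q')"
      using dense[of "F (\<theta> p')" "F (\<theta> q')"] strict_monoD[OF F_mono pq'(4)] by blast
    have "F (\<theta> q) \<le> F (\<theta> p')" using qp by (simp add: strict_mono_less_eq[OF F_mono])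
    then have "\<phi>1 \<le> \<phi>2" using \<phi>1 \<phi>2 by simp
    then have "X \<phi>1 = X \<phi>2" using gapF[OF \<phi>1(1) \<phi>2(2)] by (rule X_gap)
    moreover have "X \<phi>1 \<le> q" using cluster_at_X(3)[OF r(2) \<phi>1(2)] .
    moreover have "p' \<le> X \<phi>2" using cluster_at_X(4)[OF r(3) \<phi>2(1)] .
    ultimately show False using pq pq' by simp
  qed
  then obtain z1 z2 \<phi> where z: "z1 < z2" "\<And>y. z1 < y \<Longrightarrow> y < z2 \<Longrightarrow> cluster_at x y \<phi>" by blast
  define c where "c = (z1 + z2) / 2"
  have c: "z1 < c" "c < z2" using z by (auto simp: c_def)
  \<comment> \<open>The one-sided lemmas require \<open>X (F \<phi>)\<close> to lie outside the open
    interval of cluster values; since it lies on one side of the midpoint, one half of the interval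
    qualifies.\<close>
  show False
  proof (cases "X (F \<phi>) \<le> c")
    case True
    then show ?thesis using no_right_cluster[OF c(2), of x \<phi>] z c by force
  next
    case False
    then show ?thesis using no_left_cluster[OF c(1), of x \<phi>] z c by force
  qed
qed

lemma cluster_subsequence:
  assumes s: "\<And>n. s n \<in> HP" "s \<longlonglongrightarrow> of_real x"
  obtains r y where "strict_mono (r :: nat \<Rightarrow> nat)" "(\<lambda>n. G (s (r n))) \<longlonglongrightarrow> of_real y" "cluster x y"
proof -
  obtain B where B: "\<And>s. s \<in> HP \<Longrightarrow> \<bar>Re s\<bar> \<le> \<bar>x\<bar> + 1 \<Longrightarrow> Im s \<le> 1 \<Longrightarrow> cmod (G s) \<le> B" using G_bounded by blast
  have re: "(\<lambda>n. Re (s n)) \<longlonglongrightarrow> x" and im: "(\<lambda>n. Im (s n)) \<longlonglongrightarrow> 0"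
    using tendsto_Re[OF s(2)] tendsto_Im[OF s(2)] by auto
  have evr: "eventually (\<lambda>n. \<bar>Re (s n)\<bar> \<le> \<bar>x\<bar> + 1) sequentially"
    using tendstoD[OF re, of 1] by (auto simp: dist_real_def elim!: eventually_mono)
  moreover have "eventually (\<lambda>n. Im (s n) < 1) sequentially" using im by (auto intro: order_tendstoD)
  ultimately have "eventually (\<lambda>n. cmod (G (s n)) \<le> B) sequentially"
    by eventually_elim (use B s(1) in auto)
  then obtain N where N: "\<And>n. n \<ge> N \<Longrightarrow> cmod (G (s n)) \<le> B" unfolding eventually_sequentially by blast
  have "bounded (range (\<lambda>n. G (s (n + N))))" unfolding bounded_iff
    by (intro exI[of _ B]) (use N in auto)
  then obtain l r where r: "strict_mono r" "((\<lambda>n. G (s (n + N))) \<circ> r) \<longlonglongrightarrow> l"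
    using bounded_imp_convergent_subsequence by blast
  define r' where "r' = (\<lambda>n. r n + N)"
  have r': "strict_mono r'" using r(1) by (simp add: r'_def strict_mono_def)
  have l: "(\<lambda>n. G (s (r' n))) \<longlonglongrightarrow> l" using r(2) by (simp add: r'_def o_def)
  have "(\<lambda>n. Im (G (s n))) \<longlonglongrightarrow> 0"
  proof (rule tendstoI)
    fix e :: real assume "e > 0"
    then obtain d where d: "d > 0" "\<And>s. s \<in> HP \<Longrightarrow> \<bar>Re s\<bar> \<le> \<bar>x\<bar> + 1 \<Longrightarrow> Im s < d \<Longrightarrow> Im (G s) < e"
      using G_Im_small[of e "\<bar>x\<bar> + 1"] by blast
    have "eventually (\<lambda>n. Im (s n) < d) sequentially" using im d(1) by (auto intro: order_tendstoD)
    with evr show "eventually (\<lambda>n. dist (Im (G (s n))) 0 < e) sequentially"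
    proof eventually_elim
      case (elim n)
      then show ?case using d(2)[OF s(1)] G_HP[OF s(1), of n] by simp
    qed
  qed
  then have "((\<lambda>n. Im (G (s n))) \<circ> r') \<longlonglongrightarrow> 0" using r' by (rule LIMSEQ_subseq_LIMSEQ)
  then have "(\<lambda>n. Im (G (s (r' n)))) \<longlonglongrightarrow> 0" by (simp add: o_def)
  then have "Im l = 0" by (rule LIMSEQ_unique[OF tendsto_Im[OF l]])
  then have l': "l = of_real (Re l)" by (simp add: complex_eq_iff)
  have "cluster x (Re l)"
    unfolding cluster_def
  proof (intro allI impI)
    fix e :: real assume e: "e > 0"
    have "(\<lambda>n. s (r' n)) \<longlonglongrightarrow> of_real x" using LIMSEQ_subseq_LIMSEQ[OF s(2) r'] by (simp add: o_def)
    from tendstoD[OF this e] tendstoD[OF l e]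
    have "eventually (\<lambda>n. cmod (s (r' n) - of_real x) < e \<and> cmod (G (s (r' n)) - of_real (Re l)) < e) sequentially"
      by eventually_elim (simp add: dist_norm flip: l')
    then show "\<exists>s\<in>HP. cmod (s - of_real x) < e \<and> cmod (G s - of_real (Re l)) < e"
      using s(1) eventually_happens'[OF sequentially_bot] by blast
  qed
  then show thesis using that[OF r', of "Re l"] l l' by simp
qed

text \<open>Near the boundary point \<open>G\<close> is bounded and has only one cluster
  value.\<close>

lemma G_limit: "\<exists>y. (G \<longlongrightarrow> of_real y) (at (of_real x) within HP)"
proof -
  have "(\<lambda>n. Complex x (inverse (real (Suc n)))) \<longlonglongrightarrow> Complex x 0"
    by (intro tendsto_Complex tendsto_const LIMSEQ_inverse_real_of_nat)
  then have "(\<lambda>n. Complex x (inverse (real (Suc n)))) \<longlonglongrightarrow> of_real x" by (simp add: complex_of_real_def)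
  then obtain y where y: "cluster x y" using cluster_subsequence[of "\<lambda>n. Complex x (inverse (real (Suc n)))" x] by auto
  have "(G \<longlongrightarrow> of_real y) (at (of_real x) within HP)"
  proof (rule ccontr)
    assume "\<not> ?thesis"
    then obtain e where e: "e > 0" "\<not> eventually (\<lambda>s. dist (G s) (of_real y) < e) (at (of_real x) within HP)"
      unfolding tendsto_iff by blast
    have "\<exists>s. s \<in> HP \<and> dist s (of_real x) < d \<and> \<not> dist (G s) (of_real y) < e" if "d > 0" for d
      using e(2) that unfolding eventually_at by blast
    then have "\<forall>n. \<exists>s. s \<in> HP \<and> dist s (of_real x) < inverse (real (Suc n)) \<and> \<not> dist (G s) (of_real y) < e"
      by simp
    then obtain s where s: "\<And>n. s n \<in> HP" "\<And>n. dist (s n) (of_real x) < inverse (real (Suc n))"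
      "\<And>n. \<not> dist (G (s n)) (of_real y) < e" by metis
    have "s \<longlonglongrightarrow> of_real x"
      by (rule LIMSEQ_norm_0[of "\<lambda>n. s n - of_real x", THEN LIM_zero_cancel])
         (use s(2) in \<open>simp add: inverse_eq_divide dist_norm\<close>)
    then obtain r y' where r: "strict_mono (r :: nat \<Rightarrow> nat)" "(\<lambda>n. G (s (r n))) \<longlonglongrightarrow> of_real y'" "cluster x y'"
      using cluster_subsequence[of s x] s(1) by blast
    have "y' = y" using cluster_unique[OF y r(3)] cluster_unique[OF r(3) y] by simp
    then have "eventually (\<lambda>n. dist (G (s (r n))) (of_real y) < e) sequentially" using tendstoD[OF r(2) e(1)] by simp
    then show False using s(3) eventually_happens'[OF sequentially_bot] by blast
  qed
  then show ?thesis by blast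
qed

section \<open>The boundary homeomorphism\<close>

definition Hb :: "real \<Rightarrow> real" where
  "Hb x = (SOME y. (G \<longlongrightarrow> of_real y) (at (of_real x) within HP))"

lemma Hb: "(G \<longlongrightarrow> of_real (Hb x)) (at (of_real x) within HP)"
  unfolding Hb_def using someI_ex[OF G_limit] .

lemma HbI:
  assumes "\<And>n. s n \<in> HP" "s \<longlonglongrightarrow> of_real x"
  shows "(\<lambda>n. G (s n)) \<longlonglongrightarrow> of_real (Hb x)"
proof -
  have "s n \<noteq> of_real x" for n using assms(1)[of n] by auto
  then have "filterlim s (at (of_real x) within HP) sequentially"
    using assms unfolding filterlim_at by (intro conjI always_eventually) auto
  then show ?thesis by (rule filterlim_compose[OF Hb])
qed

lemma HP_approach: obtains s where "\<And>n. s n \<in> HP" "s \<longlonglongrightarrow> complex_of_real x"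
proof (rule that[of "\<lambda>n. Complex x (inverse (real (Suc n)))"])
  have "(\<lambda>n. Complex x (inverse (real (Suc n)))) \<longlonglongrightarrow> Complex x 0"
    by (intro tendsto_Complex tendsto_const LIMSEQ_inverse_real_of_nat)
  then show "(\<lambda>n. Complex x (inverse (real (Suc n)))) \<longlonglongrightarrow> of_real x" by (simp add: complex_of_real_def)
qed simp

lemma Hb_per: "Hb (x + 1) = Hb x + 1"
proof -
  obtain s where s: "\<And>n. s n \<in> HP" "s \<longlonglongrightarrow> complex_of_real x" using HP_approach by blast
  have "(\<lambda>n. s n + 1) \<longlonglongrightarrow> of_real (x + 1)" using tendsto_add[OF s(2) tendsto_const[of 1]] by simp
  then have "(\<lambda>n. G (s n + 1)) \<longlonglongrightarrow> of_real (Hb (x + 1))" using s(1) by (intro HbI) auto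
  moreover have "(\<lambda>n. G (s n) + 1) \<longlonglongrightarrow> of_real (Hb x) + 1" using HbI[OF s] by (intro tendsto_intros)
  ultimately have "complex_of_real (Hb (x + 1)) = of_real (Hb x) + 1"
    unfolding G_per[OF s(1)] by (rule LIMSEQ_unique)
  then show ?thesis by (metis of_real_1 of_real_add of_real_eq_iff)
qed

lemma cont_Hb: "continuous_on UNIV Hb"
proof -
  have "continuous_on UNIV (\<lambda>x. complex_of_real (Hb x))"
    by (rule continuous_on_boundary_limit[OF Hb])
  then have "continuous_on UNIV (\<lambda>x. Re (complex_of_real (Hb x)))" by (rule continuous_on_Re)
  then show ?thesis by simp
qed

text \<open>The boundary limit of the inverse, taken along \<open>G (s n)\<close>, gives back the
  limit of \<open>s\<close>. This makes \<open>Hb\<close> injective and thereby, being continuous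
  and periodic, strictly increasing.\<close>

lemma Hb_swap: "spike_ext.Hb \<Lambda> \<Psi> k' (Hb x) = x"
proof -
  obtain s where s: "\<And>n. s n \<in> HP" "s \<longlonglongrightarrow> complex_of_real x" using HP_approach by blast
  have "(\<lambda>n. spike_ext.G \<Lambda> \<Psi> k' (G (s n))) \<longlonglongrightarrow> of_real (spike_ext.Hb \<Lambda> \<Psi> k' (Hb x))"
    using G_HP[OF s(1)] HbI[OF s] by (intro spike_ext.HbI[OF swap])
  then have "s \<longlonglongrightarrow> of_real (spike_ext.Hb \<Lambda> \<Psi> k' (Hb x))" by (simp add: G_swap[OF s(1)])
  from LIMSEQ_unique[OF this s(2)] show ?thesis by simp
qed

lemma strict_mono_Hb: "strict_mono Hb"
  by (rule strict_mono_of_inj_periodic[OF cont_Hb _ Hb_per]) (metis Hb_swap)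

lemma cont_ext: "continuous_on {s. Im s \<ge> 0} (\<lambda>s. if Im s > 0 then G s else of_real (Hb (Re s)))"
  by (rule continuous_on_extend_boundary[OF cont_G Hb])

text \<open>A sequence on the level curve of \<open>\<theta>\<close> tends to
  \<open>X \<theta>\<close>, and \<open>G\<close> maps it to the level curve of
  \<open>F \<theta>\<close>. So \<open>X\<close> semiconjugates \<open>F\<close> to
  \<open>Hb\<close> without being continuous.\<close>

lemma Hb_X: "Hb (X \<theta>) = X (F \<theta>)"
proof -
  have ex: "\<exists>s. Re (\<Lambda> (Complex s y)) = \<theta>" if y: "y > 0" for y
  proof -
    define u where "u = \<theta> - V 0 y"
    have "V 0 y + of_int \<lfloor>u\<rfloor> \<le> \<theta>" "\<theta> \<le> V 0 y + of_int (\<lfloor>u\<rfloor> + 1)" unfolding u_def by linarith+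
    then have "V (0 + of_int \<lfloor>u\<rfloor>) y \<le> \<theta>" "\<theta> \<le> V (0 + of_int (\<lfloor>u\<rfloor> + 1)) y"
      unfolding V_per_int[OF y] by auto
    then obtain s where "V s y = \<theta>" using real_IVT_between[OF cont_V[OF y] connected_UNIV] by blast
    then show ?thesis by (auto simp: V_def)
  qed
  then obtain f where f: "\<And>y. y > 0 \<Longrightarrow> Re (\<Lambda> (Complex (f y) y)) = \<theta>" by metis
  define s where "s = (\<lambda>n. Complex (f (inverse (real (Suc n)))) (inverse (real (Suc n))))"
  have s: "s n \<in> HP" "Re (\<Lambda> (s n)) = \<theta>" for n using f by (auto simp: s_def)
  have im: "(\<lambda>n. Im (s n)) \<longlonglongrightarrow> 0" unfolding s_def by (simp only: complex.sel) (rule LIMSEQ_inverse_real_of_nat)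
  have sl: "s \<longlonglongrightarrow> of_real (X \<theta>)"
    by (rule X_squeeze[OF s(1) im, where ?\<theta>1.0 = \<theta> and ?\<theta>2.0 = \<theta>]) (use s in auto)
  have l: "(\<lambda>n. G (s n)) \<longlonglongrightarrow> of_real (Hb (X \<theta>))" by (rule HbI[OF s(1) sl])
  have im': "(\<lambda>n. Im (G (s n))) \<longlonglongrightarrow> 0" using tendsto_Im[OF l] by simp
  have "(\<lambda>n. G (s n)) \<longlonglongrightarrow> of_real (X (F \<theta>))"
    by (rule X_squeeze[OF G_HP[OF s(1)] im', where ?\<theta>1.0 = "F \<theta>" and ?\<theta>2.0 = "F \<theta>"]) (use s in \<open>auto simp: Lam_G[OF s(1)]\<close>)
  from LIMSEQ_unique[OF l this] show ?thesis by simp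
qed

end

subsection \<open>Lifts of Denjoy homeomorphisms\<close>

text \<open>The two-sided comparison of \<open>J\<close> with its translate by \<open>\<tau>\<close> makes the set of jump points of \<open>J\<close>
invariant under this translation, without computing the jumps.\<close>

locale jump_function =
  fixes J :: "real \<Rightarrow> real" and \<tau> \<kappa> \<delta> :: real
  assumes J_mono: "x < y \<Longrightarrow> J x < J y" and J_per: "J (x + 1) = J x + 1"
    and \<kappa>: "\<kappa> > 0"
    and J_lower: "x < y \<Longrightarrow> \<kappa> * (J y - J x) \<le> J (y + \<tau>) - J (x + \<tau>)"
    and J_upper: "x < y \<Longrightarrow> \<kappa> * (J (y + \<tau>) - J (x + \<tau>)) \<le> J y - J x"
    and \<delta>: "\<delta> > 0" and J_jump: "x < 0 \<Longrightarrow> 0 < y \<Longrightarrow> \<delta> \<le> J y - J x"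
    and \<tau>: "\<tau> \<notin> \<rat>"
begin

section \<open>One-sided limits of \<open>J\<close>\<close>

definition lo :: "real \<Rightarrow> real" where "lo y = Sup (J ` {..<y})"
definition hi :: "real \<Rightarrow> real" where "hi y = Inf (J ` {y<..})"

lemma J_le: "x \<le> y \<Longrightarrow> J x \<le> J y" using J_mono less_eq_real_def by auto

lemma lo_upper: "x < y \<Longrightarrow> J x \<le> lo y"
  unfolding lo_def by (rule cSup_upper) (auto simp: bdd_above_def intro: J_le less_imp_le)

lemma lo_least: "(\<And>x. x < y \<Longrightarrow> J x \<le> z) \<Longrightarrow> lo y \<le> z"
  unfolding lo_def by (rule cSup_least) (auto intro: lt_ex)

lemma hi_lower: "y < x \<Longrightarrow> hi y \<le> J x"
  unfolding hi_def by (rule cInf_lower) (auto simp: bdd_below_def intro: J_le less_imp_le)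

lemma hi_greatest: "(\<And>x. y < x \<Longrightarrow> z \<le> J x) \<Longrightarrow> z \<le> hi y"
  unfolding hi_def by (rule cInf_greatest) (auto intro: gt_ex)

lemma lo_hi: "lo y \<le> hi y"
  by (intro lo_least hi_greatest J_le) simp

lemma hi_lo: assumes "x < y" shows "hi x < lo y"
proof -
  obtain u where u: "x < u" "u < y" using assms dense by blast
  obtain v where v: "u < v" "v < y" using u(2) dense by blast
  show ?thesis using hi_lower[OF u(1)] J_mono[OF v(1)] lo_upper[OF v(2)] by simp
qed

lemma J_per_int: "J (x + of_int k) = J x + of_int k"
  by (rule periodic_int) (rule J_per)

lemma J_bound: "\<bar>J y - y\<bar> \<le> \<bar>J 0\<bar> + 1"
proof -
  have "J (0 + of_int \<lfloor>y\<rfloor>) \<le> J y" "J y \<le> J (0 + of_int (\<lfloor>y\<rfloor> + 1))"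
    by (intro J_le; simp; linarith)+
  then show ?thesis unfolding J_per_int by (simp; linarith)
qed

lemma lo_per: "lo (y + 1) = lo y + 1"
proof (rule antisym)
  show "lo (y + 1) \<le> lo y + 1"
  proof (rule lo_least)
    fix x assume "x < y + 1"
    then show "J x \<le> lo y + 1" using lo_upper[of "x - 1" y] J_per[of "x - 1"] by simp
  qed
  have "lo y \<le> lo (y + 1) - 1"
  proof (rule lo_least)
    fix x assume "x < y"
    then show "J x \<le> lo (y + 1) - 1" using lo_upper[of "x + 1" "y + 1"] J_per[of x] by simp
  qed
  then show "lo y + 1 \<le> lo (y + 1)" by simp
qed

lemma hi_per: "hi (y + 1) = hi y + 1"
proof (rule antisym)
  have "hi (y + 1) - 1 \<le> hi y"
  proof (rule hi_greatest)
    fix x assume "y < x"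
    then show "hi (y + 1) - 1 \<le> J x" using hi_lower[of "y + 1" "x + 1"] J_per[of x] by simp
  qed
  then show "hi (y + 1) \<le> hi y + 1" by simp
  show "hi y + 1 \<le> hi (y + 1)"
  proof (rule hi_greatest)
    fix x assume "y + 1 < x"
    then show "hi y + 1 \<le> J x" using hi_lower[of y "x - 1"] J_per[of "x - 1"] by simp
  qed
qed

text \<open>A generalised inverse of \<open>J\<close>: the intervals from \<open>lo y\<close> to
  \<open>hi y\<close> are disjoint and cover the line, and \<open>c\<close> collapses each of them
  to its \<open>y\<close>. It will semiconjugate \<open>T\<close> to a translation.\<close>

definition c :: "real \<Rightarrow> real" where "c W = Sup {y. J y \<le> W}"

lemma c_bounds: "lo (c W) \<le> W" "W \<le> hi (c W)"
proof -
  have ne: "{y. J y \<le> W} \<noteq> {}"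
  proof -
    have "J (W - (\<bar>J 0\<bar> + 1)) \<le> W" using J_bound[of "W - (\<bar>J 0\<bar> + 1)"] by linarith
    then show ?thesis by blast
  qed
  have bd: "bdd_above {y. J y \<le> W}"
  proof (rule bdd_aboveI)
    fix y assume "y \<in> {y. J y \<le> W}"
    then show "y \<le> W + (\<bar>J 0\<bar> + 1)" using J_bound[of y] by (simp; linarith)
  qed
  show "lo (c W) \<le> W"
  proof (rule lo_least)
    fix x assume "x < c W"
    then obtain y where "x < y" "J y \<le> W" using less_cSupD[OF ne] unfolding c_def by blast
    then show "J x \<le> W" using J_mono by (meson less_imp_le order_trans)
  qed
  show "W \<le> hi (c W)"
  proof (rule hi_greatest)
    fix x assume x: "c W < x"
    show "W \<le> J x"
    proof (rule ccontr)
      assume "\<not> W \<le> J x"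
      then have "x \<le> c W" unfolding c_def by (intro cSup_upper bd) simp
      then show False using x by simp
    qed
  qed
qed

lemma c_eqI: assumes "lo y \<le> W" "W \<le> hi y" shows "c W = y"
proof (rule ccontr)
  assume "c W \<noteq> y"
  then consider "c W < y" | "y < c W" by linarith
  then show False
    using hi_lo[of "c W" y] hi_lo[of y "c W"] c_bounds[of W] assms by cases auto
qed

lemma c_mono: assumes "W \<le> W'" shows "c W \<le> c W'"
proof (rule ccontr)
  assume "\<not> c W \<le> c W'"
  then have "hi (c W') < lo (c W)" by (intro hi_lo) simp
  then show False using c_bounds[of W] c_bounds[of W'] assms by linarith
qed

lemma c_per: "c (W + 1) = c W + 1"
  by (rule c_eqI) (use c_bounds[of W] in \<open>simp_all add: lo_per hi_per\<close>)

lemma c_bound: "\<bar>c W - W\<bar> \<le> \<bar>J 0\<bar> + 2"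
proof -
  have "J (c W - 1) \<le> W" using lo_upper[of "c W - 1" "c W"] c_bounds(1)[of W] by simp
  moreover have "W \<le> J (c W + 1)" using hi_lower[of "c W" "c W + 1"] c_bounds(2)[of W] by simp
  ultimately show ?thesis using J_bound[of "c W - 1"] J_bound[of "c W + 1"] by linarith
qed

section \<open>Jumps along an orbit of the translation\<close>

definition gap :: "real \<Rightarrow> real" where "gap y = hi y - lo y"

lemma gap_nonneg: "gap y \<ge> 0" using lo_hi by (simp add: gap_def)

lemma gap_ge: assumes "\<And>x z. x < y \<Longrightarrow> y < z \<Longrightarrow> d \<le> J z - J x" shows "d \<le> gap y"
proof -
  have "lo y + d \<le> hi y"
  proof (rule hi_greatest)
    fix z assume z: "y < z"
    have "lo y \<le> J z - d" by (rule lo_least) (use assms z in fastforce)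
    then show "lo y + d \<le> J z" by simp
  qed
  then show ?thesis by (simp add: gap_def)
qed

lemma gap_le: "x < y \<Longrightarrow> y < z \<Longrightarrow> gap y \<le> J z - J x"
  using lo_upper hi_lower by (fastforce simp: gap_def)

text \<open>A jump is the infimum of the increments across its point, so the comparison of
  increments passes to jumps.\<close>

lemma gap_lower: "\<kappa> * gap y \<le> gap (y + \<tau>)"
proof (rule gap_ge)
  fix x z assume xz: "x < y + \<tau>" "y + \<tau> < z"
  have "\<kappa> * gap y \<le> \<kappa> * (J (z - \<tau>) - J (x - \<tau>))"
    using xz \<kappa> gap_le[of "x - \<tau>" y "z - \<tau>"] by (intro mult_left_mono) auto
  also have "\<dots> \<le> J z - J x" using J_lower[of "x - \<tau>" "z - \<tau>"] xz by simp
  finally show "\<kappa> * gap y \<le> J z - J x" .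
qed

lemma gap_upper: "\<kappa> * gap (y + \<tau>) \<le> gap y"
proof (rule gap_ge)
  fix x z assume xz: "x < y" "y < z"
  have "\<kappa> * gap (y + \<tau>) \<le> \<kappa> * (J (z + \<tau>) - J (x + \<tau>))"
    using xz \<kappa> gap_le[of "x + \<tau>" "y + \<tau>" "z + \<tau>"] by (intro mult_left_mono) auto
  also have "\<dots> \<le> J z - J x" using J_upper[of x z] xz by simp
  finally show "\<kappa> * gap (y + \<tau>) \<le> J z - J x" .
qed

lemma gap_iff: "gap (y + \<tau>) = 0 \<longleftrightarrow> gap y = 0"
proof
  assume "gap (y + \<tau>) = 0"
  then have "\<kappa> * gap y \<le> 0" using gap_lower[of y] by simp
  then show "gap y = 0" using \<kappa> gap_nonneg[of y] by (simp add: mult_le_0_iff)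
next
  assume "gap y = 0"
  then have "\<kappa> * gap (y + \<tau>) \<le> 0" using gap_upper[of y] by simp
  then show "gap (y + \<tau>) = 0" using \<kappa> gap_nonneg[of "y + \<tau>"] by (simp add: mult_le_0_iff)
qed

lemma gap_pos_orbit: "gap (real n * \<tau> + of_int k) > 0"
proof -
  have "gap 0 > 0" using gap_ge[of 0 \<delta>] J_jump \<delta> by force
  then have "gap (real n * \<tau>) \<noteq> 0"
  proof (induction n)
    case (Suc n)
    then show ?case using gap_iff[of "real n * \<tau>"] by (simp add: algebra_simps)
  qed simp
  moreover have "gap (y + of_int k) = gap y" for y
  proof (induction k rule: int_induct[of _ 0])
    case (step1 i)
    then show ?case by (simp add: gap_def lo_per hi_per flip: add.assoc)
  next
    case (step2 i)
    then show ?case using lo_per[of "y + of_int (i - 1)"] hi_per[of "y + of_int (i - 1)"]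
      by (simp add: gap_def algebra_simps)
  qed simp
  ultimately show ?thesis using gap_nonneg[of "real n * \<tau> + of_int k"] by simp
qed

text \<open>The jump at 0 propagates to all points \<open>n \<tau> + k\<close> with \<open>n\<close>
  natural. The density theorem provides a positive multiplier of \<open>\<tau>\<close>, which stays
  in this forward orbit.\<close>

lemma gap_dense: assumes "x < y" obtains z where "x < z" "z < y" "gap z > 0"
proof -
  have e: "(y - x) / 2 > 0" using assms by simp
  obtain h k where k: "k > 0" "\<bar>of_int k * \<tau> - of_int h - (x + y) / 2\<bar> < (y - x) / 2"
    by (rule sequence_of_fractional_parts_is_dense[OF \<tau> e])
  have kn: "of_int k = real (nat k)" using k(1) by simp
  show thesis
  proof (rule that[of "real (nat k) * \<tau> + of_int (- h)"])
    show "gap (real (nat k) * \<tau> + of_int (- h)) > 0" by (rule gap_pos_orbit)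
    show "x < real (nat k) * \<tau> + of_int (- h)" "real (nat k) * \<tau> + of_int (- h) < y"
      using k(2) unfolding kn by (simp_all add: abs_less_iff field_simps)
  qed
qed

text \<open>Where \<open>J\<close> does not jump, \<open>gap (c W) = 0\<close> and the quotient has the value 0.\<close>

definition T :: "real \<Rightarrow> real \<Rightarrow> real" where
  "T \<sigma> W = lo (c W + \<sigma>) + (W - lo (c W)) / gap (c W) * gap (c W + \<sigma>)"

context
  fixes \<sigma> :: real
  assumes g\<sigma>: "\<And>y. gap (y + \<sigma>) = 0 \<longleftrightarrow> gap y = 0"
begin

lemma T_bounds: "lo (c W + \<sigma>) \<le> T \<sigma> W" "T \<sigma> W \<le> hi (c W + \<sigma>)"
proof -
  let ?r = "(W - lo (c W)) / gap (c W)"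
  have r: "0 \<le> ?r" "?r \<le> 1"
    using c_bounds[of W] gap_nonneg[of "c W"] by (auto simp: gap_def divide_le_eq_1)
  have "0 \<le> ?r * gap (c W + \<sigma>)" by (intro mult_nonneg_nonneg r gap_nonneg)
  moreover have "?r * gap (c W + \<sigma>) \<le> 1 * gap (c W + \<sigma>)" using r gap_nonneg by (intro mult_right_mono) auto
  ultimately show "lo (c W + \<sigma>) \<le> T \<sigma> W" "T \<sigma> W \<le> hi (c W + \<sigma>)"
    by (simp_all add: T_def gap_def)
qed

lemma c_T: "c (T \<sigma> W) = c W + \<sigma>"
  using c_eqI T_bounds by blast

lemma T_strict_mono: "strict_mono (T \<sigma>)"
proof (rule strict_monoI)
  fix W W' :: real assume lt: "W < W'"
  then have "c W \<le> c W'" by (intro c_mono) simp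
  then consider "c W < c W'" | "c W = c W'" by linarith
  then show "T \<sigma> W < T \<sigma> W'"
  proof cases
    case 1
    then show ?thesis using hi_lo[of "c W + \<sigma>" "c W' + \<sigma>"] T_bounds(2)[of W] T_bounds(1)[of W'] by simp
  next
    case 2
    have "gap (c W) \<noteq> 0"
    proof
      assume "gap (c W) = 0"
      then show False using c_bounds[of W] c_bounds[of W'] 2 lt by (simp add: gap_def)
    qed
    then have "gap (c W) > 0" "gap (c W + \<sigma>) > 0"
      using gap_nonneg[of "c W"] gap_nonneg[of "c W + \<sigma>"] g\<sigma> by (auto simp: less_le)
    then show ?thesis using lt 2 by (simp add: T_def divide_strict_right_mono)
  qed
qed

text \<open>The context covers \<open>\<tau>\<close> and \<open>- \<tau>\<close> alike, as both
  preserve the set of jump points. \<open>T \<sigma>\<close> maps the interval collapsed to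
  \<open>y\<close> affinely onto the one collapsed to \<open>y + \<sigma>\<close>; a degenerate
  interval is the single point \<open>lo (c W) = W\<close>.\<close>

lemma T_inverse: "T (- \<sigma>) (T \<sigma> W) = W"
proof -
  have "T (- \<sigma>) (T \<sigma> W) = lo (c W) + (T \<sigma> W - lo (c W + \<sigma>)) / gap (c W + \<sigma>) * gap (c W)"
    by (simp add: T_def[of "- \<sigma>"] c_T)
  also have "\<dots> = W"
  proof (cases "gap (c W) = 0")
    case True
    then show ?thesis using c_bounds[of W] by (simp add: gap_def)
  next
    case False
    then have "gap (c W + \<sigma>) \<noteq> 0" using g\<sigma> by simp
    then show ?thesis using False by (simp add: T_def)
  qed
  finally show ?thesis .
qed

lemma T_per: "T \<sigma> (W + 1) = T \<sigma> W + 1"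
proof -
  have e: "c (W + 1) + \<sigma> = c W + \<sigma> + 1" by (simp add: c_per)
  show ?thesis unfolding T_def e by (simp add: c_per gap_def lo_per hi_per)
qed

lemma T_interior:
  assumes "lo (c W) < W" "W < hi (c W)"
  shows "lo (c (T \<sigma> W)) < T \<sigma> W" "T \<sigma> W < hi (c (T \<sigma> W))"
proof -
  have g: "gap (c W) > 0" using assms by (simp add: gap_def)
  then have g': "gap (c W + \<sigma>) > 0" using gap_nonneg[of "c W + \<sigma>"] g\<sigma>[of "c W"] by simp
  let ?r = "(W - lo (c W)) / gap (c W)"
  have r: "0 < ?r" "?r < 1" using assms g by (auto simp: gap_def)
  have "0 < ?r * gap (c W + \<sigma>)" using r g' by (intro mult_pos_pos)
  moreover have "?r * gap (c W + \<sigma>) < 1 * gap (c W + \<sigma>)" using r g' by (intro mult_strict_right_mono) auto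
  ultimately show "lo (c (T \<sigma> W)) < T \<sigma> W" "T \<sigma> W < hi (c (T \<sigma> W))"
    unfolding c_T by (simp_all add: T_def gap_def)
qed

end

lemma gap_iff': "gap (y + - \<tau>) = 0 \<longleftrightarrow> gap y = 0"
  using gap_iff[of "y + - \<tau>"] by simp

text \<open>The complement of the open jump intervals. Their end points belong to \<open>C\<close>,
  which is therefore closed.\<close>

definition C :: "real set" where "C = {W. \<not> (lo (c W) < W \<and> W < hi (c W))}"

lemma closed_C: "closed C"
proof -
  have "- C = (\<Union>y. {lo y<..<hi y})"
  proof (intro set_eqI iffI)
    fix W assume "W \<in> - C"
    then have "W \<in> {lo (c W)<..<hi (c W)}" by (simp add: C_def)
    then show "W \<in> (\<Union>y. {lo y<..<hi y})" by blast
  next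
    fix W assume "W \<in> (\<Union>y. {lo y<..<hi y})"
    then obtain y where y: "lo y < W" "W < hi y" by auto
    then have "c W = y" by (intro c_eqI) auto
    then show "W \<in> - C" using y by (simp add: C_def)
  qed
  moreover have "open (\<Union>y. {lo y<..<hi y})" by (intro open_UN ballI open_greaterThanLessThan)
  ultimately show ?thesis by (simp add: closed_def)
qed

lemma C_ne: "lo 0 \<in> C"
  by (simp add: C_def c_eqI[OF order_refl lo_hi])

lemma C_per: "W + 1 \<in> C \<longleftrightarrow> W \<in> C"
  by (simp add: C_def c_per lo_per hi_per)

lemma C_T: "T \<tau> W \<in> C \<longleftrightarrow> W \<in> C"
proof -
  have "T (- \<tau>) (T \<tau> W) = W" by (rule T_inverse) (rule gap_iff)
  then show ?thesis
    using T_interior[OF gap_iff, of W] T_interior[OF gap_iff', of "T \<tau> W"] unfolding C_def by auto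
qed

text \<open>Either \<open>a\<close> and \<open>b\<close> lie in one jump interval, or a jump point
  lies strictly between \<open>c a\<close> and \<open>c b\<close> by density.\<close>

lemma C_nd: assumes "a < b" shows "\<exists>x. a < x \<and> x < b \<and> x \<notin> C"
proof -
  have "\<exists>y. gap y > 0 \<and> max a (lo y) < min b (hi y)"
  proof (cases "c a = c b")
    case True
    then show ?thesis using c_bounds[of a] c_bounds[of b] assms
      by (intro exI[of _ "c a"]) (auto simp: gap_def)
  next
    case False
    then have "c a < c b" using c_mono[of a b] assms by simp
    then obtain z where z: "c a < z" "z < c b" "gap z > 0" using gap_dense by blast
    have "a < lo z" "hi z < b"
      using hi_lo[OF z(1)] hi_lo[OF z(2)] c_bounds[of a] c_bounds[of b] by simp_all
    then show ?thesis using z by (intro exI[of _ z]) (auto simp: gap_def)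
  qed
  then obtain y where y: "max a (lo y) < min b (hi y)" by blast
  then obtain x where x: "max a (lo y) < x" "x < min b (hi y)" using dense by blast
  then have "c x = y" by (intro c_eqI) auto
  then have "x \<notin> C" using x by (simp add: C_def)
  then show ?thesis using x by auto
qed

end

lemma strict_mono_surj_imp_continuous:
  fixes f :: "real \<Rightarrow> real"
  assumes f: "strict_mono f" and inv: "\<And>x. f (g x) = x"
  shows "continuous_on UNIV f"
  unfolding continuous_on_iff
proof (intro ballI allI impI)
  fix x e :: real assume e: "e > 0"
  define d where "d = min (x - g (f x - e)) (g (f x + e) - x)"
  have "g (f x - e) < x" "x < g (f x + e)"
    using strict_mono_less[OF f, of "g (f x - e)" x] strict_mono_less[OF f, of x "g (f x + e)"] e by (simp_all add: inv)
  then have "d > 0" by (simp add: d_def)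
  moreover have "dist (f y) (f x) < e" if "dist y x < d" for y
  proof -
    have "g (f x - e) < y" "y < g (f x + e)" using that by (auto simp: d_def dist_real_def abs_less_iff)
    then show ?thesis
      using strict_monoD[OF f, of "g (f x - e)" y] strict_monoD[OF f, of y "g (f x + e)"]
      by (simp add: inv dist_real_def abs_less_iff)
  qed
  ultimately show "\<exists>d>0. \<forall>y\<in>UNIV. dist y x < d \<longrightarrow> dist (f y) (f x) < e" by blast
qed

section \<open>A strictly increasing function with jumps along an orbit\<close>

lemma summable_geometric_int: "(\<lambda>n::int. (1/2) ^ nat \<bar>n\<bar> :: real) summable_on UNIV"
proof -
  have s: "(\<lambda>n::nat. (1/2) ^ n :: real) summable_on UNIV"
    by (rule norm_summable_imp_summable_on) simp
  have 1: "(\<lambda>n::int. (1/2) ^ nat \<bar>n\<bar> :: real) summable_on (range int)"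
    by (subst summable_on_reindex) (use s in \<open>auto simp: o_def\<close>)
  have 2: "(\<lambda>n::int. (1/2) ^ nat \<bar>n\<bar> :: real) summable_on (range (\<lambda>n. - int n))"
    by (subst summable_on_reindex) (use s in \<open>auto simp: o_def inj_def\<close>)
  have "(UNIV :: int set) = range int \<union> (range (\<lambda>n. - int n) - range int)"
  proof -
    have "x \<in> range int \<union> range (\<lambda>n. - int n)" for x
      by (cases x rule: int_cases2) auto
    then show ?thesis by blast
  qed
  moreover have "(\<lambda>n::int. (1/2) ^ nat \<bar>n\<bar> :: real) summable_on (range int \<union> (range (\<lambda>n. - int n) - range int))"
    by (intro summable_on_Un_disjoint 1 summable_on_subset_banach[OF 2]) auto
  ultimately show ?thesis by simp
qed

text \<open>Up to normalisation, \<open>J y\<close> is \<open>y\<close> plus a sum over all integers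
  \<open>n\<close> of the weight \<open>w n\<close> times a step function with jumps at
  \<open>n \<tau>\<close> modulo 1. The linear term makes \<open>J\<close> strictly increasing.
  Translation by \<open>\<tau>\<close> shifts the index by 1, and neighbouring weights differ at
  most by the factor 2, whence the constant 1/2.\<close>

lemma jump_function_exists:
  fixes \<tau> :: real assumes \<tau>: "\<tau> \<notin> \<rat>"
  obtains J \<delta> where "jump_function J \<tau> (1/2) \<delta>"
proof -
  define w where "w = (\<lambda>n::int. (1/2) ^ nat \<bar>n\<bar> :: real)"
  have w0: "w n > 0" for n by (simp add: w_def)
  have ws: "w summable_on UNIV" unfolding w_def by (rule summable_geometric_int)
  have w1: "w (n + 1) \<le> 2 * w n" "w n \<le> 2 * w (n + 1)" for n
  proof -
    have "nat \<bar>n\<bar> \<le> Suc (nat \<bar>n + 1\<bar>)" "nat \<bar>n + 1\<bar> \<le> Suc (nat \<bar>n\<bar>)" by linarith+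
    then have "(1/2::real) ^ Suc (nat \<bar>n + 1\<bar>) \<le> (1/2) ^ nat \<bar>n\<bar>" "(1/2::real) ^ Suc (nat \<bar>n\<bar>) \<le> (1/2) ^ nat \<bar>n + 1\<bar>"
      by (intro power_decreasing; simp)+
    then show "w (n + 1) \<le> 2 * w n" "w n \<le> 2 * w (n + 1)" by (simp_all add: w_def)
  qed
  \<comment> \<open>Increments of the step functions, bounded uniformly in \<open>n\<close>, so that
    the weighted sums converge.\<close>
  define d where "d = (\<lambda>x y n. real_of_int (\<lfloor>y - of_int n * \<tau>\<rfloor> - \<lfloor>x - of_int n * \<tau>\<rfloor>))"
  have d0: "d x y n \<ge> 0" if "x \<le> y" for x y n using that by (simp add: d_def floor_mono)
  have dabs: "\<bar>d x y n\<bar> \<le> \<bar>y - x\<bar> + 1" for x y n unfolding d_def by linarith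
  have sd: "(\<lambda>n. w n * d x y n) summable_on UNIV" for x y
  proof (rule Infinite_Sum.abs_summable_summable, rule Infinite_Sum.abs_summable_on_comparison_test')
    show "(\<lambda>n. w n * (\<bar>y - x\<bar> + 1)) summable_on UNIV"
      by (rule summable_on_cmult_left[OF ws])
    show "norm (w n * d x y n) \<le> w n * (\<bar>y - x\<bar> + 1)" for n
      using dabs[where x=x and y=y and n=n] w0[of n] by (simp add: abs_mult)
  qed
  define D where "D = (\<lambda>x y. (y - x) + infsum (\<lambda>n. w n * d x y n) UNIV)"
  have Dadd: "D x z = D x y + D y z" for x y z
  proof -
    have "infsum (\<lambda>n. w n * d x z n) UNIV = infsum (\<lambda>n. w n * d x y n + w n * d y z n) UNIV"
      by (rule infsum_cong) (simp add: d_def algebra_simps)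
    also have "\<dots> = infsum (\<lambda>n. w n * d x y n) UNIV + infsum (\<lambda>n. w n * d y z n) UNIV"
      by (rule infsum_add[OF sd sd])
    finally show ?thesis by (simp add: D_def)
  qed
  have Dpos: "D x y > 0" if "x < y" for x y
  proof -
    have "infsum (\<lambda>n. w n * d x y n) UNIV \<ge> 0"
      using d0[of x y] w0 that by (intro infsum_nonneg mult_nonneg_nonneg) (auto intro: less_imp_le)
    then show ?thesis using that by (simp add: D_def)
  qed
  have Dshift: "D (x + \<tau>) (y + \<tau>) = (y - x) + infsum (\<lambda>n. w (n + 1) * d x y n) UNIV" for x y
  proof -
    have bij: "bij_betw (\<lambda>n::int. n + 1) UNIV UNIV"
      by (rule bij_betwI[of _ _ _ "\<lambda>n. n - 1"]) auto
    have "infsum (\<lambda>n. w n * d (x + \<tau>) (y + \<tau>) n) UNIV = infsum (\<lambda>n. w (n + 1) * d (x + \<tau>) (y + \<tau>) (n + 1)) UNIV"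
      using infsum_reindex_bij_betw[OF bij, of "\<lambda>n. w n * d (x + \<tau>) (y + \<tau>) n"] by simp
    also have "\<dots> = infsum (\<lambda>n. w (n + 1) * d x y n) UNIV"
      by (rule infsum_cong) (simp add: d_def algebra_simps)
    finally show ?thesis by (simp add: D_def)
  qed
  have sd1: "(\<lambda>n. w (n + 1) * d x y n) summable_on UNIV" if "x < y" for x y
  proof (rule summable_on_comparison_test)
    show "(\<lambda>n. 2 * (w n * d x y n)) summable_on UNIV" using sd by (rule summable_on_cmult_right)
    show "w (n + 1) * d x y n \<le> 2 * (w n * d x y n)" for n
      using mult_right_mono[OF w1(1)[of n] d0[of x y n]] that by simp
    show "0 \<le> w (n + 1) * d x y n" for n using w0[of "n + 1"] d0[of x y n] that by simp
  qed
  have low: "(1/2) * D x y \<le> D (x + \<tau>) (y + \<tau>)" if "x < y" for x y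
  proof -
    have "infsum (\<lambda>n. w n * d x y n) UNIV \<le> infsum (\<lambda>n. 2 * (w (n + 1) * d x y n)) UNIV"
    proof (rule infsum_mono[OF sd summable_on_cmult_right[OF sd1[OF that]]])
      show "w n * d x y n \<le> 2 * (w (n + 1) * d x y n)" for n
        using mult_right_mono[OF w1(2)[of n] d0[of x y n]] that by simp
    qed
    then show ?thesis using that unfolding Dshift infsum_cmult_right' by (simp add: D_def)
  qed
  have up: "(1/2) * D (x + \<tau>) (y + \<tau>) \<le> D x y" if "x < y" for x y
  proof -
    have "infsum (\<lambda>n. w (n + 1) * d x y n) UNIV \<le> infsum (\<lambda>n. 2 * (w n * d x y n)) UNIV"
    proof (rule infsum_mono[OF sd1[OF that] summable_on_cmult_right[OF sd]])
      show "w (n + 1) * d x y n \<le> 2 * (w n * d x y n)" for n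
        using mult_right_mono[OF w1(1)[of n] d0[of x y n]] that by simp
    qed
    then show ?thesis using that unfolding Dshift infsum_cmult_right' by (simp add: D_def)
  qed
  define N where "N = 1 + infsum w UNIV"
  have N: "N \<ge> 1" using infsum_nonneg[of UNIV w] w0 by (simp add: N_def less_imp_le)
  have D1: "D x (x + 1) = N" for x
  proof -
    have "d x (x + 1) n = 1" for n
    proof -
      have "\<lfloor>x + 1 - of_int n * \<tau>\<rfloor> = \<lfloor>x - of_int n * \<tau>\<rfloor> + 1" by linarith
      then show ?thesis by (simp add: d_def)
    qed
    then show ?thesis by (simp add: D_def N_def)
  qed
  have jump: "D x y \<ge> 1" if "x < 0" "0 < y" for x y
  proof -
    have "sum (\<lambda>n. w n * d x y n) {0} \<le> infsum (\<lambda>n. w n * d x y n) UNIV"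
      using that d0[of x y] w0 by (intro finite_sum_le_infsum[OF sd]) (auto intro!: mult_nonneg_nonneg simp: less_imp_le)
    moreover have "w 0 * d x y 0 \<ge> 1"
    proof -
      have "\<lfloor>x\<rfloor> \<le> -1" "\<lfloor>y\<rfloor> \<ge> 0" using that by (simp_all add: floor_le_iff)
      then have "1 \<le> \<lfloor>y\<rfloor> - \<lfloor>x\<rfloor>" by linarith
      then have "real_of_int 1 \<le> real_of_int (\<lfloor>y\<rfloor> - \<lfloor>x\<rfloor>)" by (simp only: of_int_le_iff)
      then show ?thesis by (simp add: w_def d_def)
    qed
    ultimately show ?thesis using that by (simp add: D_def)
  qed
  define J where "J = (\<lambda>y. D 0 y / N)"
  have Jd: "J y - J x = D x y / N" for x y
    using Dadd[of 0 y x] by (simp add: J_def add_divide_distrib)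
  have "jump_function J \<tau> (1/2) (1 / N)"
  proof
    show "J x < J y" if "x < y" for x y
    proof -
      have "J y - J x > 0" unfolding Jd using Dpos[OF that] N by (intro divide_pos_pos) auto
      then show ?thesis by simp
    qed
    show "J (x + 1) = J x + 1" for x
    proof -
      have "J (x + 1) - J x = 1" unfolding Jd D1 using N by simp
      then show ?thesis by simp
    qed
    show "1/2 * (J y - J x) \<le> J (y + \<tau>) - J (x + \<tau>)" if "x < y" for x y
      using divide_right_mono[OF low[OF that], of N] N by (simp add: Jd)
    show "1/2 * (J (y + \<tau>) - J (x + \<tau>)) \<le> J y - J x" if "x < y" for x y
      using divide_right_mono[OF up[OF that], of N] N by (simp add: Jd)
    show "1 / N \<le> J y - J x" if "x < 0" "0 < y" for x y
      unfolding Jd using jump[OF that] N by (simp add: divide_right_mono)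
  qed (use N \<tau> in auto)
  then show thesis using that by blast
qed

text \<open>A lift for \<open>m \<tau>\<close> commuting with the translation by 1, conjugated by
  multiplication with \<open>m\<close>, commutes with the translation by \<open>1/m\<close>. The
  function \<open>c\<close>, at bounded distance from the identity and turning \<open>F\<close> into
  the translation by \<open>\<tau>\<close>, records the rotation number.\<close>

lemma denjoy_lift:
  fixes \<tau> :: real and m :: nat
  assumes \<tau>: "\<tau> \<notin> \<rat>" and m: "m \<ge> 1"
  obtains F F' c :: "real \<Rightarrow> real" and C B where
    "strict_mono F" "strict_mono F'" "\<And>x. F' (F x) = x" "\<And>x. F (F' x) = x"
    "\<And>x. F (x + 1 / m) = F x + 1 / m"
    "closed C" "C \<noteq> {}" "\<And>x. x + 1 / m \<in> C \<longleftrightarrow> x \<in> C" "\<And>a b. a < b \<Longrightarrow> \<exists>x. a < x \<and> x < b \<and> x \<notin> C"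
    "\<And>x. F x \<in> C \<longleftrightarrow> x \<in> C" "\<And>x. c (F x) = c x + \<tau>" "\<And>x. \<bar>c x - x\<bar> \<le> B"
proof -
  define \<mu> where "\<mu> = real m"
  have \<mu>: "\<mu> > 0" using m by (simp add: \<mu>_def)
  have "\<mu> * \<tau> \<notin> \<rat>"
  proof
    assume "\<mu> * \<tau> \<in> \<rat>"
    then have "\<mu> * \<tau> / \<mu> \<in> \<rat>" unfolding \<mu>_def by (intro Rats_divide Rats_of_nat)
    then show False using \<mu> \<tau> by simp
  qed
  then obtain J \<delta> where "jump_function J (\<mu> * \<tau>) (1/2) \<delta>" using jump_function_exists by blast
  then interpret j: jump_function J "\<mu> * \<tau>" "1/2" \<delta> .
  let ?T = "j.T (\<mu> * \<tau>)" and ?T' = "j.T (- (\<mu> * \<tau>))"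
  have TT: "?T' (?T x) = x" "?T (?T' x) = x" for x
    using j.T_inverse[of "\<mu> * \<tau>" x, OF j.gap_iff] j.T_inverse[of "- (\<mu> * \<tau>)" x, OF j.gap_iff'] by simp_all
  have sm: "strict_mono ?T" "strict_mono ?T'"
    using j.T_strict_mono[OF j.gap_iff] j.T_strict_mono[OF j.gap_iff'] by simp_all
  have sc: "\<mu> * (x + 1 / m) = \<mu> * x + 1" for x using \<mu> by (simp add: \<mu>_def field_simps)
  show thesis
  proof (rule that[of "\<lambda>x. ?T (\<mu> * x) / \<mu>" "\<lambda>x. ?T' (\<mu> * x) / \<mu>" "(\<lambda>x. \<mu> * x) -` j.C" "\<lambda>x. j.c (\<mu> * x) / \<mu>" "(\<bar>J 0\<bar> + 2) / \<mu>"])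
    show "strict_mono (\<lambda>x. ?T (\<mu> * x) / \<mu>)" "strict_mono (\<lambda>x. ?T' (\<mu> * x) / \<mu>)"
      using sm \<mu> by (auto simp: strict_mono_def divide_strict_right_mono)
    show "?T' (\<mu> * (?T (\<mu> * x) / \<mu>)) / \<mu> = x" "?T (\<mu> * (?T' (\<mu> * x) / \<mu>)) / \<mu> = x" for x
      using TT \<mu> by simp_all
    show "?T (\<mu> * (x + 1 / m)) / \<mu> = ?T (\<mu> * x) / \<mu> + 1 / m" for x
      unfolding sc j.T_per[OF j.gap_iff] by (simp add: add_divide_distrib \<mu>_def)
    show "closed ((\<lambda>x. \<mu> * x) -` j.C)"
      by (intro closed_vimage j.closed_C continuous_intros)
    show "(\<lambda>x. \<mu> * x) -` j.C \<noteq> {}"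
    proof -
      have "j.lo 0 / \<mu> \<in> (\<lambda>x. \<mu> * x) -` j.C" using j.C_ne \<mu> by simp
      then show ?thesis by blast
    qed
    show "x + 1 / m \<in> (\<lambda>x. \<mu> * x) -` j.C \<longleftrightarrow> x \<in> (\<lambda>x. \<mu> * x) -` j.C" for x
      by (simp add: sc j.C_per)
    show "\<exists>x. a < x \<and> x < b \<and> x \<notin> (\<lambda>x. \<mu> * x) -` j.C" if "a < b" for a b
    proof -
      have "\<mu> * a < \<mu> * b" using that \<mu> by simp
      then obtain x where "\<mu> * a < x" "x < \<mu> * b" "x \<notin> j.C" using j.C_nd by blast
      then show ?thesis using \<mu> by (intro exI[of _ "x / \<mu>"]) (simp add: field_simps)
    qed
    show "?T (\<mu> * x) / \<mu> \<in> (\<lambda>x. \<mu> * x) -` j.C \<longleftrightarrow> x \<in> (\<lambda>x. \<mu> * x) -` j.C" for x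
      using \<mu> by (simp add: j.C_T)
    show "j.c (\<mu> * (?T (\<mu> * x) / \<mu>)) / \<mu> = j.c (\<mu> * x) / \<mu> + \<tau>" for x
      using \<mu> j.c_T[OF j.gap_iff] by (simp add: add_divide_distrib)
    show "\<bar>j.c (\<mu> * x) / \<mu> - x\<bar> \<le> (\<bar>J 0\<bar> + 2) / \<mu>" for x
    proof -
      have "j.c (\<mu> * x) / \<mu> - x = (j.c (\<mu> * x) - \<mu> * x) / \<mu>" using \<mu> by (simp add: field_simps)
      then show ?thesis using j.c_bound[of "\<mu> * x"] \<mu> by (simp add: abs_divide divide_right_mono)
    qed
  qed
qed

subsection \<open>Maps of the plane in logarithmic coordinates\<close>

definition cexp :: "complex \<Rightarrow> complex" where
  "cexp w = exp (2 * of_real pi * \<i> * w)"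

definition cln :: "complex \<Rightarrow> complex" where
  "cln z = Ln z / (2 * of_real pi * \<i>)"

lemma cexp_nonzero [simp]: "cexp w \<noteq> 0"
  by (simp add: cexp_def)

lemma cexp_cln [simp]: "z \<noteq> 0 \<Longrightarrow> cexp (cln z) = z"
  by (simp add: cexp_def cln_def)

lemma norm_cexp: "cmod (cexp w) = exp (- 2 * pi * Im w)"
  by (simp add: cexp_def norm_exp_eq_Re)

lemma cexp_add: "cexp (v + w) = cexp v * cexp w"
  by (simp add: cexp_def distrib_left exp_add)

lemma cexp_of_int [simp]: "cexp (of_int n) = 1"
  by (simp add: cexp_def exp_eq_1 mult_ac)

lemma cexp_eq: "cexp v = cexp w \<longleftrightarrow> (\<exists>n::int. v = w + of_int n)"
proof
  assume "cexp v = cexp w"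
  then obtain n :: int where "2 * of_real pi * \<i> * v = 2 * of_real pi * \<i> * w + (of_int (2 * n) * of_real pi) * \<i>"
    unfolding cexp_def exp_eq by auto
  then have "2 * of_real pi * \<i> * v = 2 * of_real pi * \<i> * (w + of_int n)" by (simp add: algebra_simps)
  then show "\<exists>n::int. v = w + of_int n" by (auto simp: mult_left_cancel)
qed (auto simp: cexp_add)

lemma cexp_of_real: "cexp (of_real x) = circ x"
  by (simp add: cexp_def circ_def cis_conv_exp mult_ac)

lemma circ_add: "circ (x + y) = circ x * circ y"
  by (simp add: circ_def distrib_left cis_mult)

lemma circ_eq: "circ x = circ y \<longleftrightarrow> (\<exists>n::int. x = y + of_int n)"
proof -
  have "complex_of_real x = of_real y + of_int n \<longleftrightarrow> x = y + of_int n" for n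
    by (metis of_real_add of_real_eq_iff of_real_of_int_eq)
  then show ?thesis unfolding cexp_of_real[symmetric] cexp_eq by simp
qed

lemma cont_cexp: "continuous_on S f \<Longrightarrow> continuous_on S (\<lambda>x. cexp (f x))"
  unfolding cexp_def by (intro continuous_intros)

text \<open>Dividing by \<open>z0\<close> moves the cut of the logarithm away from
  \<open>z0\<close>.\<close>

lemma cexp_local_section:
  assumes z0: "z0 \<noteq> 0"
  obtains N f where "open N" "z0 \<in> N" "continuous_on N f" "\<And>z. z \<in> N \<Longrightarrow> cexp (f z) = z"
proof (rule that[of "{z. z / z0 \<notin> \<real>\<^sub>\<le>\<^sub>0}" "\<lambda>z. cln z0 + cln (z / z0)"])
  have "open ((\<lambda>z. z / z0) -` (- \<real>\<^sub>\<le>\<^sub>0))"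
    by (intro open_vimage open_Compl closed_nonpos_Reals_complex continuous_intros) (use z0 in auto)
  then show "open {z. z / z0 \<notin> \<real>\<^sub>\<le>\<^sub>0}" by (simp add: vimage_def)
  show "z0 \<in> {z. z / z0 \<notin> \<real>\<^sub>\<le>\<^sub>0}" using z0 by simp
  show "continuous_on {z. z / z0 \<notin> \<real>\<^sub>\<le>\<^sub>0} (\<lambda>z. cln z0 + cln (z / z0))"
    unfolding cln_def by (intro continuous_intros) (use z0 in auto)
  fix z assume "z \<in> {z. z / z0 \<notin> \<real>\<^sub>\<le>\<^sub>0}"
  then have "z \<noteq> 0" by auto
  then show "cexp (cln z0 + cln (z / z0)) = z" using z0 by (simp add: cexp_add)
qed

text \<open>\<open>cln\<close> jumps across its cut, but for \<open>\<kappa>\<close> commuting with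
  the translation by 1 the result does not depend on the branch.\<close>

definition descend :: "(complex \<Rightarrow> complex) \<Rightarrow> complex \<Rightarrow> complex" where
  "descend \<kappa> z = (if z = 0 then 0 else cexp (\<kappa> (cln z)))"

lemma descend_0 [simp]: "descend \<kappa> 0 = 0"
  by (simp add: descend_def)

lemma descend_cexp:
  assumes "\<And>w. \<kappa> (w + 1) = \<kappa> w + 1" shows "descend \<kappa> (cexp w) = cexp (\<kappa> w)"
proof -
  have "cexp (cln (cexp w)) = cexp w" by simp
  then obtain n :: int where "cln (cexp w) = w + of_int n" unfolding cexp_eq by blast
  then show ?thesis using periodic_int[of \<kappa>, OF assms] by (simp add: descend_def cexp_add)
qed

lemma descend_compose:
  assumes "\<And>w. \<kappa> (w + 1) = \<kappa> w + 1" shows "descend \<kappa> (descend \<kappa>' z) = descend (\<lambda>w. \<kappa> (\<kappa>' w)) z"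
  by (cases "z = 0") (auto simp: descend_cexp[where \<kappa> = \<kappa>, OF assms] descend_def[of \<kappa>'] descend_def[of "\<lambda>w. \<kappa> (\<kappa>' w)"])

lemma descend_id: "descend (\<lambda>w. w) z = z"
  by (simp add: descend_def)

lemma descend_inj:
  assumes per: "\<And>w. \<kappa> (w + 1) = \<kappa> w + 1" and inj: "inj \<kappa>" and eq: "descend \<kappa> z = descend \<kappa> z'"
  shows "z = z'"
proof (cases "z = 0 \<or> z' = 0")
  case True
  then show ?thesis using eq by (auto simp: descend_def split: if_splits)
next
  case False
  then have "cexp (\<kappa> (cln z)) = cexp (\<kappa> (cln z'))" using eq by (simp add: descend_def)
  then obtain n :: int where "\<kappa> (cln z) = \<kappa> (cln z') + of_int n" unfolding cexp_eq by blast
  then have "\<kappa> (cln z) = \<kappa> (cln z' + of_int n)" using periodic_int[of \<kappa>, OF per] by simp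
  then have "cln z = cln z' + of_int n" using inj by (simp add: inj_eq)
  then have "cexp (cln z) = cexp (cln z')" unfolding cexp_eq by blast
  then show ?thesis using False by simp
qed

text \<open>Away from 0 a local section of \<open>cexp\<close> replaces \<open>cln\<close>. At 0 the
  condition \<open>top\<close> gives a bound by a multiple of \<open>sqrt (cmod z)\<close>; its
  factor 1/2 accommodates the inverse of squaring. The parameter \<open>s\<close> serves the isotopy
  used for the orientation.\<close>

lemma continuous_on_descend_family:
  fixes K :: "real \<Rightarrow> complex \<Rightarrow> complex"
  assumes cK: "continuous_on (S \<times> UNIV) (\<lambda>p. K (fst p) (snd p))"
    and per: "\<And>s w. s \<in> S \<Longrightarrow> K s (w + 1) = K s w + 1"
    and top: "\<And>s w. s \<in> S \<Longrightarrow> a \<le> Im w \<Longrightarrow> (Im w - a) / 2 \<le> Im (K s w)"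
  shows "continuous_on (S \<times> UNIV) (\<lambda>p. descend (K (fst p)) (snd p))"
  unfolding continuous_on_eq_continuous_within
proof
  fix p0 :: "real \<times> complex" assume p0: "p0 \<in> S \<times> UNIV"
  obtain s0 z0 where sz: "p0 = (s0, z0)" by force
  let ?f = "\<lambda>p. descend (K (fst p)) (snd p)"
  show "continuous (at p0 within S \<times> UNIV) ?f"
  proof (cases "z0 = 0")
    case False
    obtain N wf where oN: "open N" and z0N: "z0 \<in> N" and cN: "continuous_on N wf"
      and wf: "\<And>z. z \<in> N \<Longrightarrow> cexp (wf z) = z"
      using cexp_local_section[OF False] by metis
    have cwf: "continuous_on (S \<times> N) (\<lambda>p. wf (snd p))"
      by (rule continuous_on_compose2[OF cN]) (auto intro: continuous_intros)
    have "continuous_on (S \<times> N) (\<lambda>p. cexp (K (fst p) (wf (snd p))))"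
    proof (rule cont_cexp)
      have "continuous_on (S \<times> N) (\<lambda>p. (fst p, wf (snd p)))" by (intro continuous_intros cwf)
      then show "continuous_on (S \<times> N) (\<lambda>p. K (fst p) (wf (snd p)))"
        using continuous_on_compose2[OF cK, of "S \<times> N" "\<lambda>p. (fst p, wf (snd p))"] by fastforce
    qed
    moreover have "cexp (K (fst p) (wf (snd p))) = ?f p" if "p \<in> S \<times> N" for p
      using that descend_cexp[of "K (fst p)" "wf (snd p)", OF per] wf[of "snd p"] by auto
    ultimately have "continuous_on (S \<times> N) ?f" by (simp cong: continuous_on_cong)
    then have "continuous (at p0 within S \<times> N) ?f"
      using p0 sz z0N by (auto simp: continuous_on_eq_continuous_within)
    moreover have "at p0 within S \<times> N = at p0 within S \<times> UNIV"
      by (rule at_within_nhd[of _ "UNIV \<times> N"]) (use z0N sz oN in \<open>auto intro: open_Times\<close>)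
    ultimately show ?thesis by (simp add: continuous_within)
  next
    case True
    have b: "cmod (?f p) \<le> sqrt (cmod (snd p)) * exp (pi * a)"
      if p: "fst p \<in> S" "cmod (snd p) \<le> exp (- 2 * pi * a)" for p
    proof (cases "snd p = 0")
      case False
      define w where "w = cln (snd p)"
      have zw: "snd p = cexp w" using False by (simp add: w_def)
      have "exp (- 2 * pi * Im w) \<le> exp (- 2 * pi * a)" using p(2) by (simp only: zw norm_cexp)
      then have "a \<le> Im w" by simp
      then have "(Im w - a) / 2 \<le> Im (K (fst p) w)" using top p(1) by blast
      then have "- 2 * pi * Im (K (fst p) w) \<le> - 2 * pi * ((Im w - a) / 2)"
        by (intro mult_left_mono_neg) auto
      then have "exp (- 2 * pi * Im (K (fst p) w)) \<le> exp (- pi * Im w + pi * a)" by (simp add: algebra_simps)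
      also have "\<dots> = exp (- pi * Im w) * exp (pi * a)" by (rule exp_add)
      also have "exp (- pi * Im w) = sqrt (cmod (snd p))"
        unfolding zw norm_cexp by (rule real_sqrt_unique[symmetric]) (simp_all flip: exp_double)
      finally have "cmod (cexp (K (fst p) w)) \<le> sqrt (cmod (snd p)) * exp (pi * a)" by (simp only: norm_cexp)
      moreover have "?f p = cexp (K (fst p) w)" unfolding zw by (rule descend_cexp) (use per p in auto)
      ultimately show ?thesis by simp
    qed simp
    have "(?f \<longlongrightarrow> 0) (at p0 within S \<times> UNIV)"
    proof (rule Lim_null_comparison)
      have "((\<lambda>p. cmod (snd p)) \<longlongrightarrow> cmod (snd p0)) (at p0 within S \<times> UNIV)"
        by (intro tendsto_intros)
      then have l: "((\<lambda>p. cmod (snd p)) \<longlongrightarrow> 0) (at p0 within S \<times> UNIV)" using sz True by simp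
      then have "eventually (\<lambda>p. cmod (snd p) < exp (- 2 * pi * a)) (at p0 within S \<times> UNIV)"
        by (rule order_tendstoD) simp
      moreover have "eventually (\<lambda>p. p \<in> S \<times> UNIV) (at p0 within S \<times> UNIV)"
        by (simp add: eventually_at_filter)
      ultimately show "eventually (\<lambda>p. cmod (?f p) \<le> sqrt (cmod (snd p)) * exp (pi * a)) (at p0 within S \<times> UNIV)"
        by eventually_elim (use b in auto)
      have "((\<lambda>p. sqrt (cmod (snd p)) * exp (pi * a)) \<longlongrightarrow> sqrt 0 * exp (pi * a)) (at p0 within S \<times> UNIV)"
        by (intro tendsto_intros l)
      then show "((\<lambda>p. sqrt (cmod (snd p)) * exp (pi * a)) \<longlongrightarrow> 0) (at p0 within S \<times> UNIV)" by simp
    qed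
    then show ?thesis using sz True by (simp add: continuous_within)
  qed
qed

lemma continuous_on_descend:
  assumes c: "continuous_on UNIV \<kappa>" and per: "\<And>w. \<kappa> (w + 1) = \<kappa> w + 1"
    and top: "\<And>w. a \<le> Im w \<Longrightarrow> (Im w - a) / 2 \<le> Im (\<kappa> w)"
  shows "continuous_on UNIV (descend \<kappa>)"
proof -
  have "continuous_on ({0} \<times> UNIV) (\<lambda>p::real \<times> complex. descend \<kappa> (snd p))"
  proof (rule continuous_on_descend_family[where K = "\<lambda>_. \<kappa>" and a = a])
    show "continuous_on ({0} \<times> UNIV) (\<lambda>p::real \<times> complex. \<kappa> (snd p))"
      by (auto intro!: continuous_on_compose2[OF c] continuous_intros)
  qed (rule per, rule top)
  then have "continuous_on UNIV (\<lambda>z. descend \<kappa> (snd (0::real, z)))"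
    by (rule continuous_on_compose2) (auto intro!: continuous_intros)
  then show ?thesis by simp
qed

text \<open>Along an isotopy of injective maps the image of a circle never meets the image of its
  centre. The translated loop is thus homotopic in the punctured plane to the original circle and
  has winding number 1; a continuous logarithm then provides the angle.\<close>

lemma orientation_preserving_descend:
  fixes K :: "real \<Rightarrow> complex \<Rightarrow> complex"
  assumes cK: "continuous_on ({0..1} \<times> UNIV) (\<lambda>p. K (fst p) (snd p))"
    and per: "\<And>s w. s \<in> {0..1} \<Longrightarrow> K s (w + 1) = K s w + 1"
    and top: "\<And>s w. s \<in> {0..1} \<Longrightarrow> a \<le> Im w \<Longrightarrow> (Im w - a) / 2 \<le> Im (K s w)"
    and inj: "\<And>s. s \<in> {0..1} \<Longrightarrow> inj (K s)" and K0: "\<And>w. K 0 w = w"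
  shows "orientation_preserving (descend (K 1))"
  unfolding orientation_preserving_def
proof (intro allI impI)
  fix p :: complex and r :: real assume r: "r > 0"
  define g where "g = (\<lambda>x. descend (K (fst x)) (p + of_real r * circ (snd x)) - descend (K (fst x)) p)"
  have cf: "continuous_on ({0..1} \<times> UNIV) (\<lambda>q. descend (K (fst q)) (snd q))"
    by (rule continuous_on_descend_family[OF cK per top])
  have cg: "continuous_on ({0..1} \<times> {0..1}) g"
  proof -
    have "continuous_on ({0..1} \<times> {0..1}) (\<lambda>x::real\<times>real. (fst x, p + of_real r * circ (snd x)))"
      unfolding circ_def cis_conv_exp by (intro continuous_intros)
    moreover have "continuous_on ({0..1} \<times> {0..1}) (\<lambda>x::real\<times>real. (fst x, p))" by (intro continuous_intros)
    ultimately have "continuous_on ({0..1} \<times> {0..1}) (\<lambda>x. descend (K (fst x)) (p + of_real r * circ (snd x)))"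
      "continuous_on ({0..1} \<times> {0..1}) (\<lambda>x::real\<times>real. descend (K (fst x)) p)"
      using continuous_on_compose2[OF cf, of "{0..1} \<times> {0..1}" "\<lambda>x::real\<times>real. (fst x, p + of_real r * circ (snd x))"]
        continuous_on_compose2[OF cf, of "{0..1} \<times> {0..1}" "\<lambda>x::real\<times>real. (fst x, p)"] by force+
    then show ?thesis unfolding g_def by (intro continuous_intros)
  qed
  have gne: "g x \<noteq> 0" if "fst x \<in> {0..1}" for x
  proof
    assume "g x = 0"
    then have eq: "descend (K (fst x)) (p + of_real r * circ (snd x)) = descend (K (fst x)) p" by (simp add: g_def)
    have "p + of_real r * circ (snd x) = p"
      by (rule descend_inj[OF per[OF that] inj[OF that] eq])
    then show False using r by (simp add: circ_def)
  qed
  have c01: "circ 0 = 1" "circ 1 = 1" by (simp_all add: circ_def complex_eq_iff)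
  define \<gamma> where "\<gamma> = (\<lambda>t. g (1, t))"
  have hl: "homotopic_loops (- {0}) (circlepath 0 r) \<gamma>"
    unfolding homotopic_loops
  proof (intro exI[of _ g] conjI ballI)
    show "continuous_on ({0..1} \<times> {0..1}) g" by fact
    show "g \<in> {0..1} \<times> {0..1} \<rightarrow> - {0}" using gne by auto
    show "g (0, t) = circlepath 0 r t" for t
    proof -
      have "descend (K 0) z = z" for z using descend_id[of z] K0 by (simp add: descend_def)
      then show ?thesis by (simp add: g_def circlepath circ_def cis_conv_exp mult_ac)
    qed
    show "g (1, t) = \<gamma> t" for t by (simp add: \<gamma>_def)
    show "pathfinish (g \<circ> Pair t) = pathstart (g \<circ> Pair t)" for t
      by (simp add: pathfinish_def pathstart_def g_def c01)
  qed
  have w1: "winding_number \<gamma> 0 = 1"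
    using winding_number_homotopic_loops[OF hl] winding_number_circlepath_centre[OF r, of 0] by simp
  have "path \<gamma>" using homotopic_loops_imp_path[OF hl] by simp
  moreover have "0 \<notin> path_image \<gamma>" using homotopic_loops_imp_subset[OF hl] by auto
  ultimately obtain q where q: "path q" "pathfinish q - pathstart q = 2 * of_real pi * \<i> * winding_number \<gamma> 0"
    "\<And>t. t \<in> {0..1} \<Longrightarrow> \<gamma> t = 0 + exp (q t)"
    using winding_number_as_continuous_log by blast
  show "\<exists>\<theta>. continuous_on {0..1} \<theta> \<and>
        (\<forall>t\<in>{0..1}. descend (K 1) (p + of_real r * circ t) - descend (K 1) p
          = of_real (cmod (descend (K 1) (p + of_real r * circ t) - descend (K 1) p)) * circ (\<theta> t)) \<and>
        \<theta> 1 - \<theta> 0 = 1"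
  proof (intro exI[of _ "\<lambda>t. Im (q t) / (2 * pi)"] conjI ballI)
    show "continuous_on {0..1} (\<lambda>t. Im (q t) / (2 * pi))"
      using q(1) unfolding path_def by (intro continuous_intros) auto
    have "Im (q 1 - q 0) = 2 * pi" using q(2) w1 by (simp add: pathfinish_def pathstart_def)
    then show "Im (q 1) / (2 * pi) - Im (q 0) / (2 * pi) = 1" by (simp add: diff_divide_distrib[symmetric])
    fix t :: real assume t: "t \<in> {0..1}"
    have "\<gamma> t = of_real (cmod (\<gamma> t)) * circ (Im (q t) / (2 * pi))"
      unfolding q(3)[OF t] by (simp add: norm_mult circ_def exp_eq_polar exp_of_real)
    then show "descend (K 1) (p + of_real r * circ t) - descend (K 1) p
          = of_real (cmod (descend (K 1) (p + of_real r * circ t) - descend (K 1) p)) * circ (Im (q t) / (2 * pi))"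
      by (simp add: \<gamma>_def g_def)
  qed
qed

lemma infdist_real_shift:
  fixes C :: "real set"
  assumes "\<And>x. x + a \<in> C \<longleftrightarrow> x \<in> C" shows "infdist (x + a) C = infdist x C"
proof (cases "C = {}")
  case False
  have eq: "C = (\<lambda>c. c + a) ` C"
  proof (intro set_eqI iffI)
    fix c assume "c \<in> C"
    then have "c - a \<in> C" using assms[of "c - a"] by simp
    then show "c \<in> (\<lambda>c. c + a) ` C" by (intro image_eqI[of _ _ "c - a"]) auto
  qed (use assms in auto)
  have "infdist (x + a) C = (INF c\<in>C. dist (x + a) c)" using False by (simp add: infdist_def)
  also have "\<dots> = (INF c\<in>(\<lambda>c. c + a) ` C. dist (x + a) c)" using eq by simp
  also have "\<dots> = (INF c\<in>C. dist (x + a) (c + a))" by (simp add: image_image)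
  also have "\<dots> = infdist x C" using False by (simp add: infdist_def)
  finally show ?thesis .
qed (simp add: infdist_def)

subsection \<open>The admissible map\<close>

locale denjoy_data =
  fixes F F' c :: "real \<Rightarrow> real" and C :: "real set" and B \<tau> :: real and m :: nat
  assumes F_mono: "strict_mono F" and F'_mono: "strict_mono F'"
    and F'F [simp]: "F' (F x) = x" and FF' [simp]: "F (F' x) = x"
    and F_per_m: "F (x + 1 / m) = F x + 1 / m" and m: "m \<ge> 1"
    and C_closed: "closed C" and C_ne: "C \<noteq> {}" and C_per_m: "x + 1 / m \<in> C \<longleftrightarrow> x \<in> C"
    and C_nd: "a < b \<Longrightarrow> \<exists>x. a < x \<and> x < b \<and> x \<notin> C"
    and F_C: "F x \<in> C \<longleftrightarrow> x \<in> C" and c_F: "c (F x) = c x + \<tau>" and c_bound: "\<bar>c x - x\<bar> \<le> B"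
    and \<tau>: "\<tau> \<notin> \<rat>"
begin

lemma cont_F: "continuous_on UNIV F" and cont_F': "continuous_on UNIV F'"
  using strict_mono_surj_imp_continuous F_mono F'_mono F'F FF' by blast+

lemma F_per_mn: "F (x + real n / m) = F x + real n / m"
proof (induction n)
  case (Suc n)
  then show ?case using F_per_m[of "x + real n / m"] by (simp add: add_divide_distrib ac_simps)
qed simp

lemma C_per_mn: "x + real n / m \<in> C \<longleftrightarrow> x \<in> C"
proof (induction n)
  case (Suc n)
  then show ?case using C_per_m[of "x + real n / m"] by (simp add: add_divide_distrib ac_simps)
qed simp

lemma F_per: "F (x + 1) = F x + 1" using F_per_mn[of x m] m by simp
lemma C_per: "x + 1 \<in> C \<longleftrightarrow> x \<in> C" using C_per_mn[of x m] m by simp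

lemma F'_per_m: "F' (x + 1 / m) = F' x + 1 / m"
  using F_per_m[of "F' x"] by (metis F'F FF')

lemma F'_C: "F' x \<in> C \<longleftrightarrow> x \<in> C" using F_C[of "F' x"] by simp

text \<open>The distance to \<open>C\<close> itself may shrink too fast along an orbit of
  \<open>F\<close>. Summing over the backward orbit with weights \<open>(2/3)^n\<close> gives
  \<open>d (F x) \<ge> 2/3 * d x\<close>, while \<open>d\<close> still vanishes exactly on the
  invariant set \<open>C\<close>.\<close>

definition d :: "real \<Rightarrow> real" where
  "d x = (\<Sum>n. (2/3) ^ n * min 1 (infdist ((F' ^^ n) x) C))"

lemma d_term: "0 \<le> (2/3) ^ n * min 1 (infdist y C)" "(2/3) ^ n * min 1 (infdist y C) \<le> (2/3::real) ^ n"
  by (simp_all add: infdist_nonneg mult_left_le)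

lemma d_summable: "summable (\<lambda>n. (2/3) ^ n * min 1 (infdist ((F' ^^ n) x) C))"
  by (rule summable_comparison_test'[of "\<lambda>n. (2/3) ^ n" 0]) (use d_term in auto)

lemma d_nonneg: "0 \<le> d x"
  unfolding d_def by (rule suminf_nonneg[OF d_summable]) (rule d_term)

lemma d_le: "d x \<le> 3"
proof -
  have "d x \<le> (\<Sum>n. (2/3) ^ n)" unfolding d_def by (rule suminf_le[OF _ d_summable]) (use d_term in auto)
  then show ?thesis by (simp add: suminf_geometric)
qed

lemma d_F: "d (F x) = min 1 (infdist (F x) C) + 2/3 * d x"
proof -
  let ?f = "\<lambda>n. (2/3) ^ n * min 1 (infdist ((F' ^^ n) (F x)) C)"
  have "d (F x) = ?f 0 + (\<Sum>n. ?f (Suc n))"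
    unfolding d_def using suminf_split_head[OF d_summable[of "F x"]] by simp
  also have "(\<Sum>n. ?f (Suc n)) = (\<Sum>n. 2/3 * ((2/3) ^ n * min 1 (infdist ((F' ^^ n) x) C)))"
    by (simp add: funpow_Suc_right mult.assoc del: funpow.simps)
  also have "\<dots> = 2/3 * d x" unfolding d_def by (rule suminf_mult[OF d_summable])
  finally show ?thesis by simp
qed

lemma d_F_ge: "d (F x) \<ge> 2/3 * d x"
  unfolding d_F by (simp add: infdist_nonneg)

lemma d_zero_iff: "d x = 0 \<longleftrightarrow> x \<in> C"
proof
  assume "x \<in> C"
  then have "(F' ^^ n) x \<in> C" for n by (induction n) (auto simp: F'_C)
  then show "d x = 0" unfolding d_def by simp
next
  assume "d x = 0"
  have "min 1 (infdist (F (F' x)) C) \<le> d (F (F' x))" unfolding d_F using d_nonneg by simp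
  then have "min 1 (infdist x C) \<le> 0" using \<open>d x = 0\<close> by simp
  then have "infdist x C = 0" using infdist_nonneg[of x C] by (auto simp: min_def split: if_splits)
  then show "x \<in> C" using in_closed_iff_infdist_zero[OF C_closed C_ne] by simp
qed

lemma d_pos: "x \<notin> C \<Longrightarrow> d x > 0"
  using d_nonneg[of x] d_zero_iff[of x] by simp

lemma d_per_m: "d (x + 1 / m) = d x"
proof -
  have "(F' ^^ n) (x + 1 / m) = (F' ^^ n) x + 1 / m" for n
    by (induction n) (simp_all add: F'_per_m)
  then show ?thesis unfolding d_def by (simp add: infdist_real_shift C_per_m)
qed

lemma cont_d: "continuous_on UNIV d"
proof -
  have c: "continuous_on UNIV (F' ^^ n)" for n
  proof (induction n)
    case (Suc n)
    then show ?case using continuous_on_compose2[OF cont_F' Suc] by (simp add: o_def)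
  qed (simp add: id_def[symmetric])
  have "uniform_limit UNIV (\<lambda>n x. \<Sum>i<n. (2/3) ^ i * min 1 (infdist ((F' ^^ i) x) C)) d sequentially"
    unfolding d_def
    by (rule Weierstrass_m_test[where M = "\<lambda>n. (2/3) ^ n"]) (use d_term in auto)
  then show ?thesis
    by (rule uniform_limit_theorem[rotated])
       (auto intro!: always_eventually continuous_intros c)
qed

text \<open>In the coordinate \<open>v = - ln r / (2 \<pi>)\<close> this is \<open>r\<close> to \<open>r^2\<close> inside and to the square root outside the unit disc.\<close>

definition A :: "real \<Rightarrow> real" where "A v = max (2 * v) (v / 2)"
definition A' :: "real \<Rightarrow> real" where "A' v = min (2 * v) (v / 2)"

lemma A'_A [simp]: "A' (A v) = v" and A_A' [simp]: "A (A' v) = v"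
  by (auto simp: A_def A'_def max_def min_def field_simps)

lemma A_mono: "u < v \<Longrightarrow> A u < A v"
  by (auto simp: A_def max_def)

text \<open>A skew product over \<open>F\<close>. A larger imaginary part means closer to the
  origin, so the nonnegative term \<open>d\<close> pushes inwards.\<close>

definition k :: "complex \<Rightarrow> complex" where
  "k w = Complex (F (Re w)) (A (Im w) + d (Re w))"

definition k' :: "complex \<Rightarrow> complex" where
  "k' w = Complex (F' (Re w)) (A' (Im w - d (F' (Re w))))"

lemma k'k [simp]: "k' (k w) = w" and kk' [simp]: "k (k' w) = w"
  by (simp_all add: k_def k'_def complex_eq_iff)

lemma cont_k: "continuous_on UNIV k"
  unfolding k_def A_def Complex_eq
  by (intro continuous_intros continuous_on_compose2[OF cont_F] continuous_on_compose2[OF cont_d]) auto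

lemma cont_k': "continuous_on UNIV k'"
  unfolding k'_def A'_def Complex_eq
  by (intro continuous_intros continuous_on_compose2[OF cont_F'] continuous_on_compose2[OF cont_d]) auto

lemma k_per_m: "k (w + of_real (1 / m)) = k w + of_real (1 / m)"
  by (simp add: k_def complex_eq_iff F_per_m[simplified] d_per_m[simplified])

lemma k_per_mn: "k (w + of_real (real n / m)) = k w + of_real (real n / m)"
proof (induction n)
  case (Suc n)
  have e: "w + of_real (real (Suc n) / m) = (w + of_real (real n / m)) + of_real (1 / m)"
    by (simp add: complex_eq_iff add_divide_distrib)
  show ?case unfolding e k_per_m Suc by (simp add: complex_eq_iff add_divide_distrib)
qed simp

lemma k_per: "k (w + 1) = k w + 1" using k_per_mn[of w m] m by simp
lemma k'_per: "k' (w + 1) = k' w + 1" by (metis k_per k'k kk')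

lemma k_cleft: "k w \<in> cleft C \<longleftrightarrow> w \<in> cleft C"
proof (cases "Re w \<in> C")
  case True
  then have "d (Re w) = 0" by (simp add: d_zero_iff)
  then show ?thesis using True by (auto simp: k_def F_C A_def max_def)
qed (simp add: k_def F_C)

lemma A_ge: "A v \<ge> 2 * v" "0 \<le> v \<Longrightarrow> v \<le> A v" by (auto simp: A_def)

definition h :: "complex \<Rightarrow> complex" where "h = descend k"

lemma h_0 [simp]: "h 0 = 0" by (simp add: h_def)

lemma h_cexp: "h (cexp w) = cexp (k w)" unfolding h_def by (rule descend_cexp) (rule k_per)

lemma h_funpow_0: "(h ^^ n) 0 = 0" by (induction n) auto

lemma h_funpow: "(h ^^ n) (cexp w) = cexp ((k ^^ n) w)"
  by (induction n) (auto simp: h_cexp)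

lemma h_homeo: "homeomorphism UNIV UNIV h (descend k')"
proof (rule homeomorphismI)
  show "continuous_on UNIV h" unfolding h_def
  proof (rule continuous_on_descend[where a = 0, OF cont_k k_per])
    fix w :: complex assume "0 \<le> Im w"
    then show "(Im w - 0) / 2 \<le> Im (k w)" using A_ge(2)[of "Im w"] d_nonneg[of "Re w"] by (simp add: k_def)
  qed
  \<comment> \<open>The value 3 is the bound \<open>d_le\<close>, the sum of the geometric series
    with ratio 2/3.\<close>
  show "continuous_on UNIV (descend k')"
  proof (rule continuous_on_descend[where a = 3, OF cont_k' k'_per])
    fix w :: complex assume "3 \<le> Im w"
    then show "(Im w - 3) / 2 \<le> Im (k' w)" using d_le[of "F' (Re w)"] by (simp add: k'_def A'_def min_def)
  qed
  show "descend k' (h x) = x" for x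
    unfolding h_def descend_compose[where \<kappa> = k', OF k'_per] by (simp add: descend_id)
  show "h (descend k' y) = y" for y
    unfolding h_def descend_compose[where \<kappa> = k, OF k_per] by (simp add: descend_id)
qed auto

definition K :: "real \<Rightarrow> complex \<Rightarrow> complex" where
  "K s w = of_real (1 - s) * w + of_real s * k w"

text \<open>The segment from the identity to \<open>k\<close> is an isotopy: convex combinations of
  strictly increasing functions are injective, first in the real part and then, over equal real
  parts where \<open>d\<close> cancels, in the imaginary part.\<close>

lemma h_orientation: "orientation_preserving h"
proof -
  have "orientation_preserving (descend (K 1))"
  proof (rule orientation_preserving_descend[where K = K and a = 0])
    show "continuous_on ({0..1} \<times> UNIV) (\<lambda>p. K (fst p) (snd p))"
      unfolding K_def by (intro continuous_intros continuous_on_compose2[OF cont_k]) auto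
    show "K s (w + 1) = K s w + 1" for s w
      unfolding K_def k_per by (simp add: algebra_simps)
    show "K 0 w = w" for w by (simp add: K_def)
    fix s :: real assume s: "s \<in> {0..1}"
    show "(Im w - 0) / 2 \<le> Im (K s w)" if w: "0 \<le> Im w" for w
    proof -
      have "Im w \<le> Im (k w)" using A_ge(2)[OF w] d_nonneg[of "Re w"] by (simp add: k_def)
      then have "s * Im w \<le> s * Im (k w)" using s by (intro mult_left_mono) auto
      then have "(1 - s) * Im w + s * Im w \<le> Im (K s w)" by (simp add: K_def)
      then show ?thesis using w by (simp add: algebra_simps)
    qed
    have mono: "(1 - s) * u + s * f u < (1 - s) * v + s * f v" if "u < v" "f u < f v" for u v and f :: "real \<Rightarrow> real"
    proof (cases "s = 1")
      case False
      then have "(1 - s) * u < (1 - s) * v" using s that by simp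
      moreover have "s * f u \<le> s * f v" using s that by (intro mult_left_mono) auto
      ultimately show ?thesis by simp
    qed (use that in simp)
    show "inj (K s)"
    proof (rule injI)
      fix w w' assume eq: "K s w = K s w'"
      then have e: "(1 - s) * Re w + s * F (Re w) = (1 - s) * Re w' + s * F (Re w')"
        by (simp add: K_def k_def complex_eq_iff)
      have re: "Re w = Re w'"
        using mono[where f = F, of "Re w" "Re w'"] mono[where f = F, of "Re w'" "Re w"] e strict_monoD[OF F_mono]
        by (metis less_irrefl linorder_neqE_linordered_idom)
      have e2: "(1 - s) * Im w + s * A (Im w) = (1 - s) * Im w' + s * A (Im w')"
        using eq re by (simp add: K_def k_def complex_eq_iff distrib_left)
      have "Im w = Im w'"
        using mono[where f = A, of "Im w" "Im w'"] mono[where f = A, of "Im w'" "Im w"] e2 A_mono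
        by (metis less_irrefl linorder_neqE_linordered_idom)
      then show "w = w'" using re by (simp add: complex_eq_iff)
    qed
  qed
  moreover have "K 1 = k" by (rule ext) (simp add: K_def)
  ultimately show ?thesis by (simp add: h_def)
qed

section \<open>Orbits and the basin of attraction\<close>

lemma k_funpow_Re: "Re ((k ^^ n) w) = (F ^^ n) (Re w)"
  by (induction n) (simp_all add: k_def)

lemma k_funpow_cleft: "(k ^^ n) w \<in> cleft C \<longleftrightarrow> w \<in> cleft C"
proof (induction n)
  case (Suc n)
  then show ?case using k_cleft[of "(k ^^ n) w"] by simp
qed simp

lemma k_funpow_Im_pos: "0 \<le> Im w \<Longrightarrow> 2 ^ n * Im w \<le> Im ((k ^^ n) w)"
proof (induction n)
  case (Suc n)
  have "2 * (2 ^ n * Im w) \<le> 2 * Im ((k ^^ n) w)" using Suc by simp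
  also have "\<dots> \<le> Im (k ((k ^^ n) w))" using A_ge(1) d_nonneg by (simp add: k_def add_increasing2)
  finally show ?case by simp
qed simp

lemma d_funpow: "(2/3) ^ n * d x \<le> d ((F ^^ n) x)"
proof (induction n)
  case (Suc n)
  have "(2/3) ^ Suc n * d x = 2/3 * ((2/3) ^ n * d x)" by simp
  also have "\<dots> \<le> 2/3 * d ((F ^^ n) x)" using Suc by (intro mult_left_mono) auto
  also have "\<dots> \<le> d (F ((F ^^ n) x))" by (rule d_F_ge)
  finally show ?case by simp
qed simp

text \<open>Off \<open>C\<close> the displacement \<open>d\<close> decays at most like \<open>(2/3)^n\<close> along an orbit, more slowly than the
contraction \<open>(1/2)^n\<close> of the outer region, so the orbit enters the unit disc.\<close>

lemma enters_disc:
  assumes w: "w \<in> cleft C" shows "\<exists>n. Im ((k ^^ n) w) > 0"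
proof (cases "Im w > 0")
  case True
  then show ?thesis by (intro exI[of _ 0]) simp
next
  case False
  then have dp: "d (Re w) > 0" using w d_pos by simp
  show ?thesis
  proof (rule ccontr)
    assume "\<not> ?thesis"
    then have neg: "Im ((k ^^ n) w) \<le> 0" for n by (meson not_less)
    \<comment> \<open>While the orbit stays outside the disc, each step halves the height and adds
      \<open>d\<close>. After multiplication by \<open>2^n\<close> the gain per step is at least
      \<open>2 * (4/3)^n * d (Re w)\<close>, hence at least \<open>2 * d (Re w)\<close>.\<close>
    have "Im w + 2 * real n * d (Re w) \<le> 2 ^ n * Im ((k ^^ n) w)" for n
    proof (induction n)
      case (Suc n)
      have "(1::real) \<le> (4/3) ^ n" by (rule one_le_power) simp
      then have "1 * d (Re w) \<le> (4/3) ^ n * d (Re w)" using dp by (intro mult_right_mono) auto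
      also have "\<dots> = 2 ^ n * ((2/3) ^ n * d (Re w))" by (simp flip: power_mult_distrib mult.assoc)
      also have "\<dots> \<le> 2 ^ n * d ((F ^^ n) (Re w))" using d_funpow by (intro mult_left_mono) auto
      finally have 1: "d (Re w) \<le> 2 ^ n * d ((F ^^ n) (Re w))" by simp
      have "A (Im ((k ^^ n) w)) = Im ((k ^^ n) w) / 2" using neg[of n] by (simp add: A_def max_def)
      then have "Im ((k ^^ Suc n) w) = Im ((k ^^ n) w) / 2 + d ((F ^^ n) (Re w))"
        by (simp add: k_def k_funpow_Re)
      then have "2 ^ Suc n * Im ((k ^^ Suc n) w) = 2 ^ n * Im ((k ^^ n) w) + 2 * (2 ^ n * d ((F ^^ n) (Re w)))"
        by (simp add: algebra_simps)
      then show ?case using Suc 1 by (simp add: algebra_simps)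
    qed simp
    then have le: "Im w + 2 * real n * d (Re w) \<le> 0" for n
      using neg[of n] by (meson mult_nonneg_nonpos order_trans zero_le_numeral zero_le_power)
    obtain n where "- Im w / (2 * d (Re w)) < real n" using reals_Archimedean2 by blast
    then have "- Im w < real n * (2 * d (Re w))" using dp by (subst (asm) pos_divide_less_eq) auto
    then show False using le[of n] by simp
  qed
qed

text \<open>Inside the disc each step at least doubles the height, so after entry the moduli are
  dominated by a geometric sequence.\<close>

lemma h_tendsto_0:
  assumes w: "w \<in> cleft C" shows "(\<lambda>n. (h ^^ n) (cexp w)) \<longlonglongrightarrow> 0"
proof -
  obtain N where N: "Im ((k ^^ N) w) > 0" using enters_disc[OF w] by blast
  let ?v = "Im ((k ^^ N) w)"
  have "(\<lambda>n. (h ^^ (n + N)) (cexp w)) \<longlonglongrightarrow> 0"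
  proof (rule Lim_null_comparison[of _ "\<lambda>n. exp (- 2 * pi * ?v) ^ n"])
    show "(\<lambda>n. exp (- 2 * pi * ?v) ^ n) \<longlonglongrightarrow> 0" using N by (intro LIMSEQ_power_zero) simp
    show "eventually (\<lambda>n. cmod ((h ^^ (n + N)) (cexp w)) \<le> exp (- 2 * pi * ?v) ^ n) sequentially"
    proof (rule always_eventually, rule allI)
      fix n
      have "real n * ?v \<le> 2 ^ n * ?v" using N of_nat_less_two_power[of n] by (intro mult_right_mono) (simp_all add: less_imp_le)
      also have "\<dots> \<le> Im ((k ^^ n) ((k ^^ N) w))" using k_funpow_Im_pos N by simp
      also have "(k ^^ n) ((k ^^ N) w) = (k ^^ (n + N)) w" by (simp add: funpow_add)
      finally have "- 2 * pi * Im ((k ^^ (n + N)) w) \<le> - 2 * pi * (real n * ?v)" by (intro mult_left_mono_neg) auto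
      then have "exp (- 2 * pi * Im ((k ^^ (n + N)) w)) \<le> exp (real n * (- 2 * pi * ?v))" by (simp add: algebra_simps)
      then show "cmod ((h ^^ (n + N)) (cexp w)) \<le> exp (- 2 * pi * ?v) ^ n"
        by (simp only: h_funpow norm_cexp exp_of_nat_mult)
    qed
  qed
  then show ?thesis by (rule LIMSEQ_offset)
qed

text \<open>Over \<open>C\<close> the displacement vanishes and \<open>A\<close> halves nonpositive
  heights: such orbits tend to the unit circle without entering the disc, which settles both the
  basin and dissipativity.\<close>

lemma Im_k_funpow_outside:
  assumes w: "w \<notin> cleft C" shows "Im ((k ^^ n) w) = Im w / 2 ^ n"
proof (induction n)
  case (Suc n)
  have nc: "(k ^^ n) w \<notin> cleft C" using w k_funpow_cleft by blast
  then have "d (Re ((k ^^ n) w)) = 0" "Im ((k ^^ n) w) \<le> 0" by (auto simp: d_zero_iff)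
  then have "Im (k ((k ^^ n) w)) = Im ((k ^^ n) w) / 2" by (simp add: k_def A_def max_def)
  then show ?case using Suc by (simp add: mult.commute)
qed simp

lemma basin_eq: "basin h 0 = insert 0 (cexp ` cleft C)"
proof (intro set_eqI iffI)
  fix z assume "z \<in> insert 0 (cexp ` cleft C)"
  then show "z \<in> basin h 0" using h_tendsto_0 by (auto simp: basin_def h_funpow_0)
next
  fix z assume z: "z \<in> basin h 0"
  show "z \<in> insert 0 (cexp ` cleft C)"
  proof (cases "z = 0")
    case False
    define w where "w = cln z"
    have zw: "z = cexp w" using False by (simp add: w_def)
    have "w \<in> cleft C"
    proof (rule ccontr)
      assume nw: "w \<notin> cleft C"
      have "1 \<le> cmod ((h ^^ n) z)" for n
        using nw unfolding zw h_funpow norm_cexp Im_k_funpow_outside[OF nw] by (simp add: mult_le_0_iff divide_le_0_iff)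
      moreover have "(\<lambda>n. cmod ((h ^^ n) z)) \<longlonglongrightarrow> 0"
        using z tendsto_norm_zero by (auto simp: basin_def)
      ultimately have "(1::real) \<le> 0" by (intro tendsto_lowerbound[where f = "\<lambda>n. cmod ((h ^^ n) z)"]) auto
      then show False by simp
    qed
    then show ?thesis using zw by blast
  qed simp
qed

lemma cexp_cleft: "cexp w \<in> cexp ` cleft C \<longleftrightarrow> w \<in> cleft C"
proof
  assume "cexp w \<in> cexp ` cleft C"
  then obtain w' where w': "w' \<in> cleft C" "cexp w = cexp w'" by blast
  then obtain n :: int where "w = w' + of_int n" using cexp_eq by blast
  moreover have "x + of_int n \<in> C \<longleftrightarrow> x \<in> C" for x and n :: int
    by (rule periodic_set_int) (rule C_per)
  ultimately show "w \<in> cleft C" using w' by simp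
qed blast

lemma cexp_notin_basin: "w \<notin> cleft C \<Longrightarrow> cexp w \<notin> basin h 0"
  using cexp_cleft by (auto simp: basin_eq)

lemma ball_basin: "ball 0 1 \<subseteq> basin h 0"
proof
  fix z :: complex assume z: "z \<in> ball 0 1"
  show "z \<in> basin h 0"
  proof (cases "z = 0")
    case False
    have "exp (- 2 * pi * Im (cln z)) < 1" using z norm_cexp[of "cln z"] False by simp
    then have "cln z \<in> cleft C" by (simp add: zero_less_mult_iff)
    then have "cexp (cln z) \<in> cexp ` cleft C" by blast
    then show ?thesis using False by (simp add: basin_eq)
  qed (simp add: basin_eq)
qed

lemma h_norm_le: assumes "cmod z \<le> 1" shows "cmod (h z) \<le> cmod z"
proof (cases "z = 0")
  case False
  define w where "w = cln z"
  have zw: "z = cexp w" using False by (simp add: w_def)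
  have "exp (- 2 * pi * Im w) \<le> 1" using assms by (simp only: zw norm_cexp)
  then have "0 \<le> Im w" using pi_gt_zero by (auto simp: zero_le_mult_iff simp del: pi_gt_zero)
  then have "Im w \<le> Im (k w)" using A_ge(2) d_nonneg[of "Re w"] by (fastforce simp: k_def)
  then have "- 2 * pi * Im (k w) \<le> - 2 * pi * Im w" by (intro mult_left_mono_neg) auto
  then show ?thesis unfolding zw h_cexp norm_cexp by (simp only: exp_le_cancel_iff)
qed simp

lemma h_stable: "asymp_stable_fixed h 0"
  unfolding asymp_stable_fixed_def
proof (intro conjI allI impI)
  show "0 \<in> interior (basin h 0)" using ball_basin by (intro interiorI[of "ball 0 1"]) auto
  fix \<epsilon> :: real assume e: "\<epsilon> > 0"
  show "\<exists>\<delta>>0. \<forall>x. dist x 0 < \<delta> \<longrightarrow> (\<forall>n. dist ((h ^^ n) x) 0 < \<epsilon>)"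
  proof (intro exI[of _ "min \<epsilon> 1"] conjI allI impI)
    fix x :: complex and n assume x: "dist x 0 < min \<epsilon> 1"
    have "cmod ((h ^^ n) x) \<le> cmod x"
    proof (induction n)
      case (Suc n)
      then have "cmod ((h ^^ n) x) \<le> 1" using x by simp
      then have "cmod (h ((h ^^ n) x)) \<le> cmod ((h ^^ n) x)" by (rule h_norm_le)
      then show ?case using Suc by simp
    qed simp
    then show "dist ((h ^^ n) x) 0 < \<epsilon>" using x by simp
  qed (use e in simp)
qed simp

lemma h_dissipative: "dissipative h"
  unfolding dissipative_def
proof (intro exI[of _ "cball 0 1"] conjI allI)
  fix z :: complex
  show "(\<lambda>n. infdist ((h ^^ n) z) (cball 0 1)) \<longlonglongrightarrow> 0"
  proof (cases "z \<in> basin h 0")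
    case True
    then have l: "(\<lambda>n. (h ^^ n) z) \<longlonglongrightarrow> 0" by (simp add: basin_def)
    show ?thesis
    proof (rule Lim_null_comparison[OF _ tendsto_norm_zero[OF l]])
      show "eventually (\<lambda>n. norm (infdist ((h ^^ n) z) (cball 0 1)) \<le> cmod ((h ^^ n) z)) sequentially"
        using infdist_le[of "0::complex" "cball 0 1"] by (simp add: infdist_nonneg dist_commute always_eventually)
    qed
  next
    case False
    then have "z \<noteq> 0" using ball_basin by (metis centre_in_ball subsetD zero_less_one)
    define w where "w = cln z"
    have zw: "z = cexp w" using \<open>z \<noteq> 0\<close> by (simp add: w_def)
    have nw: "w \<notin> cleft C" using False zw by (auto simp: basin_eq)
    have nz: "cmod ((h ^^ n) z) = exp (- 2 * pi * (Im w / 2 ^ n))" for n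
      unfolding zw h_funpow norm_cexp Im_k_funpow_outside[OF nw] ..
    have n1: "cmod ((h ^^ n) z) \<ge> 1" for n
      using nw unfolding nz by (simp add: mult_le_0_iff divide_le_0_iff)
    show ?thesis
    proof (rule Lim_null_comparison[of _ "\<lambda>n. cmod ((h ^^ n) z) - 1"])
      show "eventually (\<lambda>n. norm (infdist ((h ^^ n) z) (cball 0 1)) \<le> cmod ((h ^^ n) z) - 1) sequentially"
      proof (rule always_eventually, rule allI)
        fix n
        let ?u = "(h ^^ n) z"
        have u: "?u \<noteq> 0" using n1[of n] by auto
        have "infdist ?u (cball 0 1) \<le> dist ?u (?u / of_real (cmod ?u))"
          using u by (intro infdist_le) (simp add: norm_divide)
        also have "\<dots> = cmod (?u / of_real (cmod ?u) * of_real (cmod ?u - 1))"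
          using u by (simp add: dist_norm field_simps)
        also have "\<dots> = cmod ?u - 1" using u n1[of n] by (simp only: norm_mult norm_divide norm_of_real) simp
        finally show "norm (infdist ?u (cball 0 1)) \<le> cmod ?u - 1" by (simp add: infdist_nonneg)
      qed
      have "(\<lambda>n. exp (- 2 * pi * (Im w * (1/2) ^ n)) - 1) \<longlonglongrightarrow> exp (- 2 * pi * (Im w * 0)) - 1"
        by (intro tendsto_intros) simp
      then show "(\<lambda>n. cmod ((h ^^ n) z) - 1) \<longlonglongrightarrow> 0" unfolding nz by (simp add: power_one_over)
    qed
  qed
qed auto

lemma gap_point: obtains x0 where "x0 \<notin> C"
  using C_nd[of 0 1] by auto

lemma h_admissible: "admissible h 0"
  unfolding admissible_def
proof (intro conjI)
  show "\<exists>h'. homeomorphism UNIV UNIV h h'" using h_homeo by blast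
  show "orientation_preserving h" by (rule h_orientation)
  show "dissipative h" by (rule h_dissipative)
  show "asymp_stable_fixed h 0" by (rule h_stable)
  obtain x where "x \<in> C" using C_ne by blast
  then have "cexp (of_real x) \<notin> basin h 0" by (intro cexp_notin_basin) simp
  then show "basin h 0 \<noteq> UNIV" by blast
  obtain x0 where x0: "x0 \<notin> C" using gap_point by blast
  show "\<not> bounded (basin h 0)"
  proof
    assume "bounded (basin h 0)"
    then obtain b where b: "b > 0" "\<And>z. z \<in> basin h 0 \<Longrightarrow> cmod z \<le> b" unfolding bounded_pos by blast
    have "cexp (Complex x0 (- ln (b + 1) / (2 * pi))) \<in> basin h 0" using x0 by (simp add: basin_eq)
    then have "cmod (cexp (Complex x0 (- ln (b + 1) / (2 * pi)))) \<le> b" by (rule b(2))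
    then show False using b(1) by (simp add: norm_cexp)
  qed
qed

lemma h_equivariant: "plane_equivariant m h"
  unfolding plane_equivariant_def
proof (intro allI)
  fix j :: nat and z :: complex
  show "h (circ (real j / real m) * z) = circ (real j / real m) * h z"
  proof (cases "z = 0")
    case False
    define w where "w = cln z"
    have zw: "z = cexp w" using False by (simp add: w_def)
    have "circ (real j / real m) * z = cexp (w + of_real (real j / real m))"
      by (simp add: zw cexp_add cexp_of_real mult.commute del: of_real_divide)
    then have "h (circ (real j / real m) * z) = cexp (k w + of_real (real j / real m))"
      by (simp only: h_cexp k_per_mn)
    then show ?thesis by (simp add: zw h_cexp cexp_add cexp_of_real mult.commute del: of_real_divide)
  qed simp
qed

end

subsection \<open>The circle of prime ends\<close>

lemma holomorphic_cexp: "f holomorphic_on S \<Longrightarrow> (\<lambda>z. cexp (f z)) holomorphic_on S"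
  unfolding cexp_def by (intro holomorphic_intros)

lemma open_cexp_image:
  assumes S: "open S" shows "open (cexp ` S)"
  unfolding open_subopen[of "cexp ` S"]
proof
  fix z assume "z \<in> cexp ` S"
  then obtain w where w: "w \<in> S" "z = cexp w" by blast
  obtain e where e: "e > 0" "ball w e \<subseteq> S" using S w(1) open_contains_ball by blast
  \<comment> \<open>In an open ball of radius at most 1/2 two points cannot differ by a nonzero
    integer, so \<open>cexp\<close> is injective there.\<close>
  define r where "r = min e (1/2)"
  have r: "r > 0" "ball w r \<subseteq> S" using e by (auto simp: r_def)
  have inj: "inj_on cexp (ball w r)"
  proof (rule inj_onI)
    fix u v assume uv: "u \<in> ball w r" "v \<in> ball w r" "cexp u = cexp v"
    then obtain n :: int where n: "u = v + of_int n" unfolding cexp_eq by blast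
    have "dist u v < 1" using uv(1,2) dist_triangle_half_r[of w u 1 v] by (simp add: r_def)
    then have "\<bar>real_of_int n\<bar> < 1" using n by (simp add: dist_norm)
    then have "n = 0" by linarith
    then show "u = v" using n by simp
  qed
  have "open (cexp ` ball w r)"
    by (rule open_mapping_thm3[OF _ open_ball inj]) (intro holomorphic_cexp holomorphic_intros)
  then show "\<exists>T. open T \<and> z \<in> T \<and> T \<subseteq> cexp ` S"
    using w r by (intro exI[of _ "cexp ` ball w r"]) auto
qed

lemma riemann_map_normalized:
  assumes U: "open U" "simply_connected U" "U \<noteq> UNIV" "0 \<in> U"
  obtains \<phi> \<psi> where "\<phi> holomorphic_on ball 0 1" "\<psi> holomorphic_on U"
    "\<And>z. z \<in> ball 0 1 \<Longrightarrow> \<phi> z \<in> U \<and> \<psi> (\<phi> z) = z" "\<And>u. u \<in> U \<Longrightarrow> \<psi> u \<in> ball 0 1 \<and> \<phi> (\<psi> u) = u"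
    "\<phi> 0 = 0" "\<psi> 0 = 0"
proof -
  obtain f g where f: "f holomorphic_on U" and g: "g holomorphic_on ball 0 1"
    and fg0: "\<forall>z\<in>U. f z \<in> ball 0 1 \<and> g (f z) = z" and gf0: "\<forall>z\<in>ball 0 1. g z \<in> U \<and> f (g z) = z"
    using Riemann_mapping_theorem[of U] U by blast
  have fg: "\<And>z. z \<in> U \<Longrightarrow> f z \<in> ball 0 1 \<and> g (f z) = z"
    and gf: "\<And>z. z \<in> ball 0 1 \<Longrightarrow> g z \<in> U \<and> f (g z) = z" using fg0 gf0 by blast+
  define a where "a = f 0"
  have a: "cmod a < 1" using fg[OF U(4)] by (simp add: a_def)
  let ?M = "Moebius_function 0 (- a)" and ?N = "Moebius_function 0 a"
  have Mb: "?M z \<in> ball 0 1" "?N z \<in> ball 0 1" if "z \<in> ball 0 1" for z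
    using Moebius_function_norm_lt_1[of "- a" z 0] Moebius_function_norm_lt_1[of a z 0] a that by auto
  have MN: "?M (?N z) = z" "?N (?M z) = z" if "z \<in> ball 0 1" for z
    using Moebius_function_compose[of "- a" a z] Moebius_function_compose[of a "- a" z] a that by auto
  have M0: "?M 0 = a" "?N a = 0" by (simp_all add: Moebius_function_of_zero Moebius_function_eq_zero)
  have hM: "?M holomorphic_on ball 0 1" "?N holomorphic_on ball 0 1"
    using Moebius_function_holomorphic[of "- a" 0] Moebius_function_holomorphic[of a 0] a by auto
  show thesis
  proof (rule that[of "\<lambda>z. g (?M z)" "\<lambda>u. ?N (f u)"])
    show "(\<lambda>z. g (?M z)) holomorphic_on ball 0 1"
      by (rule holomorphic_on_compose_gen[OF hM(1) g, unfolded o_def]) (use Mb in blast)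
    show "(\<lambda>u. ?N (f u)) holomorphic_on U"
      by (rule holomorphic_on_compose_gen[OF f hM(2), unfolded o_def]) (use fg in blast)
    show "g (?M z) \<in> U \<and> ?N (f (g (?M z))) = z" if "z \<in> ball 0 1" for z
      using gf[OF Mb(1)[OF that]] MN(2)[OF that] by simp
    show "?N (f u) \<in> ball 0 1 \<and> g (?M (?N (f u))) = u" if "u \<in> U" for u
      using fg[OF that] Mb(2) MN(1) by simp
    show "g (?M 0) = 0" "?N (f 0) = 0" using fg[OF U(4)] M0 by (simp_all add: a_def)
  qed
qed

context denjoy_data
begin

abbreviation U :: "complex set" where "U \<equiv> basin h 0"

lemma zero_U: "0 \<in> U" by (simp add: basin_eq)

lemma cexp_U: "cexp w \<in> U \<longleftrightarrow> w \<in> cleft C"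
  using cexp_cleft by (simp add: basin_eq)

lemma open_U: "open U"
proof -
  have "U = ball 0 1 \<union> cexp ` cleft C" using ball_basin zero_U by (auto simp: basin_eq)
  then show ?thesis using open_cexp_image[OF open_cleft[OF C_closed]] by auto
qed

text \<open>Multiplication by a positive \<open>t \<le> 1\<close> raises the point in logarithmic
  coordinates, and \<open>cleft C\<close> is closed under upward moves.\<close>

lemma scale_U: assumes u: "u \<in> U" and t: "0 \<le> t" "t \<le> 1" shows "of_real t * u \<in> U"
proof (cases "u = 0 \<or> t = 0")
  case True
  then show ?thesis using zero_U by auto
next
  case False
  define w where "w = cln u"
  have uw: "u = cexp w" using False by (simp add: w_def)
  have wC: "w \<in> cleft C" using u uw cexp_U by blast
  have t0: "t > 0" using False t by simp
  have "of_real t = cexp (\<i> * of_real (- ln t / (2 * pi)))"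
  proof -
    have "2 * of_real pi * \<i> * (\<i> * of_real (- ln t / (2 * pi))) = complex_of_real (ln t)"
      by (simp add: field_simps)
    then show ?thesis using t0 by (simp add: cexp_def exp_of_real del: of_real_minus of_real_divide)
  qed
  then have "of_real t * u = cexp (w + \<i> * of_real (- ln t / (2 * pi)))"
    unfolding uw cexp_add by (simp add: mult.commute)
  moreover have "Im w \<le> Im (w + \<i> * of_real (- ln t / (2 * pi)))"
    using t t0 by (simp add: divide_nonpos_pos)
  then have "w + \<i> * of_real (- ln t / (2 * pi)) \<in> cleft C" using wC by auto
  ultimately show ?thesis using cexp_U by simp
qed

lemma simply_connected_U: "simply_connected U"
proof (rule starlike_imp_simply_connected)
  have "closed_segment 0 u \<subseteq> U" if "u \<in> U" for u
    using scale_U[OF that] by (auto simp: closed_segment_def scaleR_conv_of_real)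
  then show "starlike U" unfolding starlike_def using zero_U by blast
qed

lemma h_U: assumes "u \<in> U" shows "h u \<in> U"
proof (cases "u = 0")
  case False
  then obtain w where w: "w \<in> cleft C" "u = cexp w" using assms by (auto simp: basin_eq)
  then have "k w \<in> cleft C" using k_cleft by blast
  then have "cexp (k w) \<in> U" using cexp_U by blast
  then show ?thesis by (simp only: w(2) h_cexp)
qed (simp add: zero_U)

lemma rotate_U: "circ (1 / m) * u \<in> U \<longleftrightarrow> u \<in> U"
proof (cases "u = 0")
  case False
  define w where "w = cln u"
  have uw: "u = cexp w" using False by (simp add: w_def)
  have "circ (1 / m) * u = cexp (w + of_real (1 / m))"
    by (simp add: uw cexp_add cexp_of_real mult.commute del: of_real_divide)
  then show ?thesis using C_per_m by (simp add: uw cexp_U del: of_real_divide)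
qed simp

end

text \<open>The map \<open>\<omega>\<close>, the contraction by \<open>t\<close> conjugated to the
  disc, fixes 0, so the Schwarz lemma applies. Equality would make \<open>\<omega>\<close> a
  rotation, and its iterates would keep \<open>\<psi> (t^n * u)\<close> on a fixed circle although
  \<open>t^n * u\<close> tends to 0.\<close>

lemma star_schwarz:
  fixes \<phi> \<psi> :: "complex \<Rightarrow> complex"
  assumes h\<phi>: "\<phi> holomorphic_on ball 0 1" and h\<psi>: "\<psi> holomorphic_on U" and U: "open U"
    and \<phi>\<psi>: "\<And>z. z \<in> ball 0 1 \<Longrightarrow> \<phi> z \<in> U \<and> \<psi> (\<phi> z) = z" and \<psi>\<phi>: "\<And>u. u \<in> U \<Longrightarrow> \<psi> u \<in> ball 0 1 \<and> \<phi> (\<psi> u) = u"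
    and zero: "\<phi> 0 = 0" "\<psi> 0 = 0" and star: "\<And>u t. u \<in> U \<Longrightarrow> 0 \<le> t \<Longrightarrow> t \<le> 1 \<Longrightarrow> of_real t * u \<in> U"
    and u: "u \<in> U" "u \<noteq> 0" and t: "0 < t" "t < 1"
  shows "cmod (\<psi> (of_real t * u)) < cmod (\<psi> u)"
proof -
  define \<omega> where "\<omega> = (\<lambda>z. \<psi> (of_real t * \<phi> z))"
  have tU: "of_real t * \<phi> z \<in> U" if "z \<in> ball 0 1" for z using star[of "\<phi> z" t] \<phi>\<psi>[OF that] t by simp
  have h\<omega>: "\<omega> holomorphic_on ball 0 1" unfolding \<omega>_def
    by (rule holomorphic_on_compose_gen[OF _ h\<psi>, unfolded o_def])
       (use tU in \<open>auto intro!: holomorphic_intros h\<phi>\<close>)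
  have \<omega>b: "cmod (\<omega> z) < 1" if "cmod z < 1" for z using \<psi>\<phi>[OF tU, of z] that by (simp add: \<omega>_def)
  have \<omega>0: "\<omega> 0 = 0" by (simp add: \<omega>_def zero)
  define z where "z = \<psi> u"
  have z: "cmod z < 1" "z \<noteq> 0" "\<phi> z = u" using \<psi>\<phi>[OF u(1)] u zero by (auto simp: z_def)
  have le: "cmod (\<omega> z) \<le> cmod z" by (rule Schwarz_Lemma(1)[OF h\<omega> \<omega>0 \<omega>b z(1)])
  have "cmod (\<omega> z) \<noteq> cmod z"
  proof
    assume "cmod (\<omega> z) = cmod z"
    then obtain \<alpha> where \<alpha>: "\<And>z. cmod z < 1 \<Longrightarrow> \<omega> z = \<alpha> * z" "cmod \<alpha> = 1"
      using Schwarz_Lemma(3)[OF h\<omega> \<omega>0 \<omega>b z(1)] z by blast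
    have it: "\<psi> (of_real (t ^ n) * u) = \<alpha> ^ n * z \<and> \<phi> (\<alpha> ^ n * z) = of_real (t ^ n) * u" for n
    proof (induction n)
      case (Suc n)
      have nz: "cmod (\<alpha> ^ n * z) < 1" using z(1) \<alpha>(2) by (simp add: norm_mult norm_power)
      have e: "of_real (t ^ Suc n) * u = of_real t * \<phi> (\<alpha> ^ n * z)" using Suc by (simp only: power_Suc of_real_mult mult.assoc)
      have a: "\<psi> (of_real t * \<phi> (\<alpha> ^ n * z)) = \<alpha> ^ Suc n * z" using \<alpha>(1)[OF nz] by (simp add: \<omega>_def)
      have "\<phi> (\<psi> (of_real t * \<phi> (\<alpha> ^ n * z))) = of_real t * \<phi> (\<alpha> ^ n * z)"
        using \<psi>\<phi> tU[of "\<alpha> ^ n * z"] nz by simp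
      then show ?case unfolding e a by simp
    qed (use z z_def in simp)
    have "(\<lambda>n. t ^ n) \<longlonglongrightarrow> 0" using t by (intro LIMSEQ_power_zero) simp
    then have "(\<lambda>n. complex_of_real (t ^ n)) \<longlonglongrightarrow> of_real 0" by (rule tendsto_of_real)
    then have "(\<lambda>n. of_real (t ^ n) * u) \<longlonglongrightarrow> of_real 0 * u" by (rule tendsto_mult_right)
    moreover have "0 \<in> U" using star[OF u(1), of 0] by simp
    then have "isCont \<psi> (of_real 0 * u)"
      using holomorphic_on_imp_continuous_on[OF h\<psi>] U by (simp add: continuous_on_eq_continuous_at)
    ultimately have "(\<lambda>n. \<psi> (of_real (t ^ n) * u)) \<longlonglongrightarrow> \<psi> (of_real 0 * u)" by (rule isCont_tendsto_compose[rotated])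
    then have "(\<lambda>n. cmod (\<psi> (of_real (t ^ n) * u))) \<longlonglongrightarrow> cmod 0" using zero by (intro tendsto_norm) simp
    moreover have "cmod (\<psi> (of_real (t ^ n) * u)) = cmod z" for n
      using it[of n] \<alpha>(2) by (simp add: norm_mult norm_power)
    ultimately have "(\<lambda>n::nat. cmod z) \<longlonglongrightarrow> 0" by simp
    then show False using z by (simp add: LIMSEQ_const_iff)
  qed
  then show ?thesis using le z by (simp add: \<omega>_def z_def)
qed

locale denjoy_riemann = denjoy_data +
  fixes \<phi> \<psi> :: "complex \<Rightarrow> complex"
  assumes hol_\<phi>: "\<phi> holomorphic_on ball 0 1" and hol_\<psi>: "\<psi> holomorphic_on U"
    and \<phi>\<psi>: "z \<in> ball 0 1 \<Longrightarrow> \<phi> z \<in> U \<and> \<psi> (\<phi> z) = z"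
    and \<psi>\<phi>: "u \<in> U \<Longrightarrow> \<psi> u \<in> ball 0 1 \<and> \<phi> (\<psi> u) = u"
    and \<phi>0 [simp]: "\<phi> 0 = 0" and \<psi>0 [simp]: "\<psi> 0 = 0"
begin

section \<open>Lifting the Riemann map to logarithmic coordinates\<close>

lemma \<phi>_zero_iff: "z \<in> ball 0 1 \<Longrightarrow> \<phi> z = 0 \<longleftrightarrow> z = 0"
  using \<phi>\<psi> \<psi>0 \<phi>0 by metis

lemma \<psi>_zero_iff: "u \<in> U \<Longrightarrow> \<psi> u = 0 \<longleftrightarrow> u = 0"
  using \<psi>\<phi> \<psi>0 \<phi>0 by metis

lemma isCont_\<psi>: "u \<in> U \<Longrightarrow> isCont \<psi> u"
  using holomorphic_on_imp_continuous_on[OF hol_\<psi>] open_U by (simp add: continuous_on_eq_continuous_at)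

lemma isCont_\<phi>: "z \<in> ball 0 1 \<Longrightarrow> isCont \<phi> z"
  using holomorphic_on_imp_continuous_on[OF hol_\<phi>] by (simp add: continuous_on_eq_continuous_at)

text \<open>The Schwarz lemma for \<open>\<psi>\<close> on the unit disc, which lies in
  \<open>U\<close>; it supplies the assumption \<open>upper\<close> with
  \<open>M = 0\<close>.\<close>

lemma \<phi>_ge: assumes z: "z \<in> ball 0 1" shows "cmod z \<le> cmod (\<phi> z)"
proof (cases "cmod (\<phi> z) < 1")
  case True
  have "cmod (\<psi> (\<phi> z)) \<le> cmod (\<phi> z)"
  proof (rule Schwarz_Lemma(1)[of \<psi>])
    show "\<psi> holomorphic_on ball 0 1" by (rule holomorphic_on_subset[OF hol_\<psi> ball_basin])
    show "cmod (\<psi> u) < 1" if "cmod u < 1" for u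
      using \<psi>\<phi>[of u] ball_basin that by (auto simp: subset_iff)
  qed (use True in auto)
  then show ?thesis using \<phi>\<psi>[OF z] by simp
qed (use z in simp)

text \<open>The quotient of \<open>\<phi>\<close> by \<open>z\<close> extends to the disc without
  zeros: away from 0 by injectivity, at 0 because an injective \<open>\<phi>\<close> has nonzero
  derivative. Its logarithm \<open>L\<close> is single valued on the disc, so the lift
  \<open>Lam\<close> commutes with integer translations.\<close>

lemma L_exists: "\<exists>L. L holomorphic_on ball 0 1 \<and> (\<forall>z\<in>ball 0 1. \<phi> z = z * exp (L z))"
proof -
  define q where "q = (\<lambda>z. if z = 0 then deriv \<phi> 0 else \<phi> z / z)"
  have "(\<lambda>z. if z = 0 then deriv \<phi> 0 else \<phi> z / z - \<phi> 0 / (z - 0)) holomorphic_on ball 0 1"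
    by (rule pole_theorem_open[OF hol_\<phi> open_ball]) simp
  then have hq: "q holomorphic_on ball 0 1" by (rule holomorphic_transform) (simp add: q_def)
  have inj: "inj_on \<phi> (ball 0 1)" using \<phi>\<psi> by (intro inj_on_inverseI[of _ \<psi>]) blast
  have "deriv \<phi> 0 \<noteq> 0" by (rule holomorphic_injective_imp_regular[OF hol_\<phi> open_ball inj]) simp
  then have nz: "\<forall>z\<in>ball 0 1. q z \<noteq> 0" using \<phi>_zero_iff by (auto simp: q_def)
  have "simply_connected (ball (0::complex) 1)" by (simp add: convex_imp_simply_connected)
  then obtain L where L: "L holomorphic_on ball 0 1" "\<forall>z\<in>ball 0 1. q z = exp (L z)"
    using hq nz unfolding simply_connected_eq_holomorphic_log[OF open_ball] by blast
  have "\<phi> z = z * exp (L z)" if "z \<in> ball 0 1" for z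
  proof (cases "z = 0")
    case False
    have "q z = exp (L z)" using L(2) that by blast
    then have "exp (L z) = \<phi> z / z" using False by (simp add: q_def)
    then show ?thesis using False by simp
  qed simp
  then show ?thesis using L(1) by blast
qed

definition L :: "complex \<Rightarrow> complex" where
  "L = (SOME L. L holomorphic_on ball 0 1 \<and> (\<forall>z\<in>ball 0 1. \<phi> z = z * exp (L z)))"

lemma L: "L holomorphic_on ball 0 1" "z \<in> ball 0 1 \<Longrightarrow> \<phi> z = z * exp (L z)"
  using someI_ex[OF L_exists] unfolding L_def by blast+

definition Lam :: "complex \<Rightarrow> complex" where
  "Lam s = s + L (cexp s) / (2 * of_real pi * \<i>)"

lemma cexp_ball: "cexp s \<in> ball 0 1 \<longleftrightarrow> s \<in> HP"
  by (simp add: norm_cexp zero_less_mult_iff)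

lemma cexp_Lam: assumes "s \<in> HP" shows "cexp (Lam s) = \<phi> (cexp s)"
proof -
  have "cexp (L (cexp s) / (2 * of_real pi * \<i>)) = exp (L (cexp s))" by (simp add: cexp_def)
  then show ?thesis using L(2)[of "cexp s"] cexp_ball assms by (simp add: Lam_def cexp_add)
qed

lemma hol_Lam: "Lam holomorphic_on HP"
  unfolding Lam_def[abs_def]
  by (intro holomorphic_intros holomorphic_on_compose_gen[OF _ L(1), unfolded o_def] holomorphic_cexp)
     (use cexp_ball in blast)+

lemma Lam_per: "Lam (s + 1) = Lam s + 1"
proof -
  have "cexp (s + 1) = cexp s" using cexp_of_int[of 1] by (simp add: cexp_add)
  then show ?thesis by (simp add: Lam_def)
qed

lemma Lam_per_int: "Lam (s + of_int n) = Lam s + of_int n"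
  by (rule periodic_int) (rule Lam_per)

lemma Lam_cleft: "s \<in> HP \<Longrightarrow> Lam s \<in> cleft C"
  using cexp_Lam[of s] \<phi>\<psi>[of "cexp s"] cexp_ball[of s] cexp_U[of "Lam s"] by metis

lemma inj_Lam: "inj_on Lam HP"
proof (rule inj_onI)
  fix s s' assume s: "s \<in> HP" "s' \<in> HP" and eq: "Lam s = Lam s'"
  then have "\<phi> (cexp s) = \<phi> (cexp s')" using cexp_Lam by metis
  then have "cexp s = cexp s'" using \<phi>\<psi> cexp_ball s by metis
  then obtain n :: int where n: "s = s' + of_int n" unfolding cexp_eq by blast
  then have "of_int n = (0::complex)" using eq Lam_per_int[of s' n] by simp
  then show "s = s'" using n by simp
qed

lemma Lam_surj: assumes w: "w \<in> cleft C" shows "w \<in> Lam ` HP"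
proof -
  have wU: "cexp w \<in> U" using w cexp_U by blast
  define z where "z = \<psi> (cexp w)"
  have z: "z \<in> ball 0 1" "\<phi> z = cexp w" "z \<noteq> 0" using \<psi>\<phi>[OF wU] \<psi>_zero_iff[OF wU] by (auto simp: z_def)
  have zs: "z = cexp (cln z)" using z by simp
  have s: "cln z \<in> HP" using z(1) zs cexp_ball by metis
  have "cexp (Lam (cln z)) = cexp w" using cexp_Lam[OF s] z(2) zs by simp
  then obtain n :: int where "w = Lam (cln z) + of_int n" unfolding cexp_eq by (metis add_diff_cancel_right' cexp_eq)
  then have "w = Lam (cln z + of_int n)" by (simp add: Lam_per_int)
  moreover have "cln z + of_int n \<in> HP" using s by simp
  ultimately show ?thesis by blast
qed

lemma Lam_image: "Lam ` HP = cleft C"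
  using Lam_cleft Lam_surj by blast

definition Psi :: "complex \<Rightarrow> complex" where "Psi = inv_into HP Lam"

lemma Psi_Lam: "s \<in> HP \<Longrightarrow> Psi (Lam s) = s"
  unfolding Psi_def by (rule inv_into_f_f[OF inj_Lam])

lemma Lam_Psi: "w \<in> cleft C \<Longrightarrow> Lam (Psi w) = w"
  unfolding Psi_def using Lam_surj f_inv_into_f by metis

lemma Psi_HP: "w \<in> cleft C \<Longrightarrow> Psi w \<in> HP"
  unfolding Psi_def using Lam_surj inv_into_into by metis

lemma hol_Psi: "Psi holomorphic_on cleft C"
proof -
  obtain g where g: "g holomorphic_on (Lam ` HP)" "\<And>s. s \<in> HP \<Longrightarrow> g (Lam s) = s"
    using holomorphic_has_inverse[OF hol_Lam open_HP inj_Lam] by metis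
  show ?thesis
  proof (rule holomorphic_transform[of g])
    show "g holomorphic_on cleft C" using g(1) unfolding Lam_image .
    show "g w = Psi w" if "w \<in> cleft C" for w
      using g(2)[OF Psi_HP[OF that]] Lam_Psi[OF that] by simp
  qed
qed

lemma cexp_Psi: assumes w: "w \<in> cleft C" shows "cexp (Psi w) = \<psi> (cexp w)"
proof -
  have "\<phi> (cexp (Psi w)) = cexp w" using cexp_Lam[OF Psi_HP[OF w]] Lam_Psi[OF w] by simp
  then show ?thesis using \<phi>\<psi> cexp_ball Psi_HP[OF w] by metis
qed

lemma norm_cexp_less: "cmod (cexp v) < cmod (cexp w) \<longleftrightarrow> Im w < Im v"
  by (simp add: norm_cexp)

sublocale spike: spike_map Lam Psi C
proof
  show "closed C" "C \<noteq> {}" by (rule C_closed, rule C_ne)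
  show "x + 1 \<in> C \<longleftrightarrow> x \<in> C" for x by (rule C_per)
  show "\<exists>x. a < x \<and> x < b \<and> x \<notin> C" if "a < b" for a b by (rule C_nd[OF that])
  show "Lam holomorphic_on HP" "Psi holomorphic_on cleft C" by (rule hol_Lam, rule hol_Psi)
  show "Lam (s + 1) = Lam s + 1" for s by (rule Lam_per)
  show "s \<in> HP \<Longrightarrow> Lam s \<in> cleft C" for s by (rule Lam_cleft)
  show "s \<in> HP \<Longrightarrow> Psi (Lam s) = s" for s by (rule Psi_Lam)
  show "w \<in> cleft C \<Longrightarrow> Psi w \<in> HP" for w by (rule Psi_HP)
  show "w \<in> cleft C \<Longrightarrow> Lam (Psi w) = w" for w by (rule Lam_Psi)
  \<comment> \<open>Raising by \<open>\<eta>\<close> is scaling by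
    \<open>exp (- 2 * pi * \<eta>)\<close> in the starlike domain \<open>U\<close>, so
    \<open>star_schwarz\<close> applies.\<close>
  show "Im (Psi w) < Im (Psi (w + \<i> * of_real \<eta>))" if w: "w \<in> cleft C" and \<eta>: "\<eta> > 0" for w \<eta>
  proof -
    have w': "w + \<i> * of_real \<eta> \<in> cleft C" using w \<eta> by auto
    have "2 * of_real pi * \<i> * (\<i> * of_real \<eta>) = complex_of_real (- 2 * pi * \<eta>)" by (simp add: complex_eq_iff)
    then have "cexp (\<i> * of_real \<eta>) = of_real (exp (- 2 * pi * \<eta>))" by (simp only: cexp_def exp_of_real)
    then have e: "cexp (w + \<i> * of_real \<eta>) = of_real (exp (- 2 * pi * \<eta>)) * cexp w"
      by (simp add: cexp_add mult.commute)
    have "cmod (\<psi> (of_real (exp (- 2 * pi * \<eta>)) * cexp w)) < cmod (\<psi> (cexp w))"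
      by (rule star_schwarz[OF hol_\<phi> hol_\<psi> open_U \<phi>\<psi> \<psi>\<phi> \<phi>0 \<psi>0 scale_U])
         (use w cexp_U \<eta> in auto)
    then have "cmod (cexp (Psi (w + \<i> * of_real \<eta>))) < cmod (cexp (Psi w))"
      unfolding cexp_Psi[OF w] cexp_Psi[OF w'] e .
    then show ?thesis by (simp only: norm_cexp_less)
  qed
  have sub: "cball 0 (exp (- 2 * pi * e)) \<subseteq> ball (0::complex) 1" if "e > 0" for e
  proof
    fix z :: complex assume "z \<in> cball 0 (exp (- 2 * pi * e))"
    then have "cmod z \<le> exp (- 2 * pi * e)" by (simp only: mem_cball_0)
    also have "exp (- 2 * pi * e) < 1" using that by simp
    finally show "z \<in> ball 0 1" by simp
  qed
  \<comment> \<open>The image \<open>K\<close> of a smaller closed disc is a compact subset of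
    \<open>U\<close> and misses \<open>cexp w\<close>; points of the slit domain near
    \<open>w\<close> therefore come from outside the smaller disc.\<close>
  show "((\<lambda>u. Im (Psi u)) \<longlongrightarrow> 0) (at w within cleft C)" if w: "w \<notin> cleft C" for w
  proof (rule tendstoI)
    fix e :: real assume e: "e > 0"
    define K where "K = \<phi> ` cball 0 (exp (- 2 * pi * e))"
    note sub = sub[OF e]
    have "compact K" unfolding K_def
      by (intro compact_continuous_image continuous_on_subset[OF holomorphic_on_imp_continuous_on[OF hol_\<phi>] sub] compact_cball)
    then have oK: "open (- K)" by (intro open_Compl compact_imp_closed)
    have "K \<subseteq> U" using sub \<phi>\<psi> by (auto simp: K_def)
    then have "cexp w \<notin> K" using w cexp_U by blast
    have "isCont cexp w" using cont_cexp[OF continuous_on_id, of UNIV] by (simp add: continuous_on_eq_continuous_at)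
    then have "eventually (\<lambda>u. cexp u \<in> - K) (at w)"
      using oK \<open>cexp w \<notin> K\<close> unfolding isCont_def by (auto dest: topological_tendstoD)
    then have "eventually (\<lambda>u. cexp u \<in> - K) (at w within cleft C)"
      unfolding eventually_at_filter by (auto elim: eventually_mono)
    moreover have "eventually (\<lambda>u. u \<in> cleft C) (at w within cleft C)" by (simp add: eventually_at_filter)
    ultimately show "eventually (\<lambda>u. dist (Im (Psi u)) 0 < e) (at w within cleft C)"
    proof eventually_elim
      case (elim u)
      have "\<not> cmod (cexp (Psi u)) \<le> exp (- 2 * pi * e)"
      proof
        assume "cmod (cexp (Psi u)) \<le> exp (- 2 * pi * e)"
        then have "\<phi> (cexp (Psi u)) \<in> K" by (simp add: K_def)
        then have "cexp u \<in> K" using cexp_Lam[OF Psi_HP[OF elim(2)]] Lam_Psi[OF elim(2)] by simp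
        then show False using elim(1) by simp
      qed
      then have "Im (Psi u) < e" by (simp add: norm_cexp not_le)
      then show ?case using Psi_HP[OF elim(2)] by simp
    qed
  qed
  show "\<exists>B. \<forall>s. \<epsilon> \<le> Im s \<longrightarrow> cmod (Lam s - s) \<le> B" if \<epsilon>: "0 < \<epsilon>" for \<epsilon>
  proof -
    note sub = sub[OF \<epsilon>]
    have "compact (L ` cball 0 (exp (- 2 * pi * \<epsilon>)))"
      by (intro compact_continuous_image continuous_on_subset[OF holomorphic_on_imp_continuous_on[OF L(1)] sub] compact_cball)
    then have "bounded (L ` cball 0 (exp (- 2 * pi * \<epsilon>)))" by (rule compact_imp_bounded)
    then obtain b where b: "\<forall>y\<in>L ` cball 0 (exp (- 2 * pi * \<epsilon>)). cmod y \<le> b"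
      unfolding bounded_iff by blast
    have "cmod (Lam s - s) \<le> b / (2 * pi)" if "\<epsilon> \<le> Im s" for s
    proof -
      have "cexp s \<in> cball 0 (exp (- 2 * pi * \<epsilon>))" using that by (simp add: norm_cexp)
      then have "cmod (L (cexp s)) \<le> b" using b by blast
      then show ?thesis by (simp add: Lam_def norm_divide norm_mult divide_right_mono)
    qed
    then show ?thesis by blast
  qed
  show "\<exists>M. \<forall>s\<in>HP. Im (Lam s) \<le> Im s + M"
  proof (intro exI[of _ 0] ballI)
    fix s assume s: "s \<in> HP"
    have "cmod (cexp s) \<le> cmod (cexp (Lam s))"
      unfolding cexp_Lam[OF s] using cexp_ball s by (intro \<phi>_ge) blast
    then show "Im (Lam s) \<le> Im s + 0" by (simp add: norm_cexp)
  qed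
qed

sublocale ext: spike_ext Lam Psi C F F' k k'
proof unfold_locales
  show "continuous_on UNIV k" "continuous_on UNIV k'" by (rule cont_k, rule cont_k')
  show "strict_mono F" "strict_mono F'" by (rule F_mono, rule F'_mono)
  show "k w \<in> cleft C \<longleftrightarrow> w \<in> cleft C" for w by (rule k_cleft)
  show "k (w + 1) = k w + 1" for w by (rule k_per)
  show "F x \<in> C \<longleftrightarrow> x \<in> C" for x by (rule F_C)
  show "\<exists>B'. \<forall>w. Im w \<le> B \<longrightarrow> Im (k w) \<le> B'" for B
  proof (intro exI[of _ "max (2 * B) (B / 2) + 3"] allI impI)
    fix w assume "Im w \<le> B"
    then have "A (Im w) \<le> max (2 * B) (B / 2)" by (auto simp: A_def max_def)
    then show "Im (k w) \<le> max (2 * B) (B / 2) + 3" using d_le[of "Re w"] by (simp add: k_def)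
  qed
  show "\<exists>B'. \<forall>w. Im w \<le> B \<longrightarrow> Im (k' w) \<le> B'" for B
  proof (intro exI[of _ "B / 2"] allI impI)
    fix w assume "Im w \<le> B"
    then show "Im (k' w) \<le> B / 2" using d_nonneg[of "F' (Re w)"] by (simp add: k'_def A'_def min_def)
  qed
qed (simp_all add: k_def k'_def)

section \<open>The extension to the closed disc\<close>

definition H :: "complex \<Rightarrow> complex" where
  "H z = circ (ext.Hb (Re (cln z)))"

lemma Hb_per_int: "ext.Hb (x + of_int n) = ext.Hb x + of_int n"
  by (rule periodic_int) (rule ext.Hb_per)

lemma H_circ: "H (circ x) = circ (ext.Hb x)"
proof -
  have "cexp (cln (circ x)) = cexp (of_real x)" unfolding cexp_of_real[symmetric] by simp
  then obtain n :: int where "cln (circ x) = of_real x + of_int n" unfolding cexp_eq by blast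
  then have "Re (cln (circ x)) = x + of_int n" by simp
  then show ?thesis unfolding H_def by (auto simp: Hb_per_int circ_eq)
qed

lemma H_lift: "circle_lift ext.Hb H"
  unfolding circle_lift_def using ext.cont_Hb ext.strict_mono_Hb ext.Hb_per H_circ by blast

definition E :: "complex \<Rightarrow> complex" where
  "E z = (if cmod z < 1 then inv_into (ball 0 1) \<phi> (h (\<phi> z)) else H z)"

lemma inv_\<phi>: assumes "u \<in> U" shows "inv_into (ball 0 1) \<phi> u = \<psi> u"
proof -
  have "inj_on \<phi> (ball 0 1)" using \<phi>\<psi> by (intro inj_on_inverseI[of _ \<psi>]) blast
  then show ?thesis using \<psi>\<phi>[OF assms] by (metis inv_into_f_f)
qed

lemma E_ball: "z \<in> ball 0 1 \<Longrightarrow> E z = \<psi> (h (\<phi> z))"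
  unfolding E_def using inv_\<phi> h_U \<phi>\<psi> by simp

lemma E_cexp:
  assumes "Im s \<ge> 0"
  shows "E (cexp s) = cexp (if Im s > 0 then ext.G s else of_real (ext.Hb (Re s)))"
proof (cases "Im s > 0")
  case True
  then have s: "s \<in> HP" by simp
  have "E (cexp s) = \<psi> (h (\<phi> (cexp s)))" by (rule E_ball[OF cexp_ball[THEN iffD2, OF s]])
  also have "\<dots> = \<psi> (cexp (k (Lam s)))" by (simp add: cexp_Lam[OF s, symmetric] h_cexp)
  also have "\<dots> = cexp (Psi (k (Lam s)))"
    by (rule cexp_Psi[OF k_cleft[THEN iffD2, OF Lam_cleft[OF s]], symmetric])
  finally show ?thesis using True by (simp add: ext.G_def)
next
  case False
  then have "s = of_real (Re s)" using assms by (simp add: complex_eq_iff)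
  then have c: "cexp s = circ (Re s)" using cexp_of_real by metis
  have "cmod (cexp s) = 1" using False assms by (simp add: norm_cexp)
  then show ?thesis using False by (simp add: E_def c H_circ cexp_of_real)
qed

lemma cont_E: "continuous_on (cball 0 1) E"
  unfolding continuous_on_eq_continuous_within
proof
  fix z0 :: complex assume z0: "z0 \<in> cball 0 1"
  show "continuous (at z0 within cball 0 1) E"
  proof (cases "z0 = 0")
    case True
    have ih: "isCont h u" for u
      using homeomorphism_cont1[OF h_homeo] by (simp add: continuous_on_eq_continuous_at)
    have "isCont (\<lambda>z. \<psi> (h (\<phi> z))) 0"
      using isCont_\<phi>[of 0] ih isCont_\<psi>[OF zero_U]
      by (intro isCont_o2[where f = "\<lambda>z. h (\<phi> z)" and g = \<psi>] isCont_o2[where f = \<phi> and g = h]) auto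
    moreover have "eventually (\<lambda>z. z \<in> ball 0 1) (nhds (0::complex))" by (intro eventually_nhds_in_open) auto
    then have "eventually (\<lambda>z. E z = \<psi> (h (\<phi> z))) (nhds 0)" by eventually_elim (rule E_ball)
    ultimately have "isCont E 0" by (subst isCont_cong)
    then show ?thesis using True continuous_at_imp_continuous_at_within by blast
  next
    case False
    obtain N wf where oN: "open N" and z0N: "z0 \<in> N" and cN: "continuous_on N wf"
      and wf: "\<And>z. z \<in> N \<Longrightarrow> cexp (wf z) = z"
      using cexp_local_section[OF False] by metis
    have wfi: "Im (wf z) \<ge> 0" if "z \<in> cball 0 1 \<inter> N" for z
    proof -
      have "cmod (cexp (wf z)) \<le> 1" using wf that by simp
      then show ?thesis using pi_gt_zero by (auto simp: norm_cexp zero_le_mult_iff simp del: pi_gt_zero)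
    qed
    have cwf: "continuous_on (cball 0 1 \<inter> N) wf"
      by (rule continuous_on_subset[OF cN]) simp
    have c: "continuous_on (cball 0 1 \<inter> N)
        (\<lambda>z. cexp (if Im (wf z) > 0 then ext.G (wf z) else of_real (ext.Hb (Re (wf z)))))"
      by (intro cont_cexp continuous_on_compose2[OF ext.cont_ext cwf]) (use wfi in auto)
    have e: "cexp (if Im (wf z) > 0 then ext.G (wf z) else of_real (ext.Hb (Re (wf z)))) = E z"
      if "z \<in> cball 0 1 \<inter> N" for z
      using E_cexp[OF wfi[OF that]] wf that by simp
    have "continuous_on (cball 0 1 \<inter> N) E" by (rule continuous_on_eq[OF c e])
    then have "continuous (at z0 within cball 0 1 \<inter> N) E"
      using z0 z0N by (auto simp: continuous_on_eq_continuous_within)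
    moreover have "at z0 within cball 0 1 \<inter> N = at z0 within cball 0 1"
      by (rule at_within_nhd[of _ N]) (use z0N oN in auto)
    ultimately show ?thesis by (simp add: continuous_within)
  qed
qed

lemma H_induced: "induced_prime_end_map h U H"
  unfolding induced_prime_end_map_def
proof (intro exI[of _ \<phi>] conjI)
  show "\<phi> holomorphic_on ball 0 1" by (rule hol_\<phi>)
  show "bij_betw \<phi> (ball 0 1) U"
    by (rule bij_betw_byWitness[of _ \<psi>]) (use \<phi>\<psi> \<psi>\<phi> in auto)
  show "continuous_on (cball 0 1) (\<lambda>z. if cmod z < 1 then inv_into (ball 0 1) \<phi> (h (\<phi> z)) else H z)"
    using cont_E unfolding E_def[abs_def] .
qed

section \<open>Equivariance on the circle of prime ends\<close>

lemma circ_norm [simp]: "cmod (circ x) = 1" by (simp add: circ_def)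

text \<open>Uniqueness of the normalised Riemann map up to rotation: by the Schwarz lemma for
  \<open>\<gamma>\<close> and its inverse \<open>\<delta>\<close>, \<open>\<gamma>\<close> is
  multiplication by some \<open>\<alpha>\<close>. Comparing derivatives at 0, through
  \<open>\<phi> z = z * exp (L z)\<close>, gives \<open>\<alpha> = 1\<close>.\<close>

lemma \<phi>_rotate: assumes z: "z \<in> ball 0 1" shows "\<phi> (circ (1 / m) * z) = circ (1 / m) * \<phi> z"
proof -
  define \<omega> where "\<omega> = circ (1 / m)"
  have n\<omega>: "cmod \<omega> = 1" and \<omega>0: "\<omega> \<noteq> 0" by (auto simp: \<omega>_def circ_def)
  have rb: "\<omega> * z \<in> ball 0 1" "z / \<omega> \<in> ball 0 1" if "z \<in> ball 0 1" for z
    using that n\<omega> by (simp_all add: norm_mult norm_divide)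
  have rU: "u / \<omega> \<in> U \<longleftrightarrow> u \<in> U" "\<omega> * u \<in> U \<longleftrightarrow> u \<in> U" for u
    using rotate_U[of "u / \<omega>"] rotate_U[of u] \<omega>0 by (simp_all add: \<omega>_def)
  define \<gamma> where "\<gamma> = (\<lambda>z. \<psi> (\<phi> (\<omega> * z) / \<omega>))"
  define \<delta> where "\<delta> = (\<lambda>z. \<psi> (\<omega> * \<phi> z) / \<omega>)"
  have in1: "\<phi> (\<omega> * z) / \<omega> \<in> U" if "z \<in> ball 0 1" for z using \<phi>\<psi> rb(1)[OF that] rU(1) by blast
  have in2: "\<omega> * \<phi> z \<in> U" if "z \<in> ball 0 1" for z using \<phi>\<psi> that rU(2) by blast
  have h\<gamma>: "\<gamma> holomorphic_on ball 0 1" unfolding \<gamma>_def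
  proof (rule holomorphic_on_compose_gen[OF _ hol_\<psi>, unfolded o_def])
    have "(\<lambda>z. \<phi> (\<omega> * z)) holomorphic_on ball 0 1"
    proof (rule holomorphic_on_compose_gen[OF _ hol_\<phi>, unfolded o_def])
      show "(\<lambda>z. \<omega> * z) holomorphic_on ball 0 1" by (intro holomorphic_intros)
      show "(\<lambda>z. \<omega> * z) ` ball 0 1 \<subseteq> ball 0 1" using rb(1) by blast
    qed
    then show "(\<lambda>z. \<phi> (\<omega> * z) / \<omega>) holomorphic_on ball 0 1"
      by (rule holomorphic_on_divide) (simp_all add: \<omega>0)
    show "(\<lambda>z. \<phi> (\<omega> * z) / \<omega>) ` ball 0 1 \<subseteq> U" using in1 by blast
  qed
  have h\<delta>: "\<delta> holomorphic_on ball 0 1" unfolding \<delta>_def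
  proof (rule holomorphic_on_divide)
    show "(\<lambda>z. \<psi> (\<omega> * \<phi> z)) holomorphic_on ball 0 1"
    proof (rule holomorphic_on_compose_gen[OF _ hol_\<psi>, unfolded o_def])
      show "(\<lambda>z. \<omega> * \<phi> z) holomorphic_on ball 0 1" by (intro holomorphic_intros hol_\<phi>)
      show "(\<lambda>z. \<omega> * \<phi> z) ` ball 0 1 \<subseteq> U" using in2 by blast
    qed
  qed (simp_all add: \<omega>0)
  have \<gamma>b: "cmod (\<gamma> z) < 1" if "cmod z < 1" for z using \<psi>\<phi> in1[of z] that by (simp add: \<gamma>_def)
  have \<delta>b: "cmod (\<delta> z) < 1" if "cmod z < 1" for z
    using \<psi>\<phi>[OF in2[of z]] that n\<omega> by (simp add: \<delta>_def norm_divide)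
  have \<delta>\<gamma>: "\<delta> (\<gamma> z) = z" if "z \<in> ball 0 1" for z
    using \<psi>\<phi>[OF in1[OF that]] \<phi>\<psi>[OF rb(1)[OF that]] \<omega>0 by (simp add: \<gamma>_def \<delta>_def)
  have eq: "cmod (\<gamma> z) = cmod z" if z: "cmod z < 1" for z
  proof (rule antisym)
    show "cmod (\<gamma> z) \<le> cmod z" by (rule Schwarz_Lemma(1)[OF h\<gamma> _ \<gamma>b z]) (simp_all add: \<gamma>_def)
    have "cmod (\<delta> (\<gamma> z)) \<le> cmod (\<gamma> z)" by (rule Schwarz_Lemma(1)[OF h\<delta> _ \<delta>b \<gamma>b[OF z]]) (simp_all add: \<delta>_def)
    then show "cmod z \<le> cmod (\<gamma> z)" using \<delta>\<gamma>[of z] z by simp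
  qed
  have \<gamma>0: "\<gamma> 0 = 0" by (simp add: \<gamma>_def)
  have half: "cmod (1/2) < 1" by simp
  have "\<exists>z. cmod z < 1 \<and> z \<noteq> 0 \<and> cmod (\<gamma> z) = cmod z"
    using eq[OF half] half by (intro exI[of _ "1/2"]) simp
  then have "\<exists>\<alpha>. (\<forall>z. cmod z < 1 \<longrightarrow> \<gamma> z = \<alpha> * z) \<and> cmod \<alpha> = 1"
    using Schwarz_Lemma(3)[OF h\<gamma> \<gamma>0 \<gamma>b half] by blast
  then obtain \<alpha> where \<alpha>: "\<And>z. cmod z < 1 \<Longrightarrow> \<gamma> z = \<alpha> * z" "cmod \<alpha> = 1" by blast
  have \<phi>\<alpha>: "\<phi> (\<omega> * z) = \<omega> * \<phi> (\<alpha> * z)" if "z \<in> ball 0 1" for z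
  proof -
    have "\<phi> (\<gamma> z) = \<phi> (\<omega> * z) / \<omega>" using \<psi>\<phi>[OF in1[OF that]] by (simp add: \<gamma>_def)
    moreover have "\<gamma> z = \<alpha> * z" using \<alpha>(1) that by simp
    ultimately show ?thesis using \<omega>0 by simp
  qed
  have "exp (L (\<omega> * z)) = \<alpha> * exp (L (\<alpha> * z))" if z: "z \<in> ball 0 1" "z \<noteq> 0" for z
  proof -
    have az: "\<alpha> * z \<in> ball 0 1" using z \<alpha>(2) by (simp add: norm_mult)
    have "\<omega> * z * exp (L (\<omega> * z)) = \<omega> * (\<alpha> * z * exp (L (\<alpha> * z)))"
      using \<phi>\<alpha>[OF z(1)] L(2)[OF rb(1)[OF z(1)]] L(2)[OF az] by simp
    then show ?thesis using z(2) \<omega>0 by simp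
  qed
  then have ev: "eventually (\<lambda>z. exp (L (\<omega> * z)) = \<alpha> * exp (L (\<alpha> * z))) (at 0)"
    unfolding eventually_at by (intro exI[of _ 1]) (auto simp: dist_norm)
  have cL: "isCont L 0"
    using holomorphic_on_imp_continuous_on[OF L(1)] by (simp add: continuous_on_eq_continuous_at)
  have lim: "((\<lambda>z. exp (L (c * z))) \<longlongrightarrow> exp (L 0)) (at 0)" for c
  proof -
    have "((\<lambda>z. c * z) \<longlongrightarrow> c * 0) (at 0)" by (intro tendsto_intros)
    then have "((\<lambda>z. c * z) \<longlongrightarrow> 0) (at 0)" by simp
    then show ?thesis by (intro tendsto_exp isCont_tendsto_compose[OF cL])
  qed
  have "((\<lambda>z. exp (L (\<omega> * z))) \<longlongrightarrow> \<alpha> * exp (L 0)) (at 0)"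
    using tendsto_cong[OF ev] tendsto_mult_left[OF lim] by blast
  then have "exp (L 0) = \<alpha> * exp (L 0)" using tendsto_unique[OF _ lim] by (metis at_neq_bot)
  then have "\<alpha> = 1" by simp
  then show ?thesis using \<phi>\<alpha>[OF z] by (simp add: \<omega>_def)
qed

lemma E_rotate: assumes z: "z \<in> ball 0 1" shows "E (circ (1 / m) * z) = circ (1 / m) * E z"
proof -
  have rz: "circ (1 / m) * z \<in> ball 0 1" using z by (simp add: norm_mult)
  have hr: "h (circ (1 / m) * u) = circ (1 / m) * h u" for u
    using h_equivariant[unfolded plane_equivariant_def, rule_format, of 1 u] by simp
  have hU: "h (\<phi> z) \<in> U" using h_U \<phi>\<psi>[OF z] by blast
  define y where "y = \<psi> (h (\<phi> z))"
  have y: "y \<in> ball 0 1" "\<phi> y = h (\<phi> z)" using \<psi>\<phi>[OF hU] by (auto simp: y_def)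
  have ry: "circ (1 / m) * y \<in> ball 0 1" using y by (simp add: norm_mult)
  have "E (circ (1 / m) * z) = \<psi> (\<phi> (circ (1 / m) * y))"
    by (simp only: E_ball[OF rz] \<phi>_rotate[OF z] hr \<phi>_rotate[OF y(1)] y(2))
  also have "\<dots> = circ (1 / m) * y" using \<phi>\<psi>[OF ry] by blast
  finally show ?thesis by (simp add: E_ball[OF z] y_def)
qed

text \<open>\<open>H\<close> is the radial limit of \<open>E\<close>, and the equivariance of
  \<open>E\<close> inside the disc passes to the limit along radii.\<close>

lemma H_equivariant: "circle_equivariant m H"
  unfolding circle_equivariant_def
proof
  fix z :: complex assume z: "z \<in> S1"
  have lim: "(\<lambda>n. E (of_real (1 - inverse (real (Suc n))) * y)) \<longlonglongrightarrow> H y" if y: "cmod y = 1" for y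
  proof -
    have "(\<lambda>n. 1 - inverse (real (Suc n))) \<longlonglongrightarrow> 1 - 0"
      by (intro tendsto_diff tendsto_const LIMSEQ_inverse_real_of_nat)
    then have "(\<lambda>n. complex_of_real (1 - inverse (real (Suc n))) * y) \<longlonglongrightarrow> of_real (1 - 0) * y"
      by (intro tendsto_mult tendsto_of_real tendsto_const)
    then have l: "(\<lambda>n. complex_of_real (1 - inverse (real (Suc n))) * y) \<longlonglongrightarrow> y" by simp
    have m: "complex_of_real (1 - inverse (real (Suc n))) * y \<in> cball 0 1" for n
    proof -
      have "inverse (real (Suc n)) \<le> 1" by (simp add: inverse_le_1_iff)
      then have "\<bar>1 - inverse (real (Suc n))\<bar> \<le> 1" by simp
      then show ?thesis using y by (simp only: mem_cball_0 norm_mult norm_of_real) simp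
    qed
    have "(\<lambda>n. E (of_real (1 - inverse (real (Suc n))) * y)) \<longlonglongrightarrow> E y"
      by (rule continuous_on_tendsto_compose[OF cont_E l]) (use m y in auto)
    then show ?thesis using y by (simp add: E_def)
  qed
  have "E (of_real (1 - inverse (real (Suc n))) * (circ (1 / m) * z))
      = circ (1 / m) * E (of_real (1 - inverse (real (Suc n))) * z)" for n
  proof -
    have i: "inverse (real (Suc n)) \<le> 1" "0 < inverse (real (Suc n))" by (simp_all add: inverse_le_1_iff)
    have "\<bar>1 - inverse (real (Suc n))\<bar> < 1" using i by simp
    then have "of_real (1 - inverse (real (Suc n))) * z \<in> ball 0 1"
      using z by (simp only: mem_ball_0 norm_mult norm_of_real) simp
    from E_rotate[OF this] show ?thesis by (simp only: mult.left_commute)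
  qed
  then have "(\<lambda>n. circ (1 / m) * E (of_real (1 - inverse (real (Suc n))) * z)) \<longlonglongrightarrow> H (circ (1 / m) * z)"
    using lim[of "circ (1 / m) * z"] z by (simp add: norm_mult)
  moreover have "(\<lambda>n. circ (1 / m) * E (of_real (1 - inverse (real (Suc n))) * z)) \<longlonglongrightarrow> circ (1 / m) * H z"
    using lim[of z] z by (intro tendsto_mult tendsto_const) simp
  ultimately show "H (circ (1 / real m) * z) = circ (1 / real m) * H z" using LIMSEQ_unique by blast
qed

section \<open>The rotation number and a wandering arc\<close>

lemma Hb_funpow_X: "(ext.Hb ^^ n) (spike.X \<theta>) = spike.X ((F ^^ n) \<theta>)"
  by (induction n) (simp_all add: ext.Hb_X)

lemma Hb_funpow_per: "(ext.Hb ^^ n) (x + of_int j) = (ext.Hb ^^ n) x + of_int j"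
  by (induction n) (simp_all add: Hb_per_int)

lemma Hb_funpow_less: "x < y \<Longrightarrow> (ext.Hb ^^ n) x < (ext.Hb ^^ n) y"
  by (induction n) (simp_all add: strict_mono_less[OF ext.strict_mono_Hb])

lemma c_funpow: "c ((F ^^ n) x) = c x + real n * \<tau>"
  by (induction n) (simp_all add: c_F algebra_simps)

text \<open>The orbit of 0 stays within bounded distance of the orbit of \<open>X 0\<close>, which
  is \<open>X\<close> of the \<open>F\<close>-orbit of 0. Both \<open>X\<close> and \<open>c\<close>
  are at bounded distance from the identity, and \<open>c\<close> turns \<open>F\<close> into the
  translation by \<open>\<tau>\<close>.\<close>

lemma Hb_funpow_bounded: obtains D where "\<And>n. \<bar>(ext.Hb ^^ n) 0 - real n * \<tau>\<bar> \<le> D"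
proof -
  obtain B' where B': "\<And>\<theta>. \<bar>spike.X \<theta> - \<theta>\<bar> \<le> B'" using spike.X_bound by blast
  obtain N :: nat where N: "\<bar>spike.X 0\<bar> < real N" using reals_Archimedean2 by blast
  have "\<bar>(ext.Hb ^^ n) 0 - real n * \<tau>\<bar> \<le> real N + B' + B + \<bar>c 0\<bar>" for n
  proof -
    have "(ext.Hb ^^ n) (0 + of_int (- int N)) < (ext.Hb ^^ n) (spike.X 0)"
      "(ext.Hb ^^ n) (spike.X 0) < (ext.Hb ^^ n) (0 + of_int (int N))"
      using N by (intro Hb_funpow_less; simp)+
    then have 1: "\<bar>(ext.Hb ^^ n) 0 - (ext.Hb ^^ n) (spike.X 0)\<bar> \<le> real N"
      unfolding Hb_funpow_per by simp
    have 2: "\<bar>(ext.Hb ^^ n) (spike.X 0) - (F ^^ n) 0\<bar> \<le> B'" unfolding Hb_funpow_X by (rule B')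
    have 3: "\<bar>c 0 + real n * \<tau> - (F ^^ n) 0\<bar> \<le> B" using c_bound[of "(F ^^ n) 0"] by (simp add: c_funpow)
    show ?thesis using 1 2 3 by linarith
  qed
  then show thesis using that by blast
qed

lemma H_rotation: "has_rotation_number H \<tau>"
  unfolding has_rotation_number_def
proof (intro exI[of _ ext.Hb] exI[of _ \<tau>] conjI)
  show "circle_lift ext.Hb H" by (rule H_lift)
  obtain D where D: "\<And>n. \<bar>(ext.Hb ^^ n) 0 - real n * \<tau>\<bar> \<le> D" using Hb_funpow_bounded by blast
  have "(\<lambda>n. (ext.Hb ^^ n) 0 / real n - \<tau>) \<longlonglongrightarrow> 0"
  proof (rule Lim_null_comparison)
    show "(\<lambda>n. D / real n) \<longlonglongrightarrow> 0" by (rule lim_const_over_n)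
    show "eventually (\<lambda>n. norm ((ext.Hb ^^ n) 0 / real n - \<tau>) \<le> D / real n) sequentially"
      using eventually_gt_at_top[of 0]
    proof eventually_elim
      case (elim n)
      then have "(ext.Hb ^^ n) 0 / real n - \<tau> = ((ext.Hb ^^ n) 0 - real n * \<tau>) / real n" by (simp add: field_simps)
      then show ?case using D[of n] elim by (simp add: divide_right_mono)
    qed
  qed
  then show "(\<lambda>n. (ext.Hb ^^ n) 0 / real n) \<longlonglongrightarrow> \<tau>" by (simp add: LIM_zero_iff)
qed simp

lemma F_funpow_per: "(F ^^ n) (x + of_int j) = (F ^^ n) x + of_int j"
proof (induction n)
  case (Suc n)
  then show ?case using periodic_int[where \<kappa> = F, OF F_per] by simp
qed simp

text \<open>After \<open>l\<close> rounds a periodic point would have moved by \<open>l * j\<close>,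
  and its value under \<open>c\<close> by \<open>l * n * \<tau>\<close>; the difference stays
  bounded for all \<open>l\<close> only if \<open>n * \<tau> = j\<close>, against
  irrationality.\<close>

lemma F_no_periodic: assumes n: "n \<ge> 1" shows "(F ^^ n) x \<noteq> x + of_int j"
proof
  assume eq: "(F ^^ n) x = x + of_int j"
  have it: "((F ^^ n) ^^ l) x = x + of_int (int l * j)" for l
  proof (induction l)
    case (Suc l)
    have "((F ^^ n) ^^ Suc l) x = (F ^^ n) (x + of_int (int l * j))" using Suc by simp
    also have "\<dots> = (F ^^ n) x + of_int (int l * j)" by (rule F_funpow_per)
    finally show ?case using eq by (simp add: algebra_simps)
  qed simp
  have "real l * \<bar>real n * \<tau> - j\<bar> \<le> 2 * B" for l :: nat
  proof -
    have "(F ^^ (l * n)) x = x + of_int (int l * j)" using it by (simp add: funpow_mult mult.commute)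
    then have "c (x + of_int (int l * j)) = c x + real (l * n) * \<tau>" using c_funpow by metis
    then have "\<bar>real (l * n) * \<tau> - real l * j\<bar> \<le> 2 * B"
      using c_bound[of x] c_bound[of "x + of_int (int l * j)"] by (simp add: abs_le_iff)
    moreover have "real (l * n) * \<tau> - real l * j = real l * (real n * \<tau> - j)" by (simp add: algebra_simps)
    ultimately show ?thesis by (simp add: abs_mult)
  qed
  then have "real n * \<tau> - j = 0"
    using reals_Archimedean3[of "\<bar>real n * \<tau> - j\<bar>"] by (metis abs_not_less_zero linorder_not_le zero_less_abs_iff)
  then have "\<tau> = of_int j / of_nat n" using n by (simp add: field_simps)
  then show False using \<tau> by (metis Rats_divide Rats_of_int Rats_of_nat)
qed

text \<open>The arc runs from the constant value of \<open>X\<close> on a gap to its value at the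
  right end \<open>\<beta>\<close> of that gap. Its images belong to image gaps in the same way. As
  \<open>\<beta>\<close> is not periodic modulo integers, the image gap has a different right end,
  so the gaps are disjoint and, by monotonicity of \<open>X\<close>, so are the arcs.\<close>

lemma wandering_arc:
  obtains a b where "a < b" "\<And>n j y. n \<ge> 1 \<Longrightarrow> a < y \<Longrightarrow> y < b \<Longrightarrow>
    \<not> (a < (ext.Hb ^^ n) y + of_int j \<and> (ext.Hb ^^ n) y + of_int j < b)"
proof -
  obtain x0 where x0: "x0 \<notin> C" using gap_point by blast
  obtain c1 where c1: "c1 \<in> C" using C_ne by blast
  \<comment> \<open>An integer translate of a point of \<open>C\<close> to the right of
    \<open>x0\<close>, so that \<open>C\<close> has a first point after \<open>x0\<close>.\<close>
  define c2 where "c2 = c1 + of_int (\<lceil>x0 - c1\<rceil> + 1)"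
  have c2: "c2 \<in> C" using c1 spike.C_per_int by (simp add: c2_def del: of_int_add)
  have "x0 < c2" unfolding c2_def by linarith
  then obtain \<beta> where \<beta>: "\<beta> \<in> C" "x0 < \<beta>" "{x0..<\<beta>} \<inter> C = {}"
    using closed_real_has_Inf_above[OF C_closed c2 _ x0] by metis
  have lt: "spike.X x0 < spike.X \<beta>"
  proof (rule spike.X_strict_left[OF \<beta>(1,2) _ \<beta>(2)])
    have "{x0<..<\<beta>} \<subseteq> {x0..<\<beta>}" by auto
    then show "{x0<..<\<beta>} \<inter> C = {}" using \<beta>(3) by blast
  qed
  have X_per: "spike.X (\<theta> + of_int j) = spike.X \<theta> + of_int j" for \<theta> j
  proof (rule spike.X_eqI)
    fix a assume "a < spike.X \<theta> + of_int j"
    then have lt: "a - of_int j < spike.X \<theta>" by simp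
    show "eventually (\<lambda>y. spike.V a y \<le> \<theta> + of_int j) (at_right 0)"
      using spike.X_less[OF lt] eventually_at_right_less[of 0]
    proof eventually_elim
      case (elim y)
      then show ?case using spike.V_per_int[of y "a - of_int j" j] by simp
    qed
  next
    fix b assume "spike.X \<theta> + of_int j < b"
    then have lt: "spike.X \<theta> < b - of_int j" by simp
    show "eventually (\<lambda>y. \<theta> + of_int j \<le> spike.V b y) (at_right 0)"
      using spike.X_gt[OF lt] eventually_at_right_less[of 0]
    proof eventually_elim
      case (elim y)
      then show ?case using spike.V_per_int[of y "b - of_int j" j] by simp
    qed
  qed
  show thesis
  proof (rule that[OF lt])
    fix n :: nat and j :: int and y
    assume n: "n \<ge> 1" and y: "spike.X x0 < y" "y < spike.X \<beta>"
    show "\<not> (spike.X x0 < (ext.Hb ^^ n) y + of_int j \<and> (ext.Hb ^^ n) y + of_int j < spike.X \<beta>)"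
    proof
      assume as: "spike.X x0 < (ext.Hb ^^ n) y + of_int j \<and> (ext.Hb ^^ n) y + of_int j < spike.X \<beta>"
      define x1 where "x1 = (F ^^ n) x0 + of_int j"
      define \<beta>1 where "\<beta>1 = (F ^^ n) \<beta> + of_int j"
      have FC: "(F ^^ n) x + of_int j \<in> C \<longleftrightarrow> x \<in> C" for x
        unfolding spike.C_per_int by (induction n) (simp_all add: F_C)
      have Fl: "u < v \<Longrightarrow> (F ^^ n) u < (F ^^ n) v" for u v
        by (induction n) (simp_all add: strict_mono_less[OF F_mono])
      have Fm: "strict_mono (F ^^ n)" using Fl by (rule strict_monoI)
      have Fs: "(F ^^ n) ((F' ^^ n) u) = u" for u
      proof (induction n arbitrary: u)
        case (Suc n)
        have "(F ^^ Suc n) ((F' ^^ Suc n) u) = F ((F ^^ n) ((F' ^^ n) (F' u)))" by (simp add: funpow_swap1)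
        then show ?case using Suc by simp
      qed simp
      have gap1: "{x1..<\<beta>1} \<inter> C = {}"
      proof (rule equals0I)
        fix v assume v: "v \<in> {x1..<\<beta>1} \<inter> C"
        define u where "u = (F' ^^ n) (v - of_int j)"
        have vu: "v = (F ^^ n) u + of_int j" by (simp add: u_def Fs)
        have "u \<in> C" using FC[of u] v vu by simp
        moreover have "(F ^^ n) x0 \<le> (F ^^ n) u" "(F ^^ n) u < (F ^^ n) \<beta>"
          using v vu by (simp_all add: x1_def \<beta>1_def)
        then have "x0 \<le> u" "u < \<beta>" by (simp_all add: strict_mono_less[OF Fm] strict_mono_less_eq[OF Fm])
        ultimately show False using \<beta>(3) by auto
      qed
      have \<beta>1C: "\<beta>1 \<in> C" using FC \<beta>(1) by (simp add: \<beta>1_def)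
      have l1: "spike.X x1 < (ext.Hb ^^ n) y + of_int j" "(ext.Hb ^^ n) y + of_int j < spike.X \<beta>1"
        using Hb_funpow_less[OF y(1), of n] Hb_funpow_less[OF y(2), of n]
        by (simp_all add: Hb_funpow_X X_per x1_def \<beta>1_def)
      have "\<beta>1 \<noteq> \<beta>" using F_no_periodic[OF n, of \<beta> "- j"] by (auto simp: \<beta>1_def)
      then consider "\<beta> < \<beta>1" | "\<beta>1 < \<beta>" by linarith
      then show False
      proof cases
        case 1
        then have "\<not> x1 \<le> \<beta>" using gap1 \<beta>(1) by auto
        then show False using spike.X_mono[of \<beta> x1] as l1 by simp
      next
        case 2
        then have "\<not> x0 \<le> \<beta>1" using \<beta>(3) \<beta>1C by auto
        then show False using spike.X_mono[of \<beta>1 x0] as l1 by simp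
      qed
    qed
  qed
qed

section \<open>No conjugacy to a rotation\<close>

lemma H_funpow_circ: "(H ^^ n) (circ x) = circ ((ext.Hb ^^ n) x)"
  by (induction n) (simp_all add: H_circ)

text \<open>Every rotation, rational or not, is recurrent: Dirichlet's theorem gives
  \<open>n \<ge> 1\<close> with \<open>n * \<alpha>\<close> close to an integer. A conjugacy would
  then return \<open>circ y\<close> to the wandering arc after \<open>n\<close> steps.\<close>

lemma H_not_rotation: "\<not> top_conj_circle H (\<lambda>z. circ \<alpha> * z)"
proof
  assume "top_conj_circle H (\<lambda>z. circ \<alpha> * z)"
  then obtain q q' where q: "homeomorphism S1 S1 q q'" and qH: "\<And>z. z \<in> S1 \<Longrightarrow> q (H z) = circ \<alpha> * q z"
    unfolding top_conj_circle_def by blast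
  obtain a b where ab: "a < b" and wand: "\<And>n j y. n \<ge> 1 \<Longrightarrow> a < y \<Longrightarrow> y < b \<Longrightarrow>
    \<not> (a < (ext.Hb ^^ n) y + of_int j \<and> (ext.Hb ^^ n) y + of_int j < b)" using wandering_arc by metis
  \<comment> \<open>An open subset of the plane whose trace on the circle is the wandering arc, so
    that continuity of \<open>q'\<close> can be used with balls of the plane.\<close>
  define W where "W = cexp ` ({s. a < Re s} \<inter> {s. Re s < b})"
  have oW: "open W" unfolding W_def
    by (intro open_cexp_image open_Int open_halfspace_Re_gt open_halfspace_Re_lt)
  have circW: "circ x \<in> W \<longleftrightarrow> (\<exists>j::int. a < x + of_int j \<and> x + of_int j < b)" for x
  proof
    assume "circ x \<in> W"
    then obtain s where s: "circ x = cexp s" "a < Re s" "Re s < b" by (auto simp: W_def)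
    then have "cexp s = cexp (of_real x)" using cexp_of_real[of x] by simp
    then obtain j :: int where "s = of_real x + of_int j" unfolding cexp_eq by blast
    then show "\<exists>j::int. a < x + of_int j \<and> x + of_int j < b" using s by (intro exI[of _ j]) simp
  next
    assume "\<exists>j::int. a < x + of_int j \<and> x + of_int j < b"
    then obtain j :: int where j: "a < x + of_int j" "x + of_int j < b" by blast
    have "circ x = cexp (of_real (x + of_int j))" unfolding cexp_of_real circ_eq
      by (intro exI[of _ "- j"]) simp
    then show "circ x \<in> W" using j by (auto simp: W_def)
  qed
  define y where "y = (a + b) / 2"
  have y: "a < y" "y < b" using ab by (auto simp: y_def)
  define p where "p = q (circ y)"
  have pS: "p \<in> S1" using homeomorphism_image1[OF q] by (auto simp: p_def)
  have q'p: "q' p = circ y" using homeomorphism_apply1[OF q, of "circ y"] by (simp add: p_def)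
  have "circ y \<in> W" using y by (intro circW[THEN iffD2] exI[of _ 0]) simp
  have cq': "continuous_on S1 q'" using homeomorphism_cont2[OF q] .
  obtain e where e: "e > 0" "\<And>z. z \<in> S1 \<Longrightarrow> dist z p < e \<Longrightarrow> q' z \<in> W"
  proof -
    obtain r where r: "r > 0" "ball (circ y) r \<subseteq> W" using oW \<open>circ y \<in> W\<close> open_contains_ball by blast
    obtain e where "e > 0" "\<And>z. z \<in> S1 \<Longrightarrow> dist z p < e \<Longrightarrow> dist (q' z) (q' p) < r"
      using cq' pS r(1) unfolding continuous_on_iff by blast
    then show thesis using that r(2) q'p by (metis dist_commute mem_ball subsetD)
  qed
  have "isCont circ 0" unfolding circ_def[abs_def] cis_conv_exp by (intro continuous_intros)
  then obtain \<delta> where \<delta>: "\<delta> > 0" "\<And>x. dist x 0 < \<delta> \<Longrightarrow> dist (circ x) (circ 0) < e"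
    using e(1) unfolding continuous_at_eps_delta by blast
  obtain N :: nat where N: "N > 0" "1 / real N < \<delta>"
    using \<delta>(1) by (metis nat_approx_posE zero_less_Suc)
  obtain j k0 where k0: "0 < k0" "\<bar>of_int k0 * \<alpha> - of_int j\<bar> < 1 / real N"
    using Dirichlet_approx[OF N(1), of \<alpha>] by metis
  define n where "n = nat k0"
  have n: "n \<ge> 1" "real n = of_int k0" using k0 by (auto simp: n_def)
  have "circ (real n * \<alpha>) = circ (real n * \<alpha> - of_int j)" unfolding circ_eq by (intro exI[of _ j]) simp
  moreover have "dist (circ (real n * \<alpha> - of_int j)) (circ 0) < e"
    using k0(2) N(2) n(2) by (intro \<delta>(2)) (simp add: dist_real_def)
  moreover have "circ 0 = 1" by (simp add: circ_def)
  ultimately have c1: "cmod (circ (real n * \<alpha>) - 1) < e" by (simp add: dist_norm)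
  have qn: "q ((H ^^ l) (circ y)) = circ (real l * \<alpha>) * p" for l
  proof (induction l)
    case 0
    then show ?case by (simp add: p_def circ_def)
  next
    case (Suc l)
    have "(H ^^ l) (circ y) \<in> S1" by (simp add: H_funpow_circ)
    then have "q ((H ^^ Suc l) (circ y)) = circ \<alpha> * (circ (real l * \<alpha>) * p)" using qH Suc by simp
    also have "\<dots> = circ (real (Suc l) * \<alpha>) * p"
      unfolding mult.assoc[symmetric] circ_add[symmetric] by (simp add: distrib_right)
    finally show ?case .
  qed
  let ?z = "circ (real n * \<alpha>) * p"
  have "dist ?z p = cmod ((circ (real n * \<alpha>) - 1) * p)" by (simp add: dist_norm algebra_simps)
  then have "dist ?z p < e" using c1 pS by (simp add: norm_mult)
  moreover have "?z \<in> S1" using pS by (simp add: norm_mult)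
  ultimately have "q' ?z \<in> W" using e(2) by blast
  moreover have "q' ?z = (H ^^ n) (circ y)"
    using homeomorphism_apply1[OF q, of "(H ^^ n) (circ y)"] qn[of n] by (simp add: H_funpow_circ)
  ultimately have "circ ((ext.Hb ^^ n) y) \<in> W" by (simp add: H_funpow_circ)
  then show False using wand[OF n(1) y] unfolding circW by blast
qed

lemma H_denjoy: "denjoy_map H"
  unfolding denjoy_map_def op_circle_homeo_def
  using H_lift H_rotation H_not_rotation \<tau> by blast

end

theorem theorem4p2:
  fixes \<tau> :: real and m :: nat
  assumes "\<tau> \<notin> \<rat>" and "m \<ge> 1"
  shows "\<exists>h. admissible h 0 \<and> plane_equivariant m h \<and>
           (\<exists>H. induced_prime_end_map h (basin h 0) H \<and> has_rotation_number H \<tau> \<and>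
              (\<exists>g. denjoy_map g \<and> circle_equivariant m g \<and> top_conj_circle H g))"
proof -
  obtain F F' c :: "real \<Rightarrow> real" and C B where
    "strict_mono F" "strict_mono F'" "\<And>x. F' (F x) = x" "\<And>x. F (F' x) = x"
    "\<And>x. F (x + 1 / m) = F x + 1 / m"
    "closed C" "C \<noteq> {}" "\<And>x. x + 1 / m \<in> C \<longleftrightarrow> x \<in> C" "\<And>a b. a < b \<Longrightarrow> \<exists>x. a < x \<and> x < b \<and> x \<notin> C"
    "\<And>x. F x \<in> C \<longleftrightarrow> x \<in> C" "\<And>x. c (F x) = c x + \<tau>" "\<And>x. \<bar>c x - x\<bar> \<le> B"
    by (rule denjoy_lift[OF assms]) (rule that)
  then interpret D: denjoy_data F F' c C B \<tau> m
    using assms by unfold_locales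
  have ne: "basin D.h 0 \<noteq> UNIV" using D.h_admissible by (simp add: admissible_def)
  obtain \<phi> \<psi> where "\<phi> holomorphic_on ball 0 1" "\<psi> holomorphic_on basin D.h 0"
    "\<And>z. z \<in> ball 0 1 \<Longrightarrow> \<phi> z \<in> basin D.h 0 \<and> \<psi> (\<phi> z) = z"
    "\<And>u. u \<in> basin D.h 0 \<Longrightarrow> \<psi> u \<in> ball 0 1 \<and> \<phi> (\<psi> u) = u" "\<phi> 0 = 0" "\<psi> 0 = 0"
    by (rule riemann_map_normalized[OF D.open_U D.simply_connected_U ne D.zero_U]) (rule that)
  then interpret R: denjoy_riemann F F' c C B \<tau> m \<phi> \<psi>
    by unfold_locales
  have "top_conj_circle R.H R.H"
    unfolding top_conj_circle_def
    by (intro exI[of _ "\<lambda>z. z"]) (auto intro: homeomorphism_ident)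
  then show ?thesis
    using D.h_admissible D.h_equivariant R.H_induced R.H_rotation R.H_denjoy R.H_equivariant by blast
qed

end
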